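(* Let $(X,\omega)$, $\Gamma$, $\Lambda$, $\alpha$, $\Omega$, $m$, $p_{s,t}$, $J=\{\zeta_1<\zeta_2<\cdots\}$, $J_R$ and $\phi$ be as described in the context. Let $s_0\in(0,1)$, $\Omega^0=\{(s,t)\in\Omega: s_0\le s\le 1\}$, and let $A=[a,b)\times(0,c)\subset\mathbb{R}^2$ with $a<b$, $c>0$ and $b-a<\zeta_1\alpha s_0$. Define $k'=\max\{k\in\mathbb{N}:\zeta_k\le cs_0\}$ and $k''=\max\{k\in\mathbb{N}:\zeta_k\le c\}$. Then $$\frac{2(b-a)}{\alpha}I_2\ \le\ \int_{\Omega^0}\#(p_{s,t}\Lambda\cap A)\,dm(s,t)\ =\ \frac{2(b-a)}{\alpha}\,(I_1+I_2+I_3),$$ where $$I_1=\frac{\zeta_{k'+1}-cs_0}{c}\sum_{j\in J_{cs_0}}\frac{\phi(j)}{j},$$ $$I_2=\sum_{\ell=1}^{k''-1}\left(\frac{\zeta_{\ell+1}-\zeta_\ell}{c}\sum_{j\in J_{\zeta_{\ell+1}}}\frac{\phi(j)}{j}\right)-\sum_{\ell=1}^{k'}\left(\frac{\zeta_{\ell+1}-\zeta_\ell}{c}\sum_{j\in J_{\zeta_{\ell+1}}}\frac{\phi(j)}{j}\right),$$ $$I_3=\left(\frac{c-\zeta_{k''}}{c}\right)\sum_{j\in J_c}\frac{\phi(j)}{j}.$$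
   Context: $(X,\omega)$ is a lattice surface: a compact Riemann surface with a holomorphic 1-form whose Veech group $\Gamma$ (stabilizer of $(X,\omega)$ under the $SL(2,\mathbb{R})$-action on translation surfaces) is a lattice in $SL(2,\mathbb{R})$. Standing assumptions: $SL(2,\mathbb{R})/\Gamma$ has only one cusp, $-\mathrm{Id}\in\Gamma$, and $(X,\omega)$ has a horizontal saddle connection of length $1$ and no shorter horizontal saddle connection. $\Lambda\subset\mathbb{R}^2$ is the set of visible holonomy vectors: the shortest holonomy vector $\int_\gamma\omega\in\mathbb{C}\cong\mathbb{R}^2$ of a saddle connection $\gamma$ in each direction. So $\Lambda$ is discrete, $\Gamma$-invariant and contains $(1,0)^{\mathsf T}$. Let $\alpha>0$ be such that $\begin{bmatrix}1&\alpha\\0&1\end{bmatrix}$ generates the stabilizer of $(1,0)^{\mathsf T}$ in $\Gamma$. $\Omega=\{(s,t)\in\mathbb{R}^2:0<s\le1,\ 1-\alpha s<t\le1\}$; $m$ is normalized Lebesgue (probability) measure on $\Omega$; $p_{s,t}=\begin{bmatrix}s&t\\0&s^{-1}\end{bmatrix}$. $J=\{\zeta_1<\zeta_2<\cdots\}$ is the (discrete) set of positive second coordinates of vectors in $\Lambda$, listed increasingly; $J_R=J\cap(0,R)$ for $R>0$. For $j\in J$, $\phi(j)=\#\{x\in\mathbb{R}:(x,j)\in\Lambda,\ 0\le x<\alpha j\}$.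
   Formalization: The printed equality fails when cs_0 lies in J; it is proved for cs_0 not in J, and for cs_0 in J with the sum in I_1 taken over all j ≤ cs_0 instead of j < cs_0; the lower bound holds in all cases, and k', k'' are read as 0 if no ζ_k qualifies. *)

theory Defs
  imports "HOL-Analysis.Analysis"
begin

section \<open>Translation surfaces\<close>

text \<open>
  The underlying topological space of a surface is a whole type \<open>'a :: t2_space\<close>.
  A chart is a pair \<open>(U, z)\<close>; only the values of \<open>z\<close> on \<open>U\<close> matter.  A 1-form \<open>\<omega>\<close> is given
  by its coefficient functions: on the chart \<open>\<kappa> = (U, z)\<close> it reads \<open>form X \<kappa> z dz\<close>.
\<close>

type_synonym 'a chart = "'a set \<times> ('a \<Rightarrow> complex)"

record 'a form_surface =
  charts :: "'a chart set"
  form :: "'a chart \<Rightarrow> complex \<Rightarrow> complex"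

definition complex_chart :: "'a::t2_space chart \<Rightarrow> bool" where
  "complex_chart \<kappa> \<longleftrightarrow> open (fst \<kappa>) \<and> open (snd \<kappa> ` fst \<kappa>) \<and>
     (\<exists>g. homeomorphism (fst \<kappa>) (snd \<kappa> ` fst \<kappa>) (snd \<kappa>) g)"

definition chart_inv :: "'a chart \<Rightarrow> complex \<Rightarrow> 'a" where
  "chart_inv \<kappa> = inv_into (fst \<kappa>) (snd \<kappa>)"

definition transition :: "'a chart \<Rightarrow> 'a chart \<Rightarrow> complex \<Rightarrow> complex" where
  "transition \<kappa> \<kappa>' = snd \<kappa>' \<circ> chart_inv \<kappa>"

definition compact_riemann_surface :: "'a::t2_space chart set \<Rightarrow> bool" where
  "compact_riemann_surface C \<longleftrightarrow>
     compact (UNIV :: 'a set) \<and> connected (UNIV :: 'a set) \<and>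
     (\<forall>\<kappa>\<in>C. complex_chart \<kappa>) \<and> (\<Union>\<kappa>\<in>C. fst \<kappa>) = UNIV \<and>
     (\<forall>\<kappa>\<in>C. \<forall>\<kappa>'\<in>C. transition \<kappa> \<kappa>' holomorphic_on snd \<kappa> ` (fst \<kappa> \<inter> fst \<kappa>'))"

definition holomorphic_one_form ::
    "'a chart set \<Rightarrow> ('a chart \<Rightarrow> complex \<Rightarrow> complex) \<Rightarrow> bool" where
  "holomorphic_one_form C f \<longleftrightarrow>
     (\<forall>\<kappa>\<in>C. f \<kappa> holomorphic_on snd \<kappa> ` fst \<kappa>) \<and>
     (\<forall>\<kappa>\<in>C. \<forall>\<kappa>'\<in>C. \<forall>w \<in> snd \<kappa> ` (fst \<kappa> \<inter> fst \<kappa>').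
        f \<kappa> w = f \<kappa>' (transition \<kappa> \<kappa>' w) * deriv (transition \<kappa> \<kappa>') w)"

definition translation_surface :: "'a::t2_space form_surface \<Rightarrow> bool" where
  "translation_surface X \<longleftrightarrow>
     compact_riemann_surface (charts X) \<and> holomorphic_one_form (charts X) (form X) \<and>
     (\<exists>\<kappa>\<in>charts X. \<exists>w \<in> snd \<kappa> ` fst \<kappa>. form X \<kappa> w \<noteq> 0)"

definition form_zeros :: "'a form_surface \<Rightarrow> 'a set" where
  "form_zeros X = {p. \<exists>\<kappa>\<in>charts X. p \<in> fst \<kappa> \<and> form X \<kappa> (snd \<kappa> p) = 0}"

text \<open>
  \<open>dh = \<omega>\<close> on the open set \<open>U\<close>.  Away from the zeros of \<open>\<omega>\<close>, such functions \<open>h\<close> are locally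
  exactly the flat (natural) coordinates of the translation surface.
\<close>

definition local_primitive ::
    "'a::t2_space form_surface \<Rightarrow> 'a set \<Rightarrow> ('a \<Rightarrow> complex) \<Rightarrow> bool" where
  "local_primitive X U h \<longleftrightarrow> open U \<and>
     (\<forall>\<kappa>\<in>charts X. \<forall>w \<in> snd \<kappa> ` (fst \<kappa> \<inter> U).
        ((\<lambda>w. h (chart_inv \<kappa> w)) has_field_derivative form X \<kappa> w) (at w))"

text \<open>Primitive of \<open>\<omega>\<close> along a path, so that \<open>F t - F 0\<close> is the integral of \<open>\<omega>\<close> over \<open>\<gamma>\<close>
  restricted to \<open>{0..t}\<close>.\<close>

definition primitive_along ::
    "'a::t2_space form_surface \<Rightarrow> (real \<Rightarrow> 'a) \<Rightarrow> (real \<Rightarrow> complex) \<Rightarrow> bool" where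
  "primitive_along X \<gamma> F \<longleftrightarrow>
     (\<forall>t\<in>{0..1}. \<exists>U h. local_primitive X U h \<and> \<gamma> t \<in> U \<and>
        (\<exists>\<delta>>0. \<forall>s\<in>{0..1}. \<bar>s - t\<bar> < \<delta> \<longrightarrow> \<gamma> s \<in> U \<and> F s = h (\<gamma> s)))"

definition has_form_integral ::
    "'a::t2_space form_surface \<Rightarrow> complex \<Rightarrow> (real \<Rightarrow> 'a) \<Rightarrow> bool" where
  "has_form_integral X I \<gamma> \<longleftrightarrow> (\<exists>F. primitive_along X \<gamma> F \<and> I = F 1 - F 0)"

text \<open>
  A saddle connection is a geodesic of the flat metric \<open>\<bar>\<omega>\<bar>\<close> (parametrized with constant speed,
  hence a straight segment in the flat coordinates) joining two possibly equal zeros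
  of \<open>\<omega>\<close>, without zeros in its interior.
\<close>

definition saddle_connection :: "'a::t2_space form_surface \<Rightarrow> (real \<Rightarrow> 'a) \<Rightarrow> bool" where
  "saddle_connection X \<gamma> \<longleftrightarrow>
     path \<gamma> \<and> pathstart \<gamma> \<in> form_zeros X \<and> pathfinish \<gamma> \<in> form_zeros X \<and>
     (\<forall>t\<in>{0<..<1}. \<gamma> t \<notin> form_zeros X) \<and>
     (\<exists>F v. primitive_along X \<gamma> F \<and> v \<noteq> 0 \<and> (\<forall>t\<in>{0..1}. F t = F 0 + of_real t * v))"

definition plane_vec :: "complex \<Rightarrow> real^2" where
  "plane_vec z = vector [Re z, Im z]"

definition holonomy_vectors :: "'a::t2_space form_surface \<Rightarrow> (real^2) set" where
  "holonomy_vectors X =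
     {plane_vec I | I \<gamma>. saddle_connection X \<gamma> \<and> has_form_integral X I \<gamma>}"

definition visible_holonomy :: "'a::t2_space form_surface \<Rightarrow> (real^2) set" where
  "visible_holonomy X =
     {v \<in> holonomy_vectors X. \<forall>r>0. r *\<^sub>R v \<in> holonomy_vectors X \<longrightarrow> norm v \<le> norm (r *\<^sub>R v)}"


section \<open>The action of \<open>SL(2,\<real>)\<close> and Veech groups\<close>

definition SL2 :: "(real^2^2) set" where
  "SL2 = {g. det g = 1}"

definition act_complex :: "real^2^2 \<Rightarrow> complex \<Rightarrow> complex" where
  "act_complex g z = Complex ((g *v plane_vec z) $ 1) ((g *v plane_vec z) $ 2)"

text \<open>
  \<open>Y\<close> is \<open>g \<cdot> X\<close>: same topological surface, flat coordinates composed with \<open>g\<close>.  The holomorphic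
  charts of \<open>g \<cdot> X\<close> are not those of \<open>X\<close>, but the local primitives determine the complex
  structure and the 1-form, so \<open>Y\<close> is unique up to the choice of a compatible atlas.
\<close>

definition is_SL2_image ::
    "real^2^2 \<Rightarrow> 'a::t2_space form_surface \<Rightarrow> 'a form_surface \<Rightarrow> bool" where
  "is_SL2_image g X Y \<longleftrightarrow> translation_surface Y \<and>
     (\<forall>U h. local_primitive X U h \<longleftrightarrow> local_primitive Y U (act_complex g \<circ> h))"

text \<open>A biholomorphic map pulling back the form of \<open>Y\<close> to the form of \<open>X\<close>.\<close>

definition translation_isomorphism ::
    "'a::t2_space form_surface \<Rightarrow> 'b::t2_space form_surface \<Rightarrow> ('a \<Rightarrow> 'b) \<Rightarrow> bool" where
  "translation_isomorphism X Y f \<longleftrightarrow> (\<exists>f'. homeomorphism UNIV UNIV f f') \<and>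
     (\<forall>\<kappa>\<in>charts X. \<forall>\<kappa>'\<in>charts Y.
        let D = snd \<kappa> ` (fst \<kappa> \<inter> f -` fst \<kappa>'); \<tau> = snd \<kappa>' \<circ> f \<circ> chart_inv \<kappa>
        in \<tau> holomorphic_on D \<and> (\<forall>w\<in>D. form X \<kappa> w = form Y \<kappa>' (\<tau> w) * deriv \<tau> w))"

definition veech_group :: "'a::t2_space form_surface \<Rightarrow> (real^2^2) set" where
  "veech_group X =
     {g \<in> SL2. \<exists>Y. is_SL2_image g X Y \<and> (\<exists>f. translation_isomorphism X Y f)}"


section \<open>Lattices in \<open>SL(2,\<real>)\<close> and their cusps\<close>

definition SL2_subgroup :: "(real^2^2) set \<Rightarrow> bool" where
  "SL2_subgroup \<Gamma> \<longleftrightarrow> \<Gamma> \<subseteq> SL2 \<and> mat 1 \<in> \<Gamma> \<and>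
     (\<forall>g\<in>\<Gamma>. \<forall>h\<in>\<Gamma>. g ** h \<in> \<Gamma>) \<and> (\<forall>g\<in>\<Gamma>. matrix_inv g \<in> \<Gamma>)"

text \<open>The Haar measure of \<open>E \<subseteq> SL(2,\<real>)\<close>, up to a constant, as the Lebesgue measure
  in \<open>\<real>\<^sup>4\<close> of the cone over \<open>E\<close>.\<close>

definition SL2_haar :: "(real^2^2) set \<Rightarrow> ennreal" where
  "SL2_haar E = emeasure lborel {r *\<^sub>R g | r g. 0 < r \<and> r \<le> 1 \<and> g \<in> E}"

text \<open>\<open>E\<close> below is a Borel fundamental domain for \<open>SL(2,\<real>)/\<Gamma>\<close>, so \<open>SL2_haar E\<close> is the covolume.\<close>

definition lattice_SL2 :: "(real^2^2) set \<Rightarrow> bool" where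
  "lattice_SL2 \<Gamma> \<longleftrightarrow> SL2_subgroup \<Gamma> \<and> discrete \<Gamma> \<and>
     (\<exists>E. E \<in> sets borel \<and> E \<subseteq> SL2 \<and> (\<forall>g\<in>SL2. \<exists>!h. h \<in> \<Gamma> \<and> g ** h \<in> E) \<and>
          SL2_haar E < \<infinity>)"

definition parabolic :: "real^2^2 \<Rightarrow> bool" where
  "parabolic g \<longleftrightarrow> g \<in> SL2 \<and> g \<noteq> mat 1 \<and> g \<noteq> - mat 1 \<and> \<bar>trace g\<bar> = 2"

text \<open>Cusps are the \<open>\<Gamma>\<close>-orbits of the lines in \<open>\<real>\<^sup>2\<close> (points of the projective line, the boundary
  of the hyperbolic plane) fixed by a parabolic element of \<open>\<Gamma>\<close>.\<close>

definition parabolic_lines :: "(real^2^2) set \<Rightarrow> (real^2) set set" where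
  "parabolic_lines \<Gamma> =
     {span {v} | v. v \<noteq> 0 \<and> (\<exists>g\<in>\<Gamma>. parabolic g \<and> g *v v \<in> span {v})}"

definition cusps :: "(real^2^2) set \<Rightarrow> (real^2) set set set" where
  "cusps \<Gamma> = parabolic_lines \<Gamma> //
     {(l, l'). l \<in> parabolic_lines \<Gamma> \<and> l' \<in> parabolic_lines \<Gamma> \<and> (\<exists>g\<in>\<Gamma>. l' = (*v) g ` l)}"

definition lattice_surface :: "'a::t2_space form_surface \<Rightarrow> bool" where
  "lattice_surface X \<longleftrightarrow> translation_surface X \<and> lattice_SL2 (veech_group X)"

definition upper_unipotent :: "real \<Rightarrow> real^2^2" where
  "upper_unipotent x = vector [vector [1, x], vector [0, 1]]"

text \<open>\<open>\<alpha> > 0\<close> and \<open>upper_unipotent \<alpha>\<close> generates the stabilizer of \<open>(1,0)\<close> in \<open>\<Gamma>\<close>; note that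
  \<open>upper_unipotent (n * \<alpha>)\<close> is the \<open>n\<close>-th power of \<open>upper_unipotent \<alpha>\<close>.\<close>

definition stabilizer_width :: "(real^2^2) set \<Rightarrow> real \<Rightarrow> bool" where
  "stabilizer_width \<Gamma> \<alpha> \<longleftrightarrow> \<alpha> > 0 \<and>
     {g \<in> \<Gamma>. g *v vector [1, 0] = vector [1, 0]} =
     range (\<lambda>n::int. upper_unipotent (of_int n * \<alpha>))"


section \<open>The transversal and the counting data\<close>

definition Omega :: "real \<Rightarrow> (real \<times> real) set" where
  "Omega \<alpha> = {(s, t). 0 < s \<and> s \<le> 1 \<and> 1 - \<alpha> * s < t \<and> t \<le> 1}"

definition Omega0 :: "real \<Rightarrow> real \<Rightarrow> (real \<times> real) set" where
  "Omega0 \<alpha> s0 = {(s, t) \<in> Omega \<alpha>. s0 \<le> s \<and> s \<le> 1}"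

definition Omega_measure :: "real \<Rightarrow> (real \<times> real) measure" where
  "Omega_measure \<alpha> = uniform_measure lborel (Omega \<alpha>)"

definition p_matrix :: "real \<Rightarrow> real \<Rightarrow> real^2^2" where
  "p_matrix s t = vector [vector [s, t], vector [0, inverse s]]"

definition box_A :: "real \<Rightarrow> real \<Rightarrow> real \<Rightarrow> (real^2) set" where
  "box_A a b c = {v. a \<le> v $ 1 \<and> v $ 1 < b \<and> 0 < v $ 2 \<and> v $ 2 < c}"

definition heights :: "(real^2) set \<Rightarrow> real set" where
  "heights \<Lambda> = {v $ 2 | v. v \<in> \<Lambda> \<and> 0 < v $ 2}"

definition heights_below :: "(real^2) set \<Rightarrow> real \<Rightarrow> real set" where
  "heights_below \<Lambda> R = heights \<Lambda> \<inter> {0<..<R}"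

text \<open>\<open>zeta \<Lambda> k\<close> for \<open>k \<ge> 1\<close> is the \<open>k\<close>-th smallest height; \<open>zeta \<Lambda> 0 = 0\<close> is a convention.\<close>

primrec zeta :: "(real^2) set \<Rightarrow> nat \<Rightarrow> real" where
  "zeta \<Lambda> 0 = 0"
| "zeta \<Lambda> (Suc k) = Inf {j \<in> heights \<Lambda>. zeta \<Lambda> k < j}"

definition phi :: "(real^2) set \<Rightarrow> real \<Rightarrow> real \<Rightarrow> nat" where
  "phi \<Lambda> \<alpha> j = card {x::real. vector [x, j] \<in> \<Lambda> \<and> 0 \<le> x \<and> x < \<alpha> * j}"

definition phi_sum :: "(real^2) set \<Rightarrow> real \<Rightarrow> real \<Rightarrow> real" where
  "phi_sum \<Lambda> \<alpha> R = (\<Sum>j\<in>heights_below \<Lambda> R. real (phi \<Lambda> \<alpha> j) / j)"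

text \<open>Because \<open>zeta \<Lambda> 0 = 0\<close>, the value is \<open>0\<close> if no height is \<open>\<le> x\<close> (and \<open>x \<ge> 0\<close>).\<close>

definition last_index :: "(real^2) set \<Rightarrow> real \<Rightarrow> nat" where
  "last_index \<Lambda> x = Max {k. zeta \<Lambda> k \<le> x}"

definition I1 :: "(real^2) set \<Rightarrow> real \<Rightarrow> real \<Rightarrow> real \<Rightarrow> real" where
  "I1 \<Lambda> \<alpha> c s0 =
     (zeta \<Lambda> (last_index \<Lambda> (c * s0) + 1) - c * s0) / c * phi_sum \<Lambda> \<alpha> (c * s0)"

definition I2 :: "(real^2) set \<Rightarrow> real \<Rightarrow> real \<Rightarrow> real \<Rightarrow> real" where
  "I2 \<Lambda> \<alpha> c s0 =
     (\<Sum>l = 1..last_index \<Lambda> c - 1.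
        (zeta \<Lambda> (l + 1) - zeta \<Lambda> l) / c * phi_sum \<Lambda> \<alpha> (zeta \<Lambda> (l + 1))) -
     (\<Sum>l = 1..last_index \<Lambda> (c * s0).
        (zeta \<Lambda> (l + 1) - zeta \<Lambda> l) / c * phi_sum \<Lambda> \<alpha> (zeta \<Lambda> (l + 1)))"

definition I3 :: "(real^2) set \<Rightarrow> real \<Rightarrow> real \<Rightarrow> real" where
  "I3 \<Lambda> \<alpha> c = (c - zeta \<Lambda> (last_index \<Lambda> c)) / c * phi_sum \<Lambda> \<alpha> c"

text \<open>
  \<open>I1\<close> with the sum over the heights \<open>< zeta (k' + 1)\<close>, that is, over all heights \<open>\<le> c * s0\<close>.  It
  differs from \<open>I1\<close> exactly if \<open>c * s0\<close> is itself a height: the integrand then jumps at the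
  endpoint \<open>s = s0\<close>, and \<open>I1\<close>, whose sum omits the height \<open>c * s0\<close>, is too small.
\<close>

definition I1_jump :: "(real^2) set \<Rightarrow> real \<Rightarrow> real \<Rightarrow> real \<Rightarrow> real" where
  "I1_jump \<Lambda> \<alpha> c s0 =
     (zeta \<Lambda> (last_index \<Lambda> (c * s0) + 1) - c * s0) / c *
       phi_sum \<Lambda> \<alpha> (zeta \<Lambda> (last_index \<Lambda> (c * s0) + 1))"

definition orbit_count :: "(real^2) set \<Rightarrow> (real^2) set \<Rightarrow> real \<times> real \<Rightarrow> real" where
  "orbit_count \<Lambda> A = (\<lambda>(s, t). real (card ((*v) (p_matrix s t) ` \<Lambda> \<inter> A)))"

end

theory Submission
  imports Defs "HOL-Complex_Analysis.Conformal_Mappings"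
begin

text \<open>
  Fix \<open>s\<close>.  A vector \<open>(x, j)\<close> of \<open>\<Lambda>\<close> is mapped into the box by \<open>p_matrix s t\<close> exactly if
  \<open>0 < j < c * s\<close> and \<open>t\<close> lies in \<open>[(a - s * x) / j, (b - s * x) / j)\<close>.  Replacing \<open>x\<close> by
  \<open>x + \<alpha> * j\<close>, which the generator of the stabilizer of \<open>(1, 0)\<close> does, moves this interval by
  \<open>- \<alpha> * s\<close>, and \<open>\<alpha> * s\<close> is the length of the fibre \<open>1 - \<alpha> * s < t \<le> 1\<close> of \<open>\<Omega>\<close> over \<open>s\<close>.  Hence the
  vectors of height \<open>j\<close> form \<open>\<phi> j\<close> classes, and the pieces that the fibre cuts out of the intervals
  of one class fit together to one interval of length \<open>(b - a) / j\<close> (\<open>measure_tiles\<close>).  The integral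
  of the count over the fibre is therefore \<open>(b - a) * \<Phi> (c * s)\<close>, where \<open>\<Phi> R\<close> is the sum of
  \<open>\<phi> j / j\<close> over the heights \<open>j < R\<close>.  As \<open>\<Omega>\<close> has area \<open>\<alpha> / 2\<close>, the integral over \<open>\<Omega>\<^sup>0\<close> is
  \<open>2 * (b - a) / \<alpha>\<close> times the integral of \<open>\<Phi> (c * s)\<close> over \<open>s0 \<le> s \<le> 1\<close>.  Now \<open>\<Phi>\<close> is a step
  function that jumps at the heights.  Cutting \<open>{c * s0..c}\<close> at the heights inside it gives the three
  terms: the part before the first of these heights, the part between the first and the last, and
  the part after the last (\<open>I_sum_eq\<close>).

  This argument needs three facts about the visible holonomy vectors.

  Invariance under the Veech group (\<open>visible_holonomy_veech\<close>): primitives of the form along a path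
  are transported by the linear action and by isomorphisms.  The zeros are transported as well,
  because they can be recognized from primitives alone: a point is not a zero if and only if some
  primitive is injective near it.

  Only finitely many of them in each disc (\<open>finite_holonomy_vectors_bounded\<close>): each point of the
  surface has a compact neighbourhood, contained in the domain of a primitive, that a path starting
  near the point cannot leave as long as the integral of the form along it stays small
  (\<open>flat_trap_exists\<close>).  Finitely many such neighbourhoods are enough, so a saddle connection of
  length at most \<open>R\<close> can be cut into a number of pieces that depends only on \<open>R\<close>, each inside one of
  the neighbourhoods.  Its holonomy is then a sum of differences of two primitives at points where
  two neighbourhoods overlap, and of values of primitives at zeros of the form.  Differences of
  primitives are locally constant, hence take finitely many values on a compact set, and there
  are finitely many zeros.

  Heights are unbounded (\<open>lattice_not_upper_triangular\<close>, \<open>heights_unbounded_of_orbit\<close>): if every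
  element of the Veech group preserved the horizontal direction, the group would consist of the
  powers of one unipotent matrix up to sign, and its covolume would be infinite.  So some element \<open>g\<close>
  moves \<open>(1, 0)\<close> off the horizontal axis; applying a high power of the unipotent generator and then
  \<open>g\<close> again moves it arbitrarily high.
\<close>

section \<open>Matrices of size two and their action on the plane\<close>

lemma matrix_eq_iff_2: "(A :: real^2^2) = B \<longleftrightarrow>
    A $ 1 $ 1 = B $ 1 $ 1 \<and> A $ 1 $ 2 = B $ 1 $ 2 \<and> A $ 2 $ 1 = B $ 2 $ 1 \<and> A $ 2 $ 2 = B $ 2 $ 2"
  by (auto simp: vec_eq_iff forall_2)

lemma matrix_mult_upper_unipotent:
  "(M ** upper_unipotent \<kappa>) $ i $ 1 = M $ i $ 1"
  "(M ** upper_unipotent \<kappa>) $ i $ 2 = M $ i $ 2 + \<kappa> * M $ i $ 1"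
  for M :: "real^2^2"
  by (simp_all add: upper_unipotent_def matrix_matrix_mult_def sum_2)

lemma det_scaleR_2: "det (r *\<^sub>R M) = r\<^sup>2 * det (M :: real^2^2)"
  by (simp add: det_2 power2_eq_square algebra_simps)

lemma matrix_mult_uminus: "M ** (- N) = - (M ** N)" for M N :: "real^2^2"
  by (simp add: matrix_eq_iff_2 matrix_matrix_mult_def sum_2)

lemma scaleR_matrix_mult: "(r *\<^sub>R M) ** N = r *\<^sub>R (M ** N)" for M N :: "real^2^2"
  by (simp add: matrix_eq_iff_2 matrix_matrix_mult_def sum_2 algebra_simps)

lemma matrix_vector_2:
  "((M :: real^2^2) *v v) $ 1 = M $ 1 $ 1 * v $ 1 + M $ 1 $ 2 * v $ 2"
  "((M :: real^2^2) *v v) $ 2 = M $ 2 $ 1 * v $ 1 + M $ 2 $ 2 * v $ 2"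
  by (simp_all add: matrix_vector_mult_def sum_2)

lemma vector_eq_iff_2: "(v :: real^2) = w \<longleftrightarrow> v $ 1 = w $ 1 \<and> v $ 2 = w $ 2"
  by (auto simp: vec_eq_iff forall_2)

lemma plane_vec_act: "plane_vec (act_complex g z) = g *v plane_vec z"
  by (simp add: plane_vec_def act_complex_def vec_eq_iff forall_2)

lemma plane_vec_inj: "plane_vec z = plane_vec w \<longleftrightarrow> z = w"
  by (simp add: plane_vec_def vec_eq_iff forall_2 complex_eq_iff)

lemma norm_plane_vec: "norm (plane_vec z) = cmod z"
  by (simp add: plane_vec_def norm_vec_def L2_set_def sum_2 cmod_def)

lemma act_complex_add: "act_complex g (z + w) = act_complex g z + act_complex g w"
  by (simp add: act_complex_def plane_vec_def complex_eq_iff matrix_vector_mult_def sum_2 algebra_simps)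

lemma act_complex_diff: "act_complex g (z - w) = act_complex g z - act_complex g w"
  by (simp add: act_complex_def plane_vec_def complex_eq_iff matrix_vector_mult_def sum_2 algebra_simps)

lemma act_complex_scale: "act_complex g (of_real r * z) = of_real r * act_complex g z"
  by (simp add: act_complex_def plane_vec_def complex_eq_iff matrix_vector_mult_def sum_2 algebra_simps)

lemma SL2_inverse:
  assumes "g \<in> SL2"
  shows "g ** matrix_inv g = mat 1" "matrix_inv g ** g = mat 1"
proof -
  have "invertible g" using assms by (simp add: SL2_def invertible_det_nz)
  then show "g ** matrix_inv g = mat 1" "matrix_inv g ** g = mat 1"
    unfolding invertible_def matrix_inv_def by (metis (mono_tags, lifting) someI_ex)+
qed

lemma SL2_inverse_vec:
  assumes "g \<in> SL2"
  shows "g *v (matrix_inv g *v v) = v" "matrix_inv g *v (g *v v) = v"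
  by (simp_all add: matrix_vector_mul_assoc SL2_inverse[OF assms])

lemma act_complex_inverse:
  assumes "g \<in> SL2"
  shows "act_complex g (act_complex (matrix_inv g) z) = z" "act_complex (matrix_inv g) (act_complex g z) = z"
  using SL2_inverse_vec[OF assms] by (metis plane_vec_act plane_vec_inj)+

lemma inj_act_complex:
  assumes "g \<in> SL2"
  shows "inj (act_complex g)"
  by (metis act_complex_inverse(2)[OF assms] injI)

section \<open>Charts and local primitives\<close>

lemma complex_chartD:
  assumes "complex_chart \<kappa>"
  shows "open (fst \<kappa>)" "open (snd \<kappa> ` fst \<kappa>)" "inj_on (snd \<kappa>) (fst \<kappa>)"
    "continuous_on (fst \<kappa>) (snd \<kappa>)" "continuous_on (snd \<kappa> ` fst \<kappa>) (chart_inv \<kappa>)"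
proof -
  obtain g where g: "homeomorphism (fst \<kappa>) (snd \<kappa> ` fst \<kappa>) (snd \<kappa>) g"
    using assms unfolding complex_chart_def by auto
  have eq: "g (snd \<kappa> p) = p" if "p \<in> fst \<kappa>" for p
    using g that by (auto simp: homeomorphism_def)
  show inj: "inj_on (snd \<kappa>) (fst \<kappa>)"
    by (rule inj_on_inverseI[where g = g]) (rule eq)
  have "chart_inv \<kappa> w = g w" if "w \<in> snd \<kappa> ` fst \<kappa>" for w
    using that eq inj by (auto simp: chart_inv_def)
  then show "continuous_on (snd \<kappa> ` fst \<kappa>) (chart_inv \<kappa>)"
    using g by (subst continuous_on_cong[OF refl, where g = g]) (auto simp: homeomorphism_def)
  show "open (fst \<kappa>)" "open (snd \<kappa> ` fst \<kappa>)" "continuous_on (fst \<kappa>) (snd \<kappa>)"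
    using assms g by (auto simp: complex_chart_def homeomorphism_def)
qed

lemma chart_inv_chart [simp]:
  assumes "complex_chart \<kappa>" "p \<in> fst \<kappa>"
  shows "chart_inv \<kappa> (snd \<kappa> p) = p"
  using complex_chartD(3)[OF assms(1)] assms(2) by (auto simp: chart_inv_def)

lemma open_chart_image:
  assumes "complex_chart \<kappa>" "open V"
  shows "open (snd \<kappa> ` (fst \<kappa> \<inter> V))"
proof -
  have "snd \<kappa> ` (fst \<kappa> \<inter> V) = snd \<kappa> ` fst \<kappa> \<inter> chart_inv \<kappa> -` V"
  proof (intro equalityI subsetI)
    fix w assume "w \<in> snd \<kappa> ` (fst \<kappa> \<inter> V)"
    then obtain p where "p \<in> fst \<kappa>" "p \<in> V" "w = snd \<kappa> p" by blast
    then show "w \<in> snd \<kappa> ` fst \<kappa> \<inter> chart_inv \<kappa> -` V" by (simp add: assms(1))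
  next
    fix w assume "w \<in> snd \<kappa> ` fst \<kappa> \<inter> chart_inv \<kappa> -` V"
    then obtain p where p: "p \<in> fst \<kappa>" "w = snd \<kappa> p" "chart_inv \<kappa> w \<in> V" by blast
    then have "p \<in> V" using chart_inv_chart[OF assms(1)] by metis
    then show "w \<in> snd \<kappa> ` (fst \<kappa> \<inter> V)"
      by (intro image_eqI[where x = p] IntI p)
  qed
  moreover have "open (snd \<kappa> ` fst \<kappa> \<inter> chart_inv \<kappa> -` V)"
    by (intro continuous_open_preimage complex_chartD assms)
  ultimately show ?thesis by simp
qed

lemma open_chart_vimage:
  assumes "complex_chart \<kappa>" "open B"
  shows "open (fst \<kappa> \<inter> snd \<kappa> -` B)"
  by (intro continuous_open_preimage complex_chartD assms)

lemma surface_chart: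
  assumes "translation_surface X" "\<kappa> \<in> charts X"
  shows "complex_chart \<kappa>"
  using assms by (auto simp: translation_surface_def compact_riemann_surface_def)

lemma surface_covered:
  assumes "translation_surface X"
  obtains \<kappa> where "\<kappa> \<in> charts X" "p \<in> fst \<kappa>"
  using assms unfolding translation_surface_def compact_riemann_surface_def
  by (metis UNIV_I UN_E)

lemma form_holomorphic:
  assumes "translation_surface X" "\<kappa> \<in> charts X"
  shows "form X \<kappa> holomorphic_on snd \<kappa> ` fst \<kappa>"
  using assms by (auto simp: translation_surface_def holomorphic_one_form_def)

lemma transition_holomorphic:
  assumes "translation_surface X" "\<kappa> \<in> charts X" "\<kappa>' \<in> charts X"
  shows "transition \<kappa> \<kappa>' holomorphic_on snd \<kappa> ` (fst \<kappa> \<inter> fst \<kappa>')"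
  using assms by (auto simp: translation_surface_def compact_riemann_surface_def)

text \<open>
  A transition map is injective, so its derivative has no zeros.  It follows that vanishing of
  the form at a point is independent of the chart.
\<close>

lemma form_transition:
  assumes X: "translation_surface X" and \<kappa>: "\<kappa> \<in> charts X" "\<kappa>' \<in> charts X"
    and p: "p \<in> fst \<kappa>" "p \<in> fst \<kappa>'"
  shows "form X \<kappa> (snd \<kappa> p) = form X \<kappa>' (snd \<kappa>' p) * deriv (transition \<kappa> \<kappa>') (snd \<kappa> p)"
    and "(transition \<kappa> \<kappa>' has_field_derivative deriv (transition \<kappa> \<kappa>') (snd \<kappa> p)) (at (snd \<kappa> p))"
    and "deriv (transition \<kappa> \<kappa>') (snd \<kappa> p) \<noteq> 0"
proof -
  let ?D = "snd \<kappa> ` (fst \<kappa> \<inter> fst \<kappa>')"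
  have c: "complex_chart \<kappa>" "complex_chart \<kappa>'" using surface_chart[OF X] \<kappa> by blast+
  have o: "open ?D" using open_chart_image[OF c(1)] complex_chartD(1)[OF c(2)] by blast
  have w: "snd \<kappa> p \<in> ?D" using p by auto
  have "transition \<kappa> \<kappa>' (snd \<kappa> p) = snd \<kappa>' p" using c p by (simp add: transition_def)
  then show "form X \<kappa> (snd \<kappa> p) = form X \<kappa>' (snd \<kappa>' p) * deriv (transition \<kappa> \<kappa>') (snd \<kappa> p)"
    using X \<kappa> w unfolding translation_surface_def holomorphic_one_form_def by metis
  have hol: "transition \<kappa> \<kappa>' holomorphic_on ?D" using transition_holomorphic X \<kappa> by blast
  show "(transition \<kappa> \<kappa>' has_field_derivative deriv (transition \<kappa> \<kappa>') (snd \<kappa> p)) (at (snd \<kappa> p))"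
    using holomorphic_derivI[OF hol o w] .
  have "inj_on (transition \<kappa> \<kappa>') ?D"
  proof (rule inj_onI)
    fix x y assume "x \<in> ?D" "y \<in> ?D" and eq: "transition \<kappa> \<kappa>' x = transition \<kappa> \<kappa>' y"
    then obtain q q' where q: "q \<in> fst \<kappa>" "q \<in> fst \<kappa>'" "x = snd \<kappa> q"
      and q': "q' \<in> fst \<kappa>" "q' \<in> fst \<kappa>'" "y = snd \<kappa> q'" by blast
    have "snd \<kappa>' q = snd \<kappa>' q'"
      using eq q q' c by (simp add: transition_def)
    then show "x = y"
      using inj_onD[OF complex_chartD(3)[OF c(2)]] q q' by metis
  qed
  then show "deriv (transition \<kappa> \<kappa>') (snd \<kappa> p) \<noteq> 0"
    using holomorphic_injective_imp_regular[OF hol o _ w] by blast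
qed

lemma local_primitive_derivative:
  assumes "local_primitive X U h" "\<kappa> \<in> charts X" "p \<in> fst \<kappa>" "p \<in> U"
  shows "((\<lambda>w. h (chart_inv \<kappa> w)) has_field_derivative form X \<kappa> (snd \<kappa> p)) (at (snd \<kappa> p))"
  using assms by (auto simp: local_primitive_def)

text \<open>
  A primitive in one chart is a primitive in all charts, by the chain rule and the
  transformation rule of the form.
\<close>

lemma local_primitive_of_chart:
  assumes X: "translation_surface X" and \<kappa>: "\<kappa> \<in> charts X" and B: "open B" "B \<subseteq> snd \<kappa> ` fst \<kappa>"
    and H: "\<And>w. w \<in> B \<Longrightarrow> (H has_field_derivative form X \<kappa> w) (at w)"
  shows "local_primitive X (fst \<kappa> \<inter> snd \<kappa> -` B) (H \<circ> snd \<kappa>)"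
  unfolding local_primitive_def
proof (intro conjI ballI)
  show "open (fst \<kappa> \<inter> snd \<kappa> -` B)"
    using open_chart_vimage surface_chart X \<kappa> B by blast
next
  fix \<kappa>' w assume \<kappa>': "\<kappa>' \<in> charts X" and "w \<in> snd \<kappa>' ` (fst \<kappa>' \<inter> (fst \<kappa> \<inter> snd \<kappa> -` B))"
  then obtain p where p: "p \<in> fst \<kappa>'" "p \<in> fst \<kappa>" "snd \<kappa> p \<in> B" "w = snd \<kappa>' p" by auto
  have c: "complex_chart \<kappa>" "complex_chart \<kappa>'" using surface_chart[OF X] \<kappa> \<kappa>' by blast+
  have tr: "transition \<kappa>' \<kappa> (snd \<kappa>' p) = snd \<kappa> p" using c p by (simp add: transition_def)
  note ft = form_transition[OF X \<kappa>' \<kappa> p(1,2)]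
  have "(H has_field_derivative form X \<kappa> (snd \<kappa> p)) (at (transition \<kappa>' \<kappa> (snd \<kappa>' p)))"
    using H p tr by auto
  from DERIV_chain[OF this ft(2)] ft(1)
  show "((\<lambda>w. (H \<circ> snd \<kappa>) (chart_inv \<kappa>' w)) has_field_derivative form X \<kappa>' w) (at w)"
    using p by (simp add: transition_def o_def)
qed

lemma chart_primitive:
  assumes X: "translation_surface X" and \<kappa>: "\<kappa> \<in> charts X" and p: "p \<in> fst \<kappa>"
  obtains r H where "r > 0" "ball (snd \<kappa> p) r \<subseteq> snd \<kappa> ` fst \<kappa>"
    "\<And>w. w \<in> ball (snd \<kappa> p) r \<Longrightarrow> (H has_field_derivative form X \<kappa> w) (at w)"
proof -
  have "open (snd \<kappa> ` fst \<kappa>)" using complex_chartD surface_chart X \<kappa> by blast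
  then obtain r where r: "r > 0" "ball (snd \<kappa> p) r \<subseteq> snd \<kappa> ` fst \<kappa>"
    using p by (meson imageI openE)
  have "form X \<kappa> holomorphic_on ball (snd \<kappa> p) r"
    using form_holomorphic[OF X \<kappa>] r holomorphic_on_subset by blast
  then obtain H where "\<And>w. w \<in> ball (snd \<kappa> p) r \<Longrightarrow>
      (H has_field_derivative form X \<kappa> w) (at w within ball (snd \<kappa> p) r)"
    using holomorphic_convex_primitive'[of "ball (snd \<kappa> p) r" "form X \<kappa>"] by auto
  then have "\<And>w. w \<in> ball (snd \<kappa> p) r \<Longrightarrow> (H has_field_derivative form X \<kappa> w) (at w)"
    by (metis at_within_open open_ball)
  with r that show ?thesis by blast
qed

lemma local_primitive_diff_locally_constant:
  assumes X: "translation_surface X" and h: "local_primitive X U h" "local_primitive X U' h'"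
    and p: "p \<in> U" "p \<in> U'"
  obtains W where "open W" "p \<in> W" "W \<subseteq> U \<inter> U'" "\<And>q. q \<in> W \<Longrightarrow> h q - h' q = h p - h' p"
proof -
  obtain \<kappa> where \<kappa>: "\<kappa> \<in> charts X" "p \<in> fst \<kappa>" using surface_covered X by blast
  have c: "complex_chart \<kappa>" using surface_chart[OF X] \<kappa> by blast+
  have "open (U \<inter> U')" using h by (auto simp: local_primitive_def)
  then have "open (snd \<kappa> ` (fst \<kappa> \<inter> (U \<inter> U')))" using open_chart_image c by blast
  moreover have "snd \<kappa> p \<in> snd \<kappa> ` (fst \<kappa> \<inter> (U \<inter> U'))" using p \<kappa> by auto
  ultimately obtain r where r: "r > 0" "ball (snd \<kappa> p) r \<subseteq> snd \<kappa> ` (fst \<kappa> \<inter> (U \<inter> U'))"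
    by (meson openE)
  let ?d = "\<lambda>w. h (chart_inv \<kappa> w) - h' (chart_inv \<kappa> w)"
  have "\<exists>k. \<forall>w\<in>ball (snd \<kappa> p) r. ?d w = k"
  proof (rule has_field_derivative_zero_constant)
    fix w assume "w \<in> ball (snd \<kappa> p) r"
    then obtain q where q: "q \<in> fst \<kappa>" "q \<in> U" "q \<in> U'" "w = snd \<kappa> q" using r by blast
    show "(?d has_field_derivative 0) (at w within ball (snd \<kappa> p) r)"
      using DERIV_diff[OF local_primitive_derivative[OF h(1) \<kappa>(1) q(1,2)]
          local_primitive_derivative[OF h(2) \<kappa>(1) q(1,3)]] q(4)
      by (simp add: has_field_derivative_at_within)
  qed auto
  then have k: "?d w = ?d (snd \<kappa> p)" if "w \<in> ball (snd \<kappa> p) r" for w using that r by auto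
  let ?W = "fst \<kappa> \<inter> snd \<kappa> -` ball (snd \<kappa> p) r"
  show ?thesis
  proof
    show "open ?W" using open_chart_vimage c by blast
    show "p \<in> ?W" using \<kappa> r by auto
    show "?W \<subseteq> U \<inter> U'"
    proof
      fix q assume q: "q \<in> ?W"
      then have "snd \<kappa> q \<in> snd \<kappa> ` (fst \<kappa> \<inter> (U \<inter> U'))" using r(2) by blast
      then obtain q' where q': "q' \<in> fst \<kappa>" "q' \<in> U \<inter> U'" "snd \<kappa> q = snd \<kappa> q'" by blast
      then have "q = q'" using inj_onD[OF complex_chartD(3)[OF c]] q by blast
      then show "q \<in> U \<inter> U'" using q' by simp
    qed
    show "h q - h' q = h p - h' p" if "q \<in> ?W" for q
      using k[of "snd \<kappa> q"] that c \<kappa> by simp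
  qed
qed

section \<open>Zeros of the form\<close>

lemma compact_surface:
  assumes "translation_surface (X :: 'a::t2_space form_surface)"
  shows "compact (UNIV :: 'a set)"
  using assms by (simp add: translation_surface_def compact_riemann_surface_def)

lemma form_zeros_iff:
  assumes X: "translation_surface X" and \<kappa>: "\<kappa> \<in> charts X" "p \<in> fst \<kappa>"
  shows "p \<in> form_zeros X \<longleftrightarrow> form X \<kappa> (snd \<kappa> p) = 0"
proof
  assume "p \<in> form_zeros X"
  then obtain \<kappa>' where \<kappa>': "\<kappa>' \<in> charts X" "p \<in> fst \<kappa>'" "form X \<kappa>' (snd \<kappa>' p) = 0"
    by (auto simp: form_zeros_def)
  then show "form X \<kappa> (snd \<kappa> p) = 0"
    using form_transition(1)[OF X \<kappa>(1) \<kappa>'(1) \<kappa>(2) \<kappa>'(2)] by simp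
qed (use \<kappa> in \<open>auto simp: form_zeros_def\<close>)

text \<open>
  A holomorphic function is injective near a point if and only if its derivative does not vanish
  there.  The right-hand side mentions no charts, which makes it usable for comparing two
  complex structures on the same space.
\<close>

lemma form_zeros_iff_no_injective_primitive:
  assumes X: "translation_surface X"
  shows "p \<notin> form_zeros X \<longleftrightarrow> (\<exists>U h. p \<in> U \<and> local_primitive X U h \<and> inj_on h U)"
proof -
  obtain \<kappa> where \<kappa>: "\<kappa> \<in> charts X" "p \<in> fst \<kappa>" using surface_covered X by blast
  have c: "complex_chart \<kappa>" using surface_chart[OF X] \<kappa> by blast+
  show ?thesis
  proof
    assume "p \<notin> form_zeros X"
    then have nz: "form X \<kappa> (snd \<kappa> p) \<noteq> 0" using form_zeros_iff[OF X \<kappa>] by simp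
    obtain r H where r: "r > 0" "ball (snd \<kappa> p) r \<subseteq> snd \<kappa> ` fst \<kappa>"
      and H: "\<And>w. w \<in> ball (snd \<kappa> p) r \<Longrightarrow> (H has_field_derivative form X \<kappa> w) (at w)"
      using chart_primitive[OF X \<kappa>] by blast
    have "deriv H (snd \<kappa> p) \<noteq> 0" using H[of "snd \<kappa> p"] nz r DERIV_imp_deriv by force
    moreover have "H holomorphic_on ball (snd \<kappa> p) r" using H
      by (meson holomorphic_on_open open_ball)
    ultimately obtain r' where r': "r' > 0" "ball (snd \<kappa> p) r' \<subseteq> ball (snd \<kappa> p) r"
      "inj_on H (ball (snd \<kappa> p) r')"
      using has_complex_derivative_locally_injective[of H "ball (snd \<kappa> p) r" "snd \<kappa> p"] r(1) by auto
    let ?U = "fst \<kappa> \<inter> snd \<kappa> -` ball (snd \<kappa> p) r'"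
    have "local_primitive X ?U (H \<circ> snd \<kappa>)"
      using local_primitive_of_chart[OF X \<kappa>(1), of "ball (snd \<kappa> p) r'" H] r r' H by blast
    moreover have "inj_on (H \<circ> snd \<kappa>) ?U"
    proof (rule comp_inj_on)
      show "inj_on (snd \<kappa>) ?U" by (rule inj_on_subset[OF complex_chartD(3)[OF c]]) blast
      show "inj_on H (snd \<kappa> ` ?U)" by (rule inj_on_subset[OF r'(3)]) blast
    qed
    moreover have "p \<in> ?U" using \<kappa> r' by auto
    ultimately show "\<exists>U h. p \<in> U \<and> local_primitive X U h \<and> inj_on h U"
      by (intro exI[of _ ?U] exI[of _ "H \<circ> snd \<kappa>"] conjI)
  next
    assume "\<exists>U h. p \<in> U \<and> local_primitive X U h \<and> inj_on h U"
    then obtain U h where h: "p \<in> U" "local_primitive X U h" "inj_on h U" by blast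
    let ?D = "snd \<kappa> ` (fst \<kappa> \<inter> U)"
    have o: "open ?D" using h(2) by (intro open_chart_image[OF c]) (simp add: local_primitive_def)
    have d: "((\<lambda>w. h (chart_inv \<kappa> w)) has_field_derivative form X \<kappa> w) (at w)" if "w \<in> ?D" for w
      using h that \<kappa> by (auto simp: local_primitive_def)
    then have "(\<lambda>w. h (chart_inv \<kappa> w)) holomorphic_on ?D" using holomorphic_on_open o by blast
    moreover have "inj_on (\<lambda>w. h (chart_inv \<kappa> w)) ?D"
    proof (rule inj_onI)
      fix x y assume "x \<in> ?D" "y \<in> ?D" and eq: "h (chart_inv \<kappa> x) = h (chart_inv \<kappa> y)"
      then obtain q q' where "q \<in> fst \<kappa>" "q \<in> U" "x = snd \<kappa> q" "q' \<in> fst \<kappa>" "q' \<in> U" "y = snd \<kappa> q'"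
        by blast
      then show "x = y" using eq c inj_onD[OF h(3), of q q'] by simp
    qed
    ultimately have "deriv (\<lambda>w. h (chart_inv \<kappa> w)) (snd \<kappa> p) \<noteq> 0"
      using holomorphic_injective_imp_regular o \<kappa> h by blast
    moreover have "snd \<kappa> p \<in> ?D" using \<kappa> h by blast
    ultimately have "form X \<kappa> (snd \<kappa> p) \<noteq> 0" using DERIV_imp_deriv[OF d] by metis
    then show "p \<notin> form_zeros X" using form_zeros_iff[OF X \<kappa>] by simp
  qed
qed

text \<open>
  The interior of the set of zeros is closed as well as open, by the identity theorem in a disc
  around a limit point.  On a connected surface it is therefore empty or everything, and the latter
  is excluded because the form of a translation surface is not identically zero.
\<close>

lemma interior_form_zeros:
  assumes X: "translation_surface X"
  shows "interior (form_zeros X) = {}"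
proof -
  have "closed (interior (form_zeros X))"
    unfolding closed_def
  proof (subst open_subopen, intro ballI)
    fix p assume p: "p \<in> - interior (form_zeros X)"
    obtain \<kappa> where \<kappa>: "\<kappa> \<in> charts X" "p \<in> fst \<kappa>" using surface_covered X by blast
    have c: "complex_chart \<kappa>" using surface_chart[OF X \<kappa>(1)] .
    obtain r where r: "r > 0" "ball (snd \<kappa> p) r \<subseteq> snd \<kappa> ` fst \<kappa>"
      using complex_chartD(2)[OF c] \<kappa>(2) by (meson imageI openE)
    let ?B = "ball (snd \<kappa> p) r" let ?W = "fst \<kappa> \<inter> snd \<kappa> -` ?B"
    have oW: "open ?W" by (rule open_chart_vimage[OF c]) simp
    have pW: "p \<in> ?W" using \<kappa> r by simp
    have hol: "form X \<kappa> holomorphic_on ?B"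
      using form_holomorphic[OF X \<kappa>(1)] r(2) holomorphic_on_subset by blast
    have "?W \<inter> interior (form_zeros X) = {}"
    proof (rule ccontr)
      assume "?W \<inter> interior (form_zeros X) \<noteq> {}"
      then obtain q where q: "q \<in> ?W" "q \<in> interior (form_zeros X)" by blast
      let ?N = "snd \<kappa> ` (fst \<kappa> \<inter> (?W \<inter> interior (form_zeros X)))"
      have oN: "open ?N" by (rule open_chart_image[OF c]) (simp add: oW open_Int)
      have z: "form X \<kappa> w = 0" if w: "w \<in> ?N" for w
      proof -
        obtain q' where "q' \<in> fst \<kappa>" "q' \<in> interior (form_zeros X)" "w = snd \<kappa> q'" using w by blast
        then show ?thesis using form_zeros_iff[OF X \<kappa>(1)] interior_subset by blast
      qed
      have N: "?N \<noteq> {}" "?N \<subseteq> ?B" using q by blast+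
      have "form X \<kappa> w = 0" if "w \<in> ?B" for w
        by (rule analytic_continuation_open[OF oN open_ball N(1) connected_ball N(2) hol, of "\<lambda>_. 0"])
          (use z that in auto)
      then have "?W \<subseteq> form_zeros X" using form_zeros_iff[OF X \<kappa>(1)] by blast
      then have "p \<in> interior (form_zeros X)" using oW pW by (meson interiorI)
      then show False using p by simp
    qed
    then show "\<exists>T. open T \<and> p \<in> T \<and> T \<subseteq> - interior (form_zeros X)" using oW pW by blast
  qed
  moreover have "connected (UNIV :: 'a set)"
    using X by (simp add: translation_surface_def compact_riemann_surface_def)
  ultimately have "interior (form_zeros X) = {} \<or> interior (form_zeros X) = UNIV"
    using connected_clopen[of "UNIV :: 'a set"] by (simp add: open_openin[symmetric] closed_closedin[symmetric])
  moreover have "interior (form_zeros X) \<noteq> UNIV"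
  proof
    assume U: "interior (form_zeros X) = UNIV"
    obtain \<kappa> w where \<kappa>: "\<kappa> \<in> charts X" "w \<in> snd \<kappa> ` fst \<kappa>" "form X \<kappa> w \<noteq> 0"
      using X by (auto simp: translation_surface_def)
    then obtain p where p: "p \<in> fst \<kappa>" "w = snd \<kappa> p" by blast
    have "p \<in> form_zeros X" using U interior_subset by blast
    then show False using form_zeros_iff[OF X \<kappa>(1) p(1)] p(2) \<kappa>(3) by simp
  qed
  ultimately show ?thesis by blast
qed

lemma form_nonzero_nearby:
  assumes X: "translation_surface X" and \<kappa>: "\<kappa> \<in> charts X" "p \<in> fst \<kappa>" and r: "r > 0"
  shows "\<exists>w\<in>ball (snd \<kappa> p) r \<inter> snd \<kappa> ` fst \<kappa>. form X \<kappa> w \<noteq> 0"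
proof -
  let ?W = "fst \<kappa> \<inter> snd \<kappa> -` ball (snd \<kappa> p) r"
  have "open ?W" using open_chart_vimage[OF surface_chart[OF X \<kappa>(1)]] by blast
  moreover have "p \<in> ?W" using \<kappa> r by simp
  ultimately have "\<not> ?W \<subseteq> form_zeros X" using interior_form_zeros[OF X] interiorI by blast
  then obtain q where "q \<in> ?W" "q \<notin> form_zeros X" by blast
  then show ?thesis using form_zeros_iff[OF X \<kappa>(1)] by blast
qed

lemma form_zeros_isolated:
  assumes X: "translation_surface X"
  shows "\<exists>W. open W \<and> p \<in> W \<and> form_zeros X \<inter> W \<subseteq> {p}"
proof -
  obtain \<kappa> where \<kappa>: "\<kappa> \<in> charts X" "p \<in> fst \<kappa>" using surface_covered X by blast
  have c: "complex_chart \<kappa>" using surface_chart[OF X \<kappa>(1)] .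
  show ?thesis
  proof (cases "p \<in> form_zeros X")
    case True
    then have z: "form X \<kappa> (snd \<kappa> p) = 0" using form_zeros_iff[OF X \<kappa>] by simp
    obtain r where r: "r > 0" "ball (snd \<kappa> p) r \<subseteq> snd \<kappa> ` fst \<kappa>"
      using complex_chartD(2)[OF c] \<kappa>(2) by (meson imageI openE)
    let ?B = "ball (snd \<kappa> p) r"
    have hol: "form X \<kappa> holomorphic_on ?B"
      using form_holomorphic[OF X \<kappa>(1)] r(2) holomorphic_on_subset by blast
    obtain \<beta> where \<beta>: "\<beta> \<in> ?B" "form X \<kappa> \<beta> \<noteq> 0" using form_nonzero_nearby[OF X \<kappa> r(1)] by blast
    have zB: "snd \<kappa> p \<in> ?B" using r(1) by simp
    obtain e where e: "e > 0" "ball (snd \<kappa> p) e \<subseteq> ?B"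
      "\<And>w. w \<in> ball (snd \<kappa> p) e - {snd \<kappa> p} \<Longrightarrow> form X \<kappa> w \<noteq> 0"
      by (rule isolated_zeros[OF hol open_ball connected_ball zB z \<beta>]) (rule that)
    let ?W = "fst \<kappa> \<inter> snd \<kappa> -` ball (snd \<kappa> p) e"
    have "form_zeros X \<inter> ?W \<subseteq> {p}"
    proof
      fix q assume q: "q \<in> form_zeros X \<inter> ?W"
      then have "form X \<kappa> (snd \<kappa> q) = 0" using form_zeros_iff[OF X \<kappa>(1)] by blast
      then have "snd \<kappa> q = snd \<kappa> p" using e(3)[of "snd \<kappa> q"] q by blast
      then have "q = p" using inj_onD[OF complex_chartD(3)[OF c]] q \<kappa>(2) by blast
      then show "q \<in> {p}" by simp
    qed
    moreover have "open ?W" using open_chart_vimage[OF c] by blast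
    moreover have "p \<in> ?W" using \<kappa> e by simp
    ultimately show ?thesis by blast
  next
    case False
    then obtain U h where h: "p \<in> U" "local_primitive X U h" "inj_on h U"
      using form_zeros_iff_no_injective_primitive[OF X] by blast
    then have "q \<notin> form_zeros X" if "q \<in> U" for q
      using form_zeros_iff_no_injective_primitive[OF X] that by blast
    moreover have "open U" using h by (simp add: local_primitive_def)
    ultimately show ?thesis using h(1) by blast
  qed
qed

lemma finite_form_zeros:
  assumes X: "translation_surface X"
  shows "finite (form_zeros X)"
proof -
  obtain W where "\<forall>p. open (W p) \<and> p \<in> W p \<and> form_zeros X \<inter> W p \<subseteq> {p}"
    using choice[OF allI[OF form_zeros_isolated[OF X]]] by (rule exE)
  then have W: "open (W p)" "p \<in> W p" "form_zeros X \<inter> W p \<subseteq> {p}" for p by simp_all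
  obtain C where C: "finite C" "UNIV \<subseteq> (\<Union>p\<in>C. W p)"
  proof (rule compactE_image[OF compact_surface[OF X], of UNIV W])
    show "UNIV \<subseteq> (\<Union>p\<in>UNIV. W p)" using W(2) by auto
  qed (use W(1) in auto)
  have "form_zeros X \<subseteq> C"
  proof
    fix q assume q: "q \<in> form_zeros X"
    obtain p where p: "p \<in> C" "q \<in> W p" using C(2) by blast
    then have "q \<in> {p}" using W[of p] q by blast
    then show "q \<in> C" using p by simp
  qed
  then show ?thesis using C(1) finite_subset by blast
qed

section \<open>Holonomy vectors and the Veech group\<close>

text \<open>
  The charts of \<open>Y\<close> and of \<open>X\<close> are unrelated, only their primitives correspond.  This suffices by
  the description of the zeros in terms of injective primitives.
\<close>

lemma form_zeros_SL2_image:
  assumes X: "translation_surface X" and g: "g \<in> SL2" and Y: "is_SL2_image g X Y"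
  shows "form_zeros Y = form_zeros X"
proof -
  have tY: "translation_surface Y" using Y by (simp add: is_SL2_image_def)
  have lp: "local_primitive X U h \<longleftrightarrow> local_primitive Y U (act_complex g \<circ> h)" for U h
    using Y by (simp add: is_SL2_image_def)
  have "(\<exists>U h. p \<in> U \<and> local_primitive X U h \<and> inj_on h U) \<longleftrightarrow>
        (\<exists>U h. p \<in> U \<and> local_primitive Y U h \<and> inj_on h U)" for p
  proof
    assume "\<exists>U h. p \<in> U \<and> local_primitive X U h \<and> inj_on h U"
    then obtain U h where h: "p \<in> U" "local_primitive X U h" "inj_on h U" by blast
    have "inj_on (act_complex g \<circ> h) U"
      by (rule comp_inj_on[OF h(3) inj_on_subset[OF inj_act_complex[OF g]]]) simp
    then show "\<exists>U h. p \<in> U \<and> local_primitive Y U h \<and> inj_on h U"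
      using lp h by blast
  next
    assume "\<exists>U h. p \<in> U \<and> local_primitive Y U h \<and> inj_on h U"
    then obtain U h where h: "p \<in> U" "local_primitive Y U h" "inj_on h U" by blast
    let ?h = "act_complex (matrix_inv g) \<circ> h"
    have "act_complex g \<circ> ?h = h" by (simp add: fun_eq_iff act_complex_inverse[OF g])
    then have "local_primitive X U ?h" using lp h by simp
    moreover have "inj_on ?h U"
      by (rule comp_inj_on[OF h(3)], rule inj_on_inverseI[where g = "act_complex g"])
        (rule act_complex_inverse[OF g])
    ultimately show "\<exists>U h. p \<in> U \<and> local_primitive X U h \<and> inj_on h U"
      using h(1) by blast
  qed
  then have "p \<notin> form_zeros Y \<longleftrightarrow> p \<notin> form_zeros X" for p
    using form_zeros_iff_no_injective_primitive[OF X] form_zeros_iff_no_injective_primitive[OF tY]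
    by simp
  then show ?thesis by blast
qed

text \<open>
  Both the path and its parametrization remain the same; only the primitive is composed with the
  linear map.
\<close>

lemma primitive_along_SL2_image:
  assumes Y: "is_SL2_image g X Y" and F: "primitive_along X \<gamma> F"
  shows "primitive_along Y \<gamma> (act_complex g \<circ> F)"
  unfolding primitive_along_def
proof
  fix t :: real assume "t \<in> {0..1}"
  then obtain U h \<delta> where h: "local_primitive X U h" "\<gamma> t \<in> U" "\<delta> > 0"
    "\<forall>s\<in>{0..1}. \<bar>s - t\<bar> < \<delta> \<longrightarrow> \<gamma> s \<in> U \<and> F s = h (\<gamma> s)"
    using F unfolding primitive_along_def by meson
  have "local_primitive Y U (act_complex g \<circ> h)" using Y h by (simp add: is_SL2_image_def)
  then show "\<exists>U h. local_primitive Y U h \<and> \<gamma> t \<in> U \<and> (\<exists>\<delta>>0. \<forall>s\<in>{0..1}. \<bar>s - t\<bar> < \<delta> \<longrightarrow>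
      \<gamma> s \<in> U \<and> (act_complex g \<circ> F) s = h (\<gamma> s))"
    using h(2-) by (intro exI[of _ U] exI[of _ "act_complex g \<circ> h"] conjI exI[of _ \<delta>]) auto
qed

lemma has_form_integral_SL2_image:
  assumes "is_SL2_image g X Y" "has_form_integral X I \<gamma>"
  shows "has_form_integral Y (act_complex g I) \<gamma>"
  using assms primitive_along_SL2_image unfolding has_form_integral_def
  by (metis act_complex_diff comp_apply)

lemma saddle_connection_SL2_image:
  assumes X: "translation_surface X" and g: "g \<in> SL2" and Y: "is_SL2_image g X Y"
    and \<gamma>: "saddle_connection X \<gamma>"
  shows "saddle_connection Y \<gamma>"
proof -
  obtain F v where F: "primitive_along X \<gamma> F" "v \<noteq> 0" "\<forall>t\<in>{0..1}. F t = F 0 + of_real t * v"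
    using \<gamma> by (auto simp: saddle_connection_def)
  have "act_complex g v \<noteq> 0"
  proof
    assume "act_complex g v = 0"
    then have "act_complex g v = act_complex g 0" using act_complex_scale[of g 0 0] by simp
    then show False using inj_act_complex[OF g] F(2) by (simp add: inj_eq)
  qed
  moreover have "\<forall>t\<in>{0..1}. (act_complex g \<circ> F) t = (act_complex g \<circ> F) 0 + of_real t * act_complex g v"
    using F(3) by (metis act_complex_add act_complex_scale comp_apply)
  ultimately have "\<exists>F v. primitive_along Y \<gamma> F \<and> v \<noteq> 0 \<and> (\<forall>t\<in>{0..1}. F t = F 0 + of_real t * v)"
    using primitive_along_SL2_image[OF Y F(1)] by blast
  then show ?thesis
    using \<gamma> form_zeros_SL2_image[OF X g Y] by (simp add: saddle_connection_def)
qed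

text \<open>
  The map read in charts is injective because the isomorphism is a homeomorphism, so its derivative
  is nonzero: zeros are neither created nor destroyed.
\<close>

lemma translation_isomorphism_pullback:
  assumes X: "translation_surface X" and Y: "translation_surface Y"
    and f: "translation_isomorphism X Y f"
    and \<kappa>: "\<kappa> \<in> charts X" "p \<in> fst \<kappa>" and \<kappa>': "\<kappa>' \<in> charts Y" "f p \<in> fst \<kappa>'"
  defines "\<tau> \<equiv> snd \<kappa>' \<circ> f \<circ> chart_inv \<kappa>"
  shows "\<exists>e. (\<tau> has_field_derivative e) (at (snd \<kappa> p)) \<and> e \<noteq> 0 \<and>
      form X \<kappa> (snd \<kappa> p) = form Y \<kappa>' (snd \<kappa>' (f p)) * e"
    and "eventually (\<lambda>w. chart_inv \<kappa>' (\<tau> w) = f (chart_inv \<kappa> w)) (nhds (snd \<kappa> p))"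
proof -
  obtain f' where f': "homeomorphism UNIV UNIV f f'"
    using f by (auto simp: translation_isomorphism_def)
  have cf: "continuous_on UNIV f" and inj: "inj f"
    using f' by (auto simp: homeomorphism_def intro: inj_on_inverseI)
  have c: "complex_chart \<kappa>" "complex_chart \<kappa>'"
    using surface_chart[OF X \<kappa>(1)] surface_chart[OF Y \<kappa>'(1)] by blast+
  let ?D = "snd \<kappa> ` (fst \<kappa> \<inter> f -` fst \<kappa>')"
  have oD: "open ?D"
    by (intro open_chart_image[OF c(1)] open_vimage complex_chartD(1)[OF c(2)] cf)
  have pD: "snd \<kappa> p \<in> ?D" using \<kappa> \<kappa>' by blast
  have hol: "\<tau> holomorphic_on ?D" and eq: "\<forall>w\<in>?D. form X \<kappa> w = form Y \<kappa>' (\<tau> w) * deriv \<tau> w"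
    using f \<kappa>(1) \<kappa>'(1) unfolding translation_isomorphism_def Let_def \<tau>_def by blast+
  have \<tau>_chart: "\<tau> (snd \<kappa> q) = snd \<kappa>' (f q)" if "q \<in> fst \<kappa>" for q
    using that c by (simp add: \<tau>_def)
  have "inj_on \<tau> ?D"
  proof (rule inj_onI)
    fix x y assume "x \<in> ?D" "y \<in> ?D" and xy: "\<tau> x = \<tau> y"
    then obtain q q' where q: "q \<in> fst \<kappa>" "f q \<in> fst \<kappa>'" "x = snd \<kappa> q"
      and q': "q' \<in> fst \<kappa>" "f q' \<in> fst \<kappa>'" "y = snd \<kappa> q'" by blast
    then have "snd \<kappa>' (f q) = snd \<kappa>' (f q')" using xy \<tau>_chart by metis
    then have "f q = f q'" using inj_onD[OF complex_chartD(3)[OF c(2)]] q q' by blast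
    then show "x = y" using inj q q' by (simp add: inj_eq)
  qed
  then have "deriv \<tau> (snd \<kappa> p) \<noteq> 0"
    using holomorphic_injective_imp_regular[OF hol oD _ pD] by blast
  moreover have "(\<tau> has_field_derivative deriv \<tau> (snd \<kappa> p)) (at (snd \<kappa> p))"
    by (rule holomorphic_derivI[OF hol oD pD])
  moreover have "form X \<kappa> (snd \<kappa> p) = form Y \<kappa>' (snd \<kappa>' (f p)) * deriv \<tau> (snd \<kappa> p)"
    using eq pD \<tau>_chart[OF \<kappa>(2)] by metis
  ultimately show "\<exists>e. (\<tau> has_field_derivative e) (at (snd \<kappa> p)) \<and> e \<noteq> 0 \<and>
      form X \<kappa> (snd \<kappa> p) = form Y \<kappa>' (snd \<kappa>' (f p)) * e" by blast
  have "chart_inv \<kappa>' (\<tau> w) = f (chart_inv \<kappa> w)" if "w \<in> ?D" for w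
  proof -
    from that obtain q where "q \<in> fst \<kappa>" "f q \<in> fst \<kappa>'" "w = snd \<kappa> q" by auto
    then show ?thesis using c \<tau>_chart by simp
  qed
  then show "eventually (\<lambda>w. chart_inv \<kappa>' (\<tau> w) = f (chart_inv \<kappa> w)) (nhds (snd \<kappa> p))"
    using oD pD unfolding eventually_nhds by (intro exI[of _ ?D]) simp
qed

lemma form_zeros_isomorphism:
  assumes X: "translation_surface X" and Y: "translation_surface Y"
    and f: "translation_isomorphism X Y f"
  shows "f p \<in> form_zeros Y \<longleftrightarrow> p \<in> form_zeros X"
proof -
  obtain \<kappa> where \<kappa>: "\<kappa> \<in> charts X" "p \<in> fst \<kappa>" using surface_covered X by blast
  obtain \<kappa>' where \<kappa>': "\<kappa>' \<in> charts Y" "f p \<in> fst \<kappa>'" using surface_covered Y by blast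
  show ?thesis
    using translation_isomorphism_pullback(1)[OF X Y f \<kappa> \<kappa>'] form_zeros_iff[OF X \<kappa>]
      form_zeros_iff[OF Y \<kappa>'] by auto
qed

lemma local_primitive_isomorphism:
  assumes X: "translation_surface X" and Y: "translation_surface Y"
    and f: "translation_isomorphism X Y f" and h: "local_primitive Y U h"
  shows "local_primitive X (f -` U) (h \<circ> f)"
  unfolding local_primitive_def
proof (intro conjI ballI)
  obtain f' where "homeomorphism UNIV UNIV f f'"
    using f by (auto simp: translation_isomorphism_def)
  then have "continuous_on UNIV f" by (simp add: homeomorphism_def)
  then show "open (f -` U)" using h by (intro open_vimage) (auto simp: local_primitive_def)
next
  fix \<kappa> w assume \<kappa>: "\<kappa> \<in> charts X" and "w \<in> snd \<kappa> ` (fst \<kappa> \<inter> f -` U)"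
  then obtain p where p: "p \<in> fst \<kappa>" "f p \<in> U" "w = snd \<kappa> p" by blast
  obtain \<kappa>' where \<kappa>': "\<kappa>' \<in> charts Y" "f p \<in> fst \<kappa>'" using surface_covered Y by blast
  let ?\<tau> = "snd \<kappa>' \<circ> f \<circ> chart_inv \<kappa>"
  obtain e where e: "(?\<tau> has_field_derivative e) (at (snd \<kappa> p))"
    "form X \<kappa> (snd \<kappa> p) = form Y \<kappa>' (snd \<kappa>' (f p)) * e"
    using translation_isomorphism_pullback(1)[OF X Y f \<kappa> p(1) \<kappa>'] by blast
  have "?\<tau> (snd \<kappa> p) = snd \<kappa>' (f p)"
    using surface_chart[OF X \<kappa>] p by simp
  then have "((\<lambda>w. h (chart_inv \<kappa>' w)) has_field_derivative form Y \<kappa>' (snd \<kappa>' (f p))) (at (?\<tau> (snd \<kappa> p)))"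
    using local_primitive_derivative[OF h \<kappa>' p(2)] by simp
  from DERIV_chain[OF this e(1)]
  have "((\<lambda>w. h (chart_inv \<kappa>' (?\<tau> w))) has_field_derivative form X \<kappa> w) (at w)"
    using e(2) p(3) by (simp add: o_def)
  moreover have "eventually (\<lambda>w. h (chart_inv \<kappa>' (?\<tau> w)) = (h \<circ> f) (chart_inv \<kappa> w)) (nhds w)"
    using translation_isomorphism_pullback(2)[OF X Y f \<kappa> p(1) \<kappa>'] p(3)
    by (auto elim: eventually_mono)
  ultimately show "((\<lambda>w. (h \<circ> f) (chart_inv \<kappa> w)) has_field_derivative form X \<kappa> w) (at w)"
    using iffD1[OF DERIV_cong_ev[OF refl _ refl]] by fast
qed

lemma primitive_along_isomorphism:
  assumes X: "translation_surface X" and Y: "translation_surface Y"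
    and f: "translation_isomorphism X Y f" and F: "primitive_along Y \<gamma> F"
    and \<delta>: "\<And>t. t \<in> {0..1} \<Longrightarrow> f (\<delta> t) = \<gamma> t"
  shows "primitive_along X \<delta> F"
  unfolding primitive_along_def
proof
  fix t :: real assume t: "t \<in> {0..1}"
  then obtain U h d where h: "local_primitive Y U h" "\<gamma> t \<in> U" "d > 0"
    "\<forall>s\<in>{0..1}. \<bar>s - t\<bar> < d \<longrightarrow> \<gamma> s \<in> U \<and> F s = h (\<gamma> s)"
    using F unfolding primitive_along_def by meson
  show "\<exists>U h. local_primitive X U h \<and> \<delta> t \<in> U \<and> (\<exists>d>0. \<forall>s\<in>{0..1}. \<bar>s - t\<bar> < d \<longrightarrow>
      \<delta> s \<in> U \<and> F s = h (\<delta> s))"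
    using h(2-) \<delta> t local_primitive_isomorphism[OF X Y f h(1)]
    by (intro exI[of _ "f -` U"] exI[of _ "h \<circ> f"] conjI exI[of _ d]) auto
qed

lemma holonomy_vectors_veech:
  assumes X: "translation_surface X" and g: "g \<in> veech_group X" and v: "v \<in> holonomy_vectors X"
  shows "g *v v \<in> holonomy_vectors X"
proof -
  obtain I \<gamma> where \<gamma>: "saddle_connection X \<gamma>" "has_form_integral X I \<gamma>" "v = plane_vec I"
    using v by (auto simp: holonomy_vectors_def)
  obtain Y f where Y: "is_SL2_image g X Y" and f: "translation_isomorphism X Y f" and gS: "g \<in> SL2"
    using g by (auto simp: veech_group_def)
  have tY: "translation_surface Y" using Y by (simp add: is_SL2_image_def)
  have sY: "saddle_connection Y \<gamma>" by (rule saddle_connection_SL2_image[OF X gS Y \<gamma>(1)])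
  have iY: "has_form_integral Y (act_complex g I) \<gamma>" by (rule has_form_integral_SL2_image[OF Y \<gamma>(2)])
  obtain f' where f': "homeomorphism UNIV UNIV f f'"
    using f by (auto simp: translation_isomorphism_def)
  have ff: "f (f' q) = q" for q using f' by (simp add: homeomorphism_def)
  have cf: "continuous_on UNIV f'" using f' by (simp add: homeomorphism_def)
  let ?\<delta> = "f' \<circ> \<gamma>"
  have prim: "primitive_along X ?\<delta> F" if "primitive_along Y \<gamma> F" for F
    using primitive_along_isomorphism[OF X tY f that] ff by simp
  have z: "f' q \<in> form_zeros X \<longleftrightarrow> q \<in> form_zeros Y" for q
    using form_zeros_isomorphism[OF X tY f, of "f' q"] ff by simp
  have "path ?\<delta>"
    using sY continuous_on_subset[OF cf] by (auto simp: saddle_connection_def intro!: path_continuous_image)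
  moreover have "pathstart ?\<delta> \<in> form_zeros X" "pathfinish ?\<delta> \<in> form_zeros X"
    "\<forall>t\<in>{0<..<1}. ?\<delta> t \<notin> form_zeros X"
    using sY z by (simp_all add: saddle_connection_def pathstart_def pathfinish_def)
  moreover have "\<exists>F v. primitive_along X ?\<delta> F \<and> v \<noteq> 0 \<and> (\<forall>t\<in>{0..1}. F t = F 0 + of_real t * v)"
    using sY prim unfolding saddle_connection_def by blast
  ultimately have "saddle_connection X ?\<delta>" by (simp add: saddle_connection_def)
  moreover have "has_form_integral X (act_complex g I) ?\<delta>"
    using iY prim unfolding has_form_integral_def by blast
  ultimately have "plane_vec (act_complex g I) \<in> holonomy_vectors X"
    unfolding holonomy_vectors_def by blast
  then show ?thesis using \<gamma>(3) by (simp add: plane_vec_act)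
qed

text \<open>
  Scaling commutes with linear maps, and the inverse matrix also acts on the holonomy vectors, so
  the parallel holonomy vectors in direction \<open>g *v v\<close> are the images of those in direction \<open>v\<close>.
\<close>

lemma visible_holonomy_veech:
  assumes X: "translation_surface X" and \<Gamma>: "SL2_subgroup (veech_group X)"
    and g: "g \<in> veech_group X" and v: "v \<in> visible_holonomy X"
  shows "g *v v \<in> visible_holonomy X"
proof -
  have gS: "g \<in> SL2" and g': "matrix_inv g \<in> veech_group X"
    using g \<Gamma> by (auto simp: SL2_subgroup_def)
  have "norm (g *v v) \<le> norm (r *\<^sub>R (g *v v))"
    if r: "r > 0" "r *\<^sub>R (g *v v) \<in> holonomy_vectors X" for r
  proof (cases "v = 0")
    case False
    have "matrix_inv g *v (r *\<^sub>R (g *v v)) = r *\<^sub>R v"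
      by (simp add: matrix_vector_mult_scaleR SL2_inverse_vec[OF gS])
    then have "r *\<^sub>R v \<in> holonomy_vectors X" using holonomy_vectors_veech[OF X g' r(2)] by simp
    then have "norm v \<le> norm (r *\<^sub>R v)" using v r(1) by (simp add: visible_holonomy_def)
    then have "1 \<le> r" using False r(1) by simp
    then show ?thesis by (simp add: mult_le_cancel_right1)
  qed simp
  then show ?thesis
    using v holonomy_vectors_veech[OF X g] by (simp add: visible_holonomy_def)
qed

section \<open>Finitely many holonomy vectors of bounded length\<close>

text \<open>
  Used for the difference of two primitives on the overlap of two compact neighbourhoods, which need
  not have finitely many components.
\<close>

lemma finite_image_locally_constant_on_compact:
  assumes "compact K" and "\<And>p. p \<in> K \<Longrightarrow> \<exists>W. open W \<and> p \<in> W \<and> (\<forall>q\<in>W \<inter> K. f q = f p)"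
  shows "finite (f ` K)"
proof -
  obtain W where W: "\<And>p. p \<in> K \<Longrightarrow> open (W p) \<and> p \<in> W p \<and> (\<forall>q\<in>W p \<inter> K. f q = f p)"
    using assms(2) by metis
  obtain C where C: "C \<subseteq> K" "finite C" "K \<subseteq> (\<Union>p\<in>C. W p)"
  proof (rule compactE_image[OF assms(1), of K W])
    show "K \<subseteq> (\<Union>p\<in>K. W p)" using W by auto
  qed (use W in auto)
  have "f ` K \<subseteq> f ` C"
  proof
    fix y assume "y \<in> f ` K"
    then obtain q where q: "q \<in> K" "y = f q" by blast
    then obtain p where p: "p \<in> C" "q \<in> W p" using C by blast
    then have "f q = f p" using W[of p] q C by blast
    then show "y \<in> f ` C" using q p by simp
  qed
  then show ?thesis using C finite_surj by blast
qed

text \<open>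
  Serves to compare primitives along a path: two of them differ locally by a constant.
\<close>

lemma constant_on_interval_if_locally:
  fixes f :: "real \<Rightarrow> 'b"
  assumes "a \<le> b" and "\<And>t. t \<in> {a..b} \<Longrightarrow> \<exists>\<delta>>0. \<forall>s\<in>{a..b}. \<bar>s - t\<bar> < \<delta> \<longrightarrow> f s = f t"
  shows "f b = f a"
proof -
  have "f constant_on {a..b}"
  proof (rule locally_constant_imp_constant)
    fix t assume t: "t \<in> {a..b}"
    then obtain \<delta> where \<delta>: "\<delta> > 0" "\<forall>s\<in>{a..b}. \<bar>s - t\<bar> < \<delta> \<longrightarrow> f s = f t"
      using assms(2) by blast
    have "openin (top_of_set {a..b}) ({a..b} \<inter> ball t \<delta>)" by blast
    moreover have "t \<in> {a..b} \<inter> ball t \<delta>" using t \<delta>(1) by simp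
    moreover have "\<forall>s\<in>{a..b} \<inter> ball t \<delta>. f s = f t"
      using \<delta>(2) by (auto simp: dist_real_def abs_minus_commute)
    ultimately show "\<exists>T. openin (top_of_set {a..b}) T \<and> t \<in> T \<and> (\<forall>x\<in>T. f x = f t)" by blast
  qed simp
  then show ?thesis using assms(1) by (auto simp: constant_on_def)
qed

lemma path_near:
  fixes \<gamma> :: "real \<Rightarrow> 'a::topological_space"
  assumes "path \<gamma>" "t \<in> {0..1}" "open W" "\<gamma> t \<in> W"
  shows "\<exists>\<delta>>0. \<forall>s\<in>{0..1}. \<bar>s - t\<bar> < \<delta> \<longrightarrow> \<gamma> s \<in> W"
proof -
  have "openin (top_of_set {0..1}) ({0..1} \<inter> \<gamma> -` W)"
    using assms by (auto simp: path_def intro: continuous_openin_preimage_gen)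
  then obtain T where T: "open T" "{0..1} \<inter> \<gamma> -` W = {0..1} \<inter> T"
    by (auto simp: openin_open)
  then have "t \<in> T" using assms by blast
  then obtain \<delta> where \<delta>: "\<delta> > 0" "ball t \<delta> \<subseteq> T" using T(1) by (meson openE)
  have "\<gamma> s \<in> W" if "s \<in> {0..1}" "\<bar>s - t\<bar> < \<delta>" for s
  proof -
    have "s \<in> {0..1} \<inter> T" using that \<delta>(2) by (auto simp: dist_real_def abs_minus_commute)
    then show ?thesis using T(2) by blast
  qed
  then show ?thesis using \<delta>(1) by blast
qed

lemma primitive_along_near:
  assumes X: "translation_surface X" and \<gamma>: "path \<gamma>" and F: "primitive_along X \<gamma> F"
    and h: "local_primitive X V h" and t: "t \<in> {0..1}" "\<gamma> t \<in> V"
  shows "\<exists>\<delta>>0. \<forall>s\<in>{0..1}. \<bar>s - t\<bar> < \<delta> \<longrightarrow> F s - h (\<gamma> s) = F t - h (\<gamma> t)"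
proof -
  obtain U k \<delta> where k: "local_primitive X U k" "\<gamma> t \<in> U" "\<delta> > 0"
    "\<forall>s\<in>{0..1}. \<bar>s - t\<bar> < \<delta> \<longrightarrow> \<gamma> s \<in> U \<and> F s = k (\<gamma> s)"
    using F t unfolding primitive_along_def by meson
  obtain W where W: "open W" "\<gamma> t \<in> W" "W \<subseteq> U \<inter> V" "\<And>q. q \<in> W \<Longrightarrow> k q - h q = k (\<gamma> t) - h (\<gamma> t)"
    by (rule local_primitive_diff_locally_constant[OF X k(1) h k(2) t(2)]) (rule that)
  obtain \<delta>' where \<delta>': "\<delta>' > 0" "\<forall>s\<in>{0..1}. \<bar>s - t\<bar> < \<delta>' \<longrightarrow> \<gamma> s \<in> W"
    using path_near[OF \<gamma> t(1) W(1,2)] by blast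
  have "F t = k (\<gamma> t)" using k(3,4) t(1) by simp
  then have "F s - h (\<gamma> s) = F t - h (\<gamma> t)" if "s \<in> {0..1}" "\<bar>s - t\<bar> < min \<delta> \<delta>'" for s
    using k(4) \<delta>'(2) W(4) that by simp
  then show ?thesis using k(3) \<delta>'(1) by (intro exI[of _ "min \<delta> \<delta>'"]) simp
qed

text \<open>
  Local primitives differ by locally constant functions, so along a path inside the domain of \<open>h\<close>
  the function \<open>h\<close> can replace all the primitives from which \<open>F\<close> was pieced together.
\<close>

lemma primitive_along_increment:
  assumes X: "translation_surface X" and \<gamma>: "path \<gamma>" and F: "primitive_along X \<gamma> F"
    and h: "local_primitive X V h" and ab: "0 \<le> a" "a \<le> b" "b \<le> 1"
    and V: "\<And>t. t \<in> {a..b} \<Longrightarrow> \<gamma> t \<in> V"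
  shows "F b - F a = h (\<gamma> b) - h (\<gamma> a)"
proof -
  have "F b - h (\<gamma> b) = F a - h (\<gamma> a)"
  proof (rule constant_on_interval_if_locally[OF ab(2)])
    fix t assume t: "t \<in> {a..b}"
    then have "t \<in> {0..1}" using ab by auto
    from primitive_along_near[OF X \<gamma> F h this V[OF t]]
    obtain \<delta> where \<delta>: "\<delta> > 0" "\<forall>s\<in>{0..1}. \<bar>s - t\<bar> < \<delta> \<longrightarrow> F s - h (\<gamma> s) = F t - h (\<gamma> t)" by blast
    then show "\<exists>\<delta>>0. \<forall>s\<in>{a..b}. \<bar>s - t\<bar> < \<delta> \<longrightarrow> F s - h (\<gamma> s) = F t - h (\<gamma> t)"
      using ab by (intro exI[of _ \<delta>]) auto
  qed
  then show ?thesis by (simp add: algebra_simps)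
qed

lemma primitive_along_unique:
  assumes X: "translation_surface X" and \<gamma>: "path \<gamma>" and F: "primitive_along X \<gamma> F" "primitive_along X \<gamma> G"
  shows "F 1 - F 0 = G 1 - G 0"
proof -
  have "F 1 - G 1 = F 0 - G 0"
  proof (rule constant_on_interval_if_locally)
    fix t :: real assume t: "t \<in> {0..1}"
    obtain U h where h: "local_primitive X U h" "\<gamma> t \<in> U"
      using F(1) t unfolding primitive_along_def by meson
    obtain d where d: "d > 0" "\<forall>s\<in>{0..1}. \<bar>s - t\<bar> < d \<longrightarrow> F s - h (\<gamma> s) = F t - h (\<gamma> t)"
      using primitive_along_near[OF X \<gamma> F(1) h(1) t h(2)] by blast
    obtain e where e: "e > 0" "\<forall>s\<in>{0..1}. \<bar>s - t\<bar> < e \<longrightarrow> G s - h (\<gamma> s) = G t - h (\<gamma> t)"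
      using primitive_along_near[OF X \<gamma> F(2) h(1) t h(2)] by blast
    have "F s - G s = F t - G t" if "s \<in> {0..1}" "\<bar>s - t\<bar> < min d e" for s
    proof -
      have "F s - h (\<gamma> s) = F t - h (\<gamma> t)" "G s - h (\<gamma> s) = G t - h (\<gamma> t)" using d e that by auto
      then have "(F s - h (\<gamma> s)) - (G s - h (\<gamma> s)) = (F t - h (\<gamma> t)) - (G t - h (\<gamma> t))" by simp
      then show ?thesis by simp
    qed
    then show "\<exists>\<delta>>0. \<forall>s\<in>{0..1}. \<bar>s - t\<bar> < \<delta> \<longrightarrow> F s - G s = F t - G t"
      using d(1) e(1) by (intro exI[of _ "min d e"]) simp
  qed simp
  then show ?thesis by (simp add: algebra_simps)
qed

text \<open>
  As long as the integral of the form over a path that starts in \<open>W\<close> is at most \<open>\<epsilon>\<close>, the path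
  cannot leave the compact set \<open>K\<close>.  Stating this through the integral instead of a metric avoids the
  construction of the flat metric near the zeros of the form, where it has cone points.
\<close>

definition flat_trap :: "'a::t2_space form_surface \<Rightarrow> 'a set \<Rightarrow> ('a \<Rightarrow> complex) \<Rightarrow> 'a set \<Rightarrow> 'a set \<Rightarrow> real \<Rightarrow> bool"
  where "flat_trap X V h K W \<epsilon> \<longleftrightarrow> local_primitive X V h \<and> compact K \<and> K \<subseteq> V \<and> open W \<and> W \<subseteq> K \<and> \<epsilon> > 0 \<and>
    (\<forall>\<gamma> F a b. path \<gamma> \<and> primitive_along X \<gamma> F \<and> 0 \<le> a \<and> a \<le> b \<and> b \<le> 1 \<and> \<gamma> a \<in> W \<and>
       (\<forall>t\<in>{a..b}. cmod (F t - F a) \<le> \<epsilon>) \<longrightarrow> \<gamma> ` {a..b} \<subseteq> K)"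

text \<open>
  In a chart, choose a circle around the point on which a primitive \<open>H\<close> differs from its value at
  the centre, by at least \<open>d\<close> say; this is possible because \<open>H\<close> is not constant.  A path that starts
  where \<open>H\<close> differs from the central value by less than \<open>d / 3\<close> must change \<open>H\<close> by at least
  \<open>2 * d / 3\<close> before it reaches the circle.  Zeros and regular points need not be distinguished.
\<close>

lemma flat_trap_exists:
  assumes X: "translation_surface X"
  shows "\<exists>V h K W \<epsilon>. flat_trap X V h K W \<epsilon> \<and> p \<in> W"
proof -
  obtain \<kappa> where \<kappa>: "\<kappa> \<in> charts X" "p \<in> fst \<kappa>" using surface_covered X by blast
  have c: "complex_chart \<kappa>" using surface_chart[OF X \<kappa>(1)] .
  let ?z = "snd \<kappa> p"
  obtain r0 H where r0: "r0 > 0" "ball ?z r0 \<subseteq> snd \<kappa> ` fst \<kappa>"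
    and H: "\<And>w. w \<in> ball ?z r0 \<Longrightarrow> (H has_field_derivative form X \<kappa> w) (at w)"
    using chart_primitive[OF X \<kappa>] by blast
  let ?H = "\<lambda>w. H w - H ?z"
  have H': "(?H has_field_derivative form X \<kappa> w) (at w)" if "w \<in> ball ?z r0" for w
    using DERIV_diff[OF H[OF that] DERIV_const] by simp
  have hol: "?H holomorphic_on ball ?z r0" using H' by (meson holomorphic_on_open open_ball)
  have contH: "continuous_on (ball ?z r0) H"
    using H by (meson DERIV_isCont continuous_at_imp_continuous_on)
  have "\<exists>\<beta>\<in>ball ?z r0. ?H \<beta> \<noteq> 0"
  proof (rule ccontr)
    assume "\<not> ?thesis"
    then have eq: "?H w = 0" if "w \<in> ball ?z r0" for w using that by blast
    obtain w where w: "w \<in> ball ?z r0" "form X \<kappa> w \<noteq> 0"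
      using form_nonzero_nearby[OF X \<kappa> r0(1)] by blast
    have "eventually (\<lambda>w. ?H w = 0) (nhds w)"
      unfolding eventually_nhds using eq w(1) by (intro exI[of _ "ball ?z r0"]) simp
    then have "((\<lambda>_. 0) has_field_derivative form X \<kappa> w) (at w)"
      using H'[OF w(1)] iffD1[OF DERIV_cong_ev[OF refl _ refl]] by fast
    then show False using w(2) DERIV_unique[OF _ DERIV_const] by blast
  qed
  then obtain \<beta> where \<beta>: "\<beta> \<in> ball ?z r0" "?H \<beta> \<noteq> 0" by blast
  have zB: "?z \<in> ball ?z r0" "?H ?z = 0" using r0 by auto
  obtain r1 where r1: "r1 > 0" "ball ?z r1 \<subseteq> ball ?z r0" "\<And>w. w \<in> ball ?z r1 - {?z} \<Longrightarrow> ?H w \<noteq> 0"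
    by (rule isolated_zeros[OF hol open_ball connected_ball zB \<beta>]) (rule that)
  define r where "r = r1 / 2"
  have r: "r > 0" "cball ?z r \<subseteq> ball ?z r1" using r1 by (auto simp: r_def)
  have cr0: "cball ?z r \<subseteq> ball ?z r0" using r r1 by blast
  have "continuous_on (sphere ?z r) (\<lambda>w. cmod (?H w))"
    by (intro continuous_intros continuous_on_subset[OF contH]) (use cr0 sphere_cball in blast)
  moreover have "sphere ?z r \<noteq> {}" using r(1) by simp
  ultimately obtain w0 where w0: "w0 \<in> sphere ?z r" "\<And>w. w \<in> sphere ?z r \<Longrightarrow> cmod (?H w0) \<le> cmod (?H w)"
    using continuous_attains_inf[of "sphere ?z r" "\<lambda>w. cmod (?H w)"] by auto
  define d where "d = cmod (?H w0)"
  have "w0 \<in> ball ?z r1 - {?z}" using w0(1) r sphere_cball[of ?z r] by auto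
  then have d: "d > 0" using r1(3) by (simp add: d_def)
  define V where "V = fst \<kappa> \<inter> snd \<kappa> -` ball ?z r0"
  define h where "h = H \<circ> snd \<kappa>"
  define K where "K = chart_inv \<kappa> ` cball ?z r"
  define O' where "O' = fst \<kappa> \<inter> snd \<kappa> -` ball ?z r"
  define W where "W = fst \<kappa> \<inter> snd \<kappa> -` (ball ?z r \<inter> (\<lambda>w. H w) -` ball (H ?z) (d / 3))"
  have lp: "local_primitive X V h"
    unfolding V_def h_def using local_primitive_of_chart[OF X \<kappa>(1) open_ball r0(2)] H by blast
  have cK: "compact K"
    unfolding K_def using cr0 r0(2)
    by (intro compact_continuous_image continuous_on_subset[OF complex_chartD(5)[OF c]]) auto
  have Kiff: "q \<in> K \<longleftrightarrow> q \<in> fst \<kappa> \<and> snd \<kappa> q \<in> cball ?z r" for q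
  proof
    assume "q \<in> K"
    then obtain w where w: "w \<in> cball ?z r" "q = chart_inv \<kappa> w" by (auto simp: K_def)
    then have "w \<in> snd \<kappa> ` fst \<kappa>" using cr0 r0(2) by blast
    then obtain q' where "q' \<in> fst \<kappa>" "w = snd \<kappa> q'" by blast
    then show "q \<in> fst \<kappa> \<and> snd \<kappa> q \<in> cball ?z r" using w c by simp
  next
    assume q: "q \<in> fst \<kappa> \<and> snd \<kappa> q \<in> cball ?z r"
    then have "q = chart_inv \<kappa> (snd \<kappa> q)" using c by simp
    then show "q \<in> K" unfolding K_def using q by blast
  qed
  have KV: "K \<subseteq> V"
  proof
    fix q assume "q \<in> K"
    then have "q \<in> fst \<kappa>" "snd \<kappa> q \<in> ball ?z r0" using Kiff cr0 by blast+
    then show "q \<in> V" by (simp add: V_def)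
  qed
  have oO: "open O'" unfolding O'_def using open_chart_vimage[OF c] by blast
  have oW: "open W"
  proof -
    have "open (ball ?z r \<inter> (\<lambda>w. H w) -` ball (H ?z) (d / 3))"
      using cr0 by (intro continuous_open_preimage continuous_on_subset[OF contH]) auto
    then show ?thesis unfolding W_def by (rule open_chart_vimage[OF c])
  qed
  have WO: "W \<subseteq> O'" unfolding W_def O'_def by blast
  have OK: "O' \<subseteq> K"
  proof
    fix q assume "q \<in> O'"
    then show "q \<in> K" unfolding Kiff O'_def by simp
  qed
  have pW: "p \<in> W" using \<kappa> r d by (simp add: W_def)
  have stay: "\<gamma> ` {a..b} \<subseteq> K" if \<gamma>: "path \<gamma>" "primitive_along X \<gamma> F" and ab: "0 \<le> a" "a \<le> b" "b \<le> 1"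
    and start: "\<gamma> a \<in> W" and small: "\<And>t. t \<in> {a..b} \<Longrightarrow> cmod (F t - F a) \<le> d / 3" for \<gamma> F a b
  proof (rule ccontr)
    assume "\<not> \<gamma> ` {a..b} \<subseteq> K"
    then obtain t1 where t1: "t1 \<in> {a..b}" "\<gamma> t1 \<notin> K" by blast
    have cont: "continuous_on {a..b} \<gamma>"
      using \<gamma>(1) ab by (auto simp: path_def intro: continuous_on_subset)
    \<comment> \<open>The first time \<open>t\<close> at which the path is outside the open disc; there it is on the circle.\<close>
    define S where "S = {t \<in> {a..b}. \<gamma> t \<notin> O'}"
    have "closed S"
    proof -
      have "closed ({a..b} \<inter> \<gamma> -` (- O'))" using oO by (intro continuous_closed_preimage cont) auto
      moreover have "S = {a..b} \<inter> \<gamma> -` (- O')" by (auto simp: S_def)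
      ultimately show ?thesis by simp
    qed
    moreover have "S \<noteq> {}" "bdd_below S" using t1 OK by (auto simp: S_def)
    ultimately have tS: "Inf S \<in> S" and tle: "\<And>t. t \<in> S \<Longrightarrow> Inf S \<le> t"
      by (auto intro: closed_contains_Inf cInf_lower)
    define t where "t = Inf S"
    have t: "t \<in> {a..b}" "\<gamma> t \<notin> O'" using tS by (auto simp: t_def S_def)
    have before: "\<gamma> s \<in> O'" if "s \<in> {a..<t}" for s
      using tle[of s] that t(1) by (force simp: S_def t_def)
    have at: "a < t" using t start WO by (metis atLeastAtMost_iff order_le_less subsetD)
    have tK: "\<gamma> t \<in> K"
    proof -
      have "closed ({a..t} \<inter> \<gamma> -` K)"
        using t(1) by (intro continuous_closed_preimage continuous_on_subset[OF cont])
          (auto simp: compact_imp_closed cK)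
      moreover have "{a..<t} \<subseteq> {a..t} \<inter> \<gamma> -` K" using before subsetD[OF OK] by auto
      ultimately have "closure {a..<t} \<subseteq> {a..t} \<inter> \<gamma> -` K" by (rule closure_minimal[rotated])
      moreover have "t \<in> closure {a..<t}" using at by simp
      ultimately show ?thesis by blast
    qed
    have inV: "\<gamma> s \<in> V" if "s \<in> {a..t}" for s
      using before[of s] tK that OK KV by (cases "s = t") auto
    have "F t - F a = h (\<gamma> t) - h (\<gamma> a)"
      using t ab inV by (intro primitive_along_increment[OF X \<gamma> lp]) auto
    moreover have "cmod (F t - F a) \<le> d / 3" using small t by blast
    moreover have "cmod (h (\<gamma> a) - H ?z) < d / 3"
      using start by (simp add: W_def h_def dist_norm norm_minus_commute)
    moreover have "cmod (h (\<gamma> t) - H ?z) \<ge> d"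
    proof -
      have "\<gamma> t \<in> fst \<kappa>" "snd \<kappa> (\<gamma> t) \<in> cball ?z r" using tK Kiff by blast+
      moreover then have "snd \<kappa> (\<gamma> t) \<notin> ball ?z r" using t(2) by (auto simp: O'_def)
      ultimately have "snd \<kappa> (\<gamma> t) \<in> sphere ?z r" by auto
      then show ?thesis using w0(2) by (simp add: d_def h_def)
    qed
    moreover have "h (\<gamma> t) - H ?z = (h (\<gamma> t) - h (\<gamma> a)) + (h (\<gamma> a) - H ?z)" by simp
    then have "cmod (h (\<gamma> t) - H ?z) \<le> cmod (h (\<gamma> t) - h (\<gamma> a)) + cmod (h (\<gamma> a) - H ?z)"
      by (metis norm_triangle_ineq)
    ultimately show False using d by simp
  qed
  have "flat_trap X V h K W (d / 3)"
    unfolding flat_trap_def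
  proof (intro conjI allI impI)
    show "local_primitive X V h" "compact K" "K \<subseteq> V" "open W" by (rule lp cK KV oW)+
    show "W \<subseteq> K" using WO OK by (rule subset_trans)
    show "d / 3 > 0" using d by simp
    show "\<gamma> ` {a..b} \<subseteq> K" if "path \<gamma> \<and> primitive_along X \<gamma> F \<and> 0 \<le> a \<and> a \<le> b \<and> b \<le> 1 \<and>
        \<gamma> a \<in> W \<and> (\<forall>t\<in>{a..b}. cmod (F t - F a) \<le> d / 3)" for \<gamma> F a b
      using that by (intro stay[of \<gamma> F]) (elim conjE, assumption | blast)+
  qed
  then show ?thesis using pW by blast
qed

text \<open>
  Cut the path at the times \<open>k / N\<close> and let \<open>i k\<close> be the centre of a neighbourhood that contains the
  piece starting at \<open>k / N\<close>.  Up to time \<open>n / N\<close>, the integral minus the value of the current primitive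
  runs through the finite set \<open>S n\<close>: passing from one neighbourhood to the next adds an element of the
  finite set \<open>D\<close> of differences of primitives on overlaps.
\<close>

lemma finite_holonomy_vectors_bounded:
  assumes X: "translation_surface X"
  shows "finite {v \<in> holonomy_vectors X. norm v \<le> R}"
proof -
  define good where "good p A \<longleftrightarrow> (case A of (V, h, K, W, \<epsilon>) \<Rightarrow> flat_trap X V h K W \<epsilon> \<and> p \<in> W)" for p A
  have "\<forall>p. \<exists>A. good p A" using flat_trap_exists[OF X] by (auto simp: good_def)
  then obtain A where A: "\<forall>p. good p (A p)" by (rule exE[OF choice])
  define V where "V p = fst (A p)" for p
  define h where "h p = fst (snd (A p))" for p
  define K where "K p = fst (snd (snd (A p)))" for p
  define W where "W p = fst (snd (snd (snd (A p))))" for p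
  define e where "e p = snd (snd (snd (snd (A p))))" for p
  have trap: "flat_trap X (V p) (h p) (K p) (W p) (e p)" and pW: "p \<in> W p" for p
    using spec[OF A, of p] by (simp_all add: good_def V_def h_def K_def W_def e_def case_prod_unfold)
  have lp: "local_primitive X (V p) (h p)" and cK: "compact (K p)" and KV: "K p \<subseteq> V p"
    and oW: "open (W p)" and WK: "W p \<subseteq> K p" and e0: "e p > 0" for p
    using trap[of p] by (simp_all add: flat_trap_def)
  obtain P where P: "finite P" "UNIV \<subseteq> (\<Union>p\<in>P. W p)"
  proof (rule compactE_image[OF compact_surface[OF X], of UNIV W])
    show "UNIV \<subseteq> (\<Union>p\<in>UNIV. W p)" using pW by auto
  qed (use oW in auto)
  have "P \<noteq> {}" using P(2) by auto
  define \<epsilon> where "\<epsilon> = Min (e ` P)"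
  have \<epsilon>: "\<epsilon> > 0" "\<And>p. p \<in> P \<Longrightarrow> \<epsilon> \<le> e p"
    using P(1) \<open>P \<noteq> {}\<close> e0 by (auto simp: \<epsilon>_def)
  obtain N0 :: nat where N0: "R / \<epsilon> \<le> real N0" using real_arch_simple by blast
  \<comment> \<open>On a piece of length \<open>1 / N\<close> the integral changes by at most \<open>\<epsilon>\<close>; the successor makes \<open>N\<close> positive.\<close>
  define N where "N = Suc N0"
  have N: "R / real N \<le> \<epsilon>" using N0 \<epsilon>(1) by (simp add: N_def field_simps)
  define D where "D = (\<Union>p\<in>P. \<Union>q\<in>P. (\<lambda>x. h p x - h q x) ` (K p \<inter> K q))"
  define E where "E = (\<Union>p\<in>P. h p ` form_zeros X)"
  have "finite ((\<lambda>x. h p x - h q x) ` (K p \<inter> K q))" for p q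
  proof (rule finite_image_locally_constant_on_compact)
    show "compact (K p \<inter> K q)" using cK by (simp add: compact_Int)
    fix x assume x: "x \<in> K p \<inter> K q"
    then have "x \<in> V p" "x \<in> V q" using KV by blast+
    then obtain U where U: "open U" "x \<in> U" "U \<subseteq> V p \<inter> V q"
        "\<And>y. y \<in> U \<Longrightarrow> h p y - h q y = h p x - h q x"
      by (rule local_primitive_diff_locally_constant[OF X lp lp]) (rule that)
    show "\<exists>U. open U \<and> x \<in> U \<and> (\<forall>y\<in>U \<inter> (K p \<inter> K q). h p y - h q y = h p x - h q x)"
    proof (intro exI conjI ballI)
      show "open U" "x \<in> U" by (rule U)+
      show "h p y - h q y = h p x - h q x" if "y \<in> U \<inter> (K p \<inter> K q)" for y
        by (rule U(4)) (use that in blast)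
    qed
  qed
  then have fD: "finite D" using P(1) by (simp add: D_def)
  have fE: "finite E" using P(1) finite_form_zeros[OF X] by (simp add: E_def)
  define S where "S n = ((\<lambda>B. (\<lambda>(x, d). x + d) ` (B \<times> D)) ^^ n) (uminus ` E)" for n
  have S0: "S 0 = uminus ` E" and SS: "S (Suc n) = (\<lambda>(x, d). x + d) ` (S n \<times> D)" for n
    by (simp_all add: S_def)
  have fS: "finite (S n)" for n by (induction n) (simp_all add: S0 SS fD fE)
  let ?T = "(\<lambda>(x, d). plane_vec (x + d)) ` (S N0 \<times> E)"
  have "{v \<in> holonomy_vectors X. norm v \<le> R} \<subseteq> ?T"
  proof
    fix v assume "v \<in> {v \<in> holonomy_vectors X. norm v \<le> R}"
    then obtain I \<gamma> where sc: "saddle_connection X \<gamma>" and I: "has_form_integral X I \<gamma>"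
      and v: "v = plane_vec I" "norm v \<le> R" by (auto simp: holonomy_vectors_def)
    have \<gamma>: "path \<gamma>" "\<gamma> 0 \<in> form_zeros X" "\<gamma> 1 \<in> form_zeros X"
      using sc by (auto simp: saddle_connection_def pathstart_def pathfinish_def)
    obtain F u where F: "primitive_along X \<gamma> F" "\<forall>t\<in>{0..1}. F t = F 0 + of_real t * u"
      using sc by (auto simp: saddle_connection_def)
    obtain G where G: "primitive_along X \<gamma> G" "I = G 1 - G 0"
      using I by (auto simp: has_form_integral_def)
    have "I = F 1 - F 0"
      using primitive_along_unique[OF X \<gamma>(1) F(1) G(1)] G(2) by simp
    moreover have "F 1 = F 0 + of_real 1 * u" using F(2) by (rule bspec) simp
    then have "F 1 - F 0 = u" by simp
    ultimately have u: "I = F 1 - F 0" "cmod u \<le> R" using v by (simp_all add: norm_plane_vec)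
    define \<tau> where "\<tau> k = real k / real N" for k
    have \<tau>: "\<tau> k \<in> {0..1}" if "k \<le> N" for k using that by (auto simp: \<tau>_def N_def field_simps)
    have "\<exists>p\<in>P. \<gamma> (\<tau> k) \<in> W p" for k using P(2) by blast
    then obtain i where i: "\<And>k. i k \<in> P" "\<And>k. \<gamma> (\<tau> k) \<in> W (i k)" by metis
    have step: "\<gamma> t \<in> K (i k)" if k: "k < N" and t: "t \<in> {\<tau> k..\<tau> (Suc k)}" for k t
    proof -
      have ab: "0 \<le> \<tau> k" "\<tau> k \<le> \<tau> (Suc k)" "\<tau> (Suc k) \<le> 1"
        using \<tau>[of k] \<tau>[of "Suc k"] k by (auto simp: \<tau>_def divide_right_mono)
      have "cmod (F s - F (\<tau> k)) \<le> e (i k)" if s: "s \<in> {\<tau> k..\<tau> (Suc k)}" for s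
      proof -
        have "F s = F 0 + of_real s * u" "F (\<tau> k) = F 0 + of_real (\<tau> k) * u"
          by (rule bspec[OF F(2)], use s ab in simp)+
        then have "F s - F (\<tau> k) = of_real (s - \<tau> k) * u" by (simp add: algebra_simps)
        then have "cmod (F s - F (\<tau> k)) = (s - \<tau> k) * cmod u"
            using s by (simp add: norm_mult del: of_real_diff)
        also have "\<dots> \<le> (1 / real N) * R"
        proof (rule mult_mono)
          have "\<tau> (Suc k) - \<tau> k = 1 / real N" by (simp add: \<tau>_def add_divide_distrib)
          then show "s - \<tau> k \<le> 1 / real N" using s by simp
        qed (use u in auto)
        also have "\<dots> \<le> \<epsilon>" using N by simp
        also have "\<dots> \<le> e (i k)" using \<epsilon>(2) i(1) by simp
        finally show ?thesis .
      qed
      then have "\<gamma> ` {\<tau> k..\<tau> (Suc k)} \<subseteq> K (i k)"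
        using trap[of "i k"] \<gamma>(1) F(1) ab i(2)[of k] unfolding flat_trap_def by blast
      then show ?thesis using t by blast
    qed
    have \<tau>le: "\<tau> k \<le> \<tau> (Suc k)" for k by (simp add: \<tau>_def divide_right_mono)
    have inc: "F (\<tau> (Suc k)) - F (\<tau> k) = h (i k) (\<gamma> (\<tau> (Suc k))) - h (i k) (\<gamma> (\<tau> k))" if k: "k < N" for k
    proof (rule primitive_along_increment[OF X \<gamma>(1) F(1) lp])
      show "0 \<le> \<tau> k" "\<tau> k \<le> \<tau> (Suc k)" "\<tau> (Suc k) \<le> 1"
        using \<tau>[of k] \<tau>[of "Suc k"] k \<tau>le by auto
      show "\<gamma> t \<in> V (i k)" if "t \<in> {\<tau> k..\<tau> (Suc k)}" for t using step[OF k that] KV by blast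
    qed
    have "\<tau> 0 = 0" by (simp add: \<tau>_def)
    have main: "F (\<tau> (Suc n)) - F 0 - h (i n) (\<gamma> (\<tau> (Suc n))) \<in> S n" if "n < N" for n
      using that
    proof (induction n)
      case 0
      have "F (\<tau> (Suc 0)) - F 0 - h (i 0) (\<gamma> (\<tau> (Suc 0))) = - h (i 0) (\<gamma> 0)"
        using inc[OF 0] \<open>\<tau> 0 = 0\<close> by (simp add: algebra_simps)
      moreover have "h (i 0) (\<gamma> 0) \<in> E" using i(1) \<gamma>(2) unfolding E_def by blast
      ultimately show ?case unfolding S0 by simp
    next
      case (Suc n)
      let ?x = "\<gamma> (\<tau> (Suc n))"
      have "?x \<in> K (i n)" using step[of n "\<tau> (Suc n)"] Suc.prems \<tau>le by simp
      moreover have "?x \<in> K (i (Suc n))" using i(2) WK by blast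
      ultimately have "h (i n) ?x - h (i (Suc n)) ?x \<in> D" using i(1) unfolding D_def by blast
      moreover have "F (\<tau> (Suc n)) - F 0 - h (i n) ?x \<in> S n" using Suc by simp
      moreover have "F (\<tau> (Suc (Suc n))) - F 0 - h (i (Suc n)) (\<gamma> (\<tau> (Suc (Suc n)))) =
        (F (\<tau> (Suc n)) - F 0 - h (i n) ?x) + (h (i n) ?x - h (i (Suc n)) ?x)"
        using inc[OF Suc.prems] by (simp add: algebra_simps)
      ultimately show ?case unfolding SS by (intro image_eqI[of _ _ "(_, _)"]) auto
    qed
    have "\<tau> (Suc N0) = 1" by (simp add: \<tau>_def N_def)
    then have "F 1 - F 0 - h (i N0) (\<gamma> 1) \<in> S N0" using main[of N0] by (simp add: N_def)
    moreover have "h (i N0) (\<gamma> 1) \<in> E" using i(1) \<gamma>(3) unfolding E_def by blast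
    moreover have "v = plane_vec ((F 1 - F 0 - h (i N0) (\<gamma> 1)) + h (i N0) (\<gamma> 1))"
      using v u by simp
    ultimately show "v \<in> ?T" by (intro image_eqI[of _ _ "(_, _)"]) auto
  qed
  moreover have "finite ?T" using fS fE by simp
  ultimately show ?thesis by (rule finite_subset)
qed

section \<open>Haar measure and the stabilizer of a cusp\<close>

text \<open>
  Coordinates in which right multiplication by a unipotent matrix acts as the same shear on both
  factors, so that Fubini's theorem applies.
\<close>

definition matrix_of_rows :: "(real \<times> real) \<times> (real \<times> real) \<Rightarrow> real^2^2" where
  "matrix_of_rows = (\<lambda>((p, q), (r, s)). vector [vector [p, q], vector [r, s]])"

lemma matrix_of_rows_nth [simp]:
  "matrix_of_rows ((p, q), (r, s)) $ 1 $ 1 = p" "matrix_of_rows ((p, q), (r, s)) $ 1 $ 2 = q"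
  "matrix_of_rows ((p, q), (r, s)) $ 2 $ 1 = r" "matrix_of_rows ((p, q), (r, s)) $ 2 $ 2 = s"
  by (simp_all add: matrix_of_rows_def)

lemma matrix_of_rows_measurable [measurable]: "matrix_of_rows \<in> borel_measurable borel"
proof -
  have eq: "matrix_of_rows = (\<lambda>x. \<chi> i j. if i = 1 then (if j = 1 then fst (fst x) else snd (fst x))
      else (if j = 1 then fst (snd x) else snd (snd x)))"
    by (auto simp: fun_eq_iff matrix_eq_iff_2)
  moreover have "continuous_on UNIV \<dots>"
  proof (intro continuous_on_vec_lambda)
    show "continuous_on UNIV (\<lambda>x :: (real \<times> real) \<times> (real \<times> real).
        if i = 1 then (if j = 1 then fst (fst x) else snd (fst x))
        else (if j = 1 then fst (snd x) else snd (snd x)))" for i j :: 2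
      by (cases "i = 1"; cases "j = 1") (auto intro!: continuous_intros)
  qed
  ultimately show ?thesis by (subst eq) (rule borel_measurable_continuous_onI)
qed

lemma Basis_matrix_2: "(Basis :: (real^2^2) set) =
    {axis 1 (axis 1 1), axis 1 (axis 2 1), axis 2 (axis 1 1), axis 2 (axis 2 1)}"
  by (auto simp: Basis_vec_def UNIV_2)

lemma Basis_real_4: "(Basis :: ((real \<times> real) \<times> (real \<times> real)) set) =
    {((1, 0), (0, 0)), ((0, 1), (0, 0)), ((0, 0), (1, 0)), ((0, 0), (0, 1))}"
  by (auto simp: Basis_prod_def zero_prod_def)

lemma lborel_matrix: "lborel = distr lborel borel matrix_of_rows"
proof (rule lborel_eqI)
  fix l u :: "real^2^2" assume le: "\<And>b. b \<in> Basis \<Longrightarrow> l \<bullet> b \<le> u \<bullet> b"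
  let ?c = "\<lambda>A :: real^2^2. ((A $ 1 $ 1, A $ 1 $ 2), (A $ 2 $ 1, A $ 2 $ 2))"
  have le': "l $ 1 $ 1 \<le> u $ 1 $ 1" "l $ 1 $ 2 \<le> u $ 1 $ 2" "l $ 2 $ 1 \<le> u $ 2 $ 1" "l $ 2 $ 2 \<le> u $ 2 $ 2"
    using le[of "axis 1 (axis 1 1)"] le[of "axis 1 (axis 2 1)"]
      le[of "axis 2 (axis 1 1)"] le[of "axis 2 (axis 2 1)"]
    by (simp_all add: Basis_matrix_2 inner_axis)
  have pre: "matrix_of_rows -` box l u = box (?c l) (?c u)"
    by (auto simp: box_def Basis_matrix_2 inner_axis Basis_prod_def)
  have "emeasure (distr lborel borel matrix_of_rows) (box l u) = emeasure lborel (box (?c l) (?c u))"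
    by (subst emeasure_distr) (simp_all add: pre)
  also have "\<dots> = (\<Prod>b\<in>Basis. (?c u - ?c l) \<bullet> b)"
    by (rule emeasure_lborel_box) (use le' in \<open>auto simp: Basis_prod_def\<close>)
  also have "(\<Prod>b\<in>Basis. (?c u - ?c l) \<bullet> b) = (\<Prod>b\<in>Basis. (u - l) \<bullet> b)"
    by (simp add: Basis_real_4 Basis_matrix_2 inner_axis axis_eq_axis)
  finally show "emeasure (distr lborel borel matrix_of_rows) (box l u) = (\<Prod>b\<in>Basis. (u - l) \<bullet> b)" .
qed simp

definition shear :: "real \<Rightarrow> real \<times> real \<Rightarrow> real \<times> real" where
  "shear \<kappa> = (\<lambda>(p, q). (p, q + \<kappa> * p))"

lemma shear_measurable [measurable]: "shear \<kappa> \<in> borel_measurable borel"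
  unfolding shear_def borel_prod[symmetric] by measurable

lemma shear_measurable_pair [measurable]: "shear \<kappa> \<in> borel \<Otimes>\<^sub>M borel \<rightarrow>\<^sub>M borel \<Otimes>\<^sub>M borel"
  unfolding borel_prod by (rule shear_measurable)

text \<open>
  A shear translates each vertical line.
\<close>

lemma lborel_distr_shear: "distr lborel borel (shear \<kappa>) = lborel"
proof (rule measure_eqI)
  fix A :: "(real \<times> real) set" assume "A \<in> sets (distr lborel borel (shear \<kappa>))"
  then have A [measurable]: "A \<in> sets borel" by simp
  have fib: "emeasure lborel (Pair x -` (shear \<kappa> -` A)) = emeasure lborel (Pair x -` A)" for x
  proof -
    have [measurable]: "Pair x -` A \<in> sets borel"
    proof (rule sets_Pair1)
      show "A \<in> sets (borel \<Otimes>\<^sub>M borel)" unfolding borel_prod by (rule A)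
    qed
    have "emeasure lborel (Pair x -` A) = emeasure (distr lborel borel ((+) (\<kappa> * x))) (Pair x -` A)"
      by (simp add: lborel_distr_plus)
    also have "\<dots> = emeasure lborel ((+) (\<kappa> * x) -` (Pair x -` A))"
      by (subst emeasure_distr) simp_all
    also have "(+) (\<kappa> * x) -` (Pair x -` A) = Pair x -` (shear \<kappa> -` A)"
      by (auto simp: shear_def add.commute)
    finally show ?thesis by simp
  qed
  have pre [measurable]: "shear \<kappa> -` A \<in> sets borel"
    using measurable_sets[OF shear_measurable A] by simp
  have "emeasure (distr lborel borel (shear \<kappa>)) A = emeasure (lborel \<Otimes>\<^sub>M lborel) (shear \<kappa> -` A)"
    by (subst emeasure_distr) (simp_all add: lborel_prod)
  also have "\<dots> = (\<integral>\<^sup>+x. emeasure lborel (Pair x -` (shear \<kappa> -` A)) \<partial>lborel)"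
    by (rule lborel.emeasure_pair_measure_alt) (unfold lborel_prod sets_lborel, rule pre)
  also have "\<dots> = (\<integral>\<^sup>+x. emeasure lborel (Pair x -` A) \<partial>lborel)" by (simp add: fib)
  also have "\<dots> = emeasure (lborel \<Otimes>\<^sub>M lborel) A"
    by (rule lborel.emeasure_pair_measure_alt[symmetric]) (unfold lborel_prod sets_lborel, rule A)
  finally show "emeasure (distr lborel borel (shear \<kappa>)) A = emeasure lborel A" by (simp add: lborel_prod)
qed simp

lemma matrix_of_rows_shear:
  "matrix_of_rows (shear \<kappa> x, shear \<kappa> y) = matrix_of_rows (x, y) ** upper_unipotent \<kappa>"
  by (cases x; cases y) (simp add: matrix_eq_iff_2 matrix_mult_upper_unipotent shear_def)

lemma mult_unipotent_measurable [measurable]: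
  "(\<lambda>M :: real^2^2. M ** upper_unipotent \<kappa>) \<in> borel_measurable borel"
proof -
  have "(\<lambda>M :: real^2^2. M ** upper_unipotent \<kappa>) =
      (\<lambda>M. \<chi> i j. if j = 1 then M $ i $ 1 else M $ i $ 2 + \<kappa> * M $ i $ 1)"
    by (auto simp: fun_eq_iff matrix_eq_iff_2 matrix_mult_upper_unipotent)
  moreover have "continuous_on UNIV \<dots>"
  proof (intro continuous_on_vec_lambda)
    show "continuous_on UNIV (\<lambda>M :: real^2^2. if j = 1 then M $ i $ 1 else M $ i $ 2 + \<kappa> * M $ i $ 1)"
      for i j :: 2 by (cases "j = 1") (auto intro!: continuous_intros)
  qed
  ultimately show ?thesis by (simp add: borel_measurable_continuous_onI)
qed

lemma lborel_distr_mult_unipotent: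
  "distr lborel borel (\<lambda>M :: real^2^2. M ** upper_unipotent \<kappa>) = lborel"
proof -
  let ?sh = "\<lambda>(x, y). (shear \<kappa> x, shear \<kappa> y)"
  have [measurable]: "?sh \<in> borel_measurable borel"
    unfolding borel_prod[symmetric] by measurable
  have sh: "distr lborel borel ?sh = lborel"
  proof -
    have "distr lborel borel ?sh = distr (lborel \<Otimes>\<^sub>M lborel) (borel \<Otimes>\<^sub>M borel) ?sh"
      by (simp add: lborel_prod borel_prod)
    also have "\<dots> = distr lborel borel (shear \<kappa>) \<Otimes>\<^sub>M distr lborel borel (shear \<kappa>)"
      by (rule pair_measure_distr[symmetric]) (simp_all add: lborel_distr_shear sigma_finite_lborel)
    also have "\<dots> = lborel" by (simp add: lborel_distr_shear lborel_prod)
    finally show ?thesis .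
  qed
  let ?R = "\<lambda>M :: real^2^2. M ** upper_unipotent \<kappa>"
  have "distr lborel borel ?R = distr (distr lborel borel matrix_of_rows) borel ?R"
    by (subst lborel_matrix) simp
  also have "\<dots> = distr lborel borel (?R \<circ> matrix_of_rows)" by (rule distr_distr) simp_all
  also have "?R \<circ> matrix_of_rows = matrix_of_rows \<circ> ?sh"
    by (auto simp: fun_eq_iff matrix_of_rows_shear)
  also have "distr lborel borel (matrix_of_rows \<circ> ?sh) = distr (distr lborel borel ?sh) borel matrix_of_rows"
    by (rule distr_distr[symmetric]) simp_all
  also have "\<dots> = lborel" by (simp add: sh lborel_matrix[symmetric])
  finally show ?thesis .
qed

lemma emeasure_vimage_mult_unipotent:
  assumes "A \<in> sets borel"
  shows "emeasure lborel ((\<lambda>M :: real^2^2. M ** upper_unipotent \<kappa>) -` A) = emeasure lborel A"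
proof -
  have "emeasure lborel A = emeasure (distr lborel borel (\<lambda>M :: real^2^2. M ** upper_unipotent \<kappa>)) A"
    by (simp add: lborel_distr_mult_unipotent)
  also have "\<dots> = emeasure lborel ((\<lambda>M :: real^2^2. M ** upper_unipotent \<kappa>) -` A)"
    by (subst emeasure_distr) (use assms in simp_all)
  finally show ?thesis by simp
qed

lemma emeasure_vimage_uminus:
  fixes A :: "'a::euclidean_space set"
  assumes "A \<in> sets borel"
  shows "emeasure lborel (uminus -` A) = emeasure lborel A"
proof -
  have "(lborel :: 'a measure) = distr lborel borel uminus"
    using lborel_affine[of "-1 :: real" "0 :: 'a"] by (simp add: density_1 o_def)
  then have "emeasure lborel A = emeasure (distr lborel borel uminus) A" by simp
  also have "\<dots> = emeasure lborel (uminus -` A)"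
    by (subst emeasure_distr) (use assms in simp_all)
  finally show ?thesis by simp
qed

text \<open>
  A set in the cone over \<open>SL2\<close> that meets each orbit of \<open>range (\<lambda>n::int. upper_unipotent (n * \<alpha>))\<close> at
  most once: in the first row \<open>(p, q)\<close>, the entry \<open>q\<close> is reduced modulo \<open>\<alpha> * p\<close>.  The bounds on \<open>p\<close>
  only simplify the computation of its volume.
\<close>

definition unipotent_tile :: "real \<Rightarrow> (real^2^2) set" where
  "unipotent_tile \<alpha> = {M. 1 \<le> M $ 1 $ 1 \<and> M $ 1 $ 1 \<le> 2 \<and> 0 \<le> M $ 1 $ 2 \<and> M $ 1 $ 2 < \<alpha> * M $ 1 $ 1 \<and>
     0 < det M \<and> det M \<le> 1}"

lemma matrix_entry_measurable [measurable]: "(\<lambda>M :: real^2^2. M $ i $ j) \<in> borel_measurable borel"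
  by (intro borel_measurable_continuous_onI continuous_intros)

lemma det_2_measurable [measurable]: "(\<lambda>M :: real^2^2. det M) \<in> borel_measurable borel"
  unfolding det_2 by measurable

lemma unipotent_tile_measurable [measurable]: "unipotent_tile \<alpha> \<in> sets borel"
  unfolding unipotent_tile_def by measurable

lemma emeasure_strip:
  fixes p q :: real
  assumes "p > 0"
  shows "emeasure lborel {(r, s). 0 < p * s - q * r \<and> p * s - q * r \<le> 1} = \<infinity>"
proof -
  let ?S = "{(r, s). 0 < p * s - q * r \<and> p * s - q * r \<le> 1}"
  have "?S = {x \<in> space (borel \<Otimes>\<^sub>M borel). 0 < p * snd x - q * fst x \<and> p * snd x - q * fst x \<le> 1}"
    by (auto simp: space_pair_measure)
  also have "\<dots> \<in> sets (borel \<Otimes>\<^sub>M borel)" by measurable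
  finally have S: "?S \<in> sets (lborel \<Otimes>\<^sub>M lborel)" by (simp add: borel_prod lborel_prod)
  have fib: "emeasure lborel (Pair r -` ?S) = ennreal (1 / p)" for r
  proof -
    have "Pair r -` ?S = {q * r / p<..q * r / p + 1 / p}"
      using assms by (auto simp: field_simps)
    then show ?thesis using assms by simp
  qed
  have "emeasure lborel ?S = (\<integral>\<^sup>+r. emeasure lborel (Pair r -` ?S) \<partial>lborel)"
    using lborel.emeasure_pair_measure_alt[OF S] by (simp add: lborel_prod)
  also have "\<dots> = ennreal (1 / p) * \<infinity>" by (simp only: fib nn_integral_const) simp
  also have "\<dots> = \<infinity>" using assms by (simp add: ennreal_mult_top)
  finally show ?thesis .
qed

text \<open>
  For fixed first row \<open>(p, q)\<close>, the second row ranges over the infinite strip between two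
  parallel lines.
\<close>

lemma emeasure_unipotent_tile:
  assumes "\<alpha> > 0"
  shows "emeasure lborel (unipotent_tile \<alpha>) = \<infinity>"
proof -
  let ?Q = "matrix_of_rows -` unipotent_tile \<alpha>"
  have Q: "?Q \<in> sets (lborel \<Otimes>\<^sub>M lborel)"
    unfolding lborel_prod sets_lborel
    using measurable_sets[OF matrix_of_rows_measurable unipotent_tile_measurable] by simp
  have fib: "emeasure lborel (Pair x -` ?Q) \<ge> \<infinity> * indicator ({1..2::real} \<times> {0..\<alpha> / 2}) x" for x
  proof (cases "x \<in> {1..2::real} \<times> {0..\<alpha> / 2}")
    case True
    then obtain p q where x: "x = (p, q)" "1 \<le> p" "p \<le> 2" "0 \<le> q" "q \<le> \<alpha> / 2" by auto
    have "\<alpha> * 1 \<le> \<alpha> * p" using assms x by (intro mult_left_mono) auto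
    then have "q < \<alpha> * p" using x assms by linarith
    then have "Pair x -` ?Q = {(r, s). 0 < p * s - q * r \<and> p * s - q * r \<le> 1}"
      using x assms by (auto simp: unipotent_tile_def det_2)
    then show ?thesis using emeasure_strip[of p q] x by simp
  qed simp
  have pos: "emeasure lborel ({1..2::real} \<times> {0..\<alpha> / 2} :: (real \<times> real) set) = ennreal (\<alpha> / 2)"
    using assms lborel.emeasure_pair_measure_Times[of "{1..2::real}" lborel "{0..\<alpha>/2}"]
    by (simp add: lborel_prod)
  have "emeasure lborel (unipotent_tile \<alpha>) = emeasure (distr lborel borel matrix_of_rows) (unipotent_tile \<alpha>)"
    by (simp add: lborel_matrix[symmetric])
  also have "\<dots> = emeasure (lborel \<Otimes>\<^sub>M lborel) ?Q"
    by (subst emeasure_distr) (simp_all add: lborel_prod)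
  also have "\<dots> = (\<integral>\<^sup>+x. emeasure lborel (Pair x -` ?Q) \<partial>lborel)"
    by (rule lborel.emeasure_pair_measure_alt[OF Q])
  also have "\<dots> \<ge> (\<integral>\<^sup>+x. \<infinity> * indicator ({1..2::real} \<times> {0..\<alpha> / 2}) x \<partial>lborel)"
    by (rule nn_integral_mono) (rule fib)
  also have "(\<integral>\<^sup>+x. \<infinity> * indicator ({1..2::real} \<times> {0..\<alpha> / 2}) x \<partial>lborel) =
      \<infinity> * emeasure lborel ({1..2::real} \<times> {0..\<alpha> / 2} :: (real \<times> real) set)"
    by (rule nn_integral_cmult_indicator) (simp add: borel_prod[symmetric])
  finally show ?thesis using assms by (simp add: pos ennreal_top_mult top_unique)
qed

text \<open>
  The scaling factor can be recovered as the square root of the determinant, which makes the cone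
  visibly a Borel set.
\<close>

lemma cone_eq:
  assumes "E \<subseteq> SL2"
  shows "{r *\<^sub>R g | r g. 0 < r \<and> r \<le> 1 \<and> g \<in> E} =
    {M. 0 < det M \<and> det M \<le> 1 \<and> (1 / sqrt (det M)) *\<^sub>R M \<in> E}" (is "?L = ?R")
proof (intro equalityI subsetI)
  fix M assume "M \<in> ?L"
  then obtain r g where M: "M = r *\<^sub>R g" "0 < r" "r \<le> 1" "g \<in> E" by blast
  have "det g = 1" using M(4) assms by (auto simp: SL2_def)
  then have "det M = r\<^sup>2" using M(1) by (simp add: det_scaleR_2)
  then show "M \<in> ?R" using M by (simp add: power_le_one)
next
  fix M assume M: "M \<in> ?R"
  then have "M = sqrt (det M) *\<^sub>R ((1 / sqrt (det M)) *\<^sub>R M)" by simp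
  moreover have "0 < sqrt (det M)" "sqrt (det M) \<le> 1" using M by simp_all
  ultimately show "M \<in> ?L" using M by blast
qed

lemma cone_measurable:
  assumes "E \<in> sets borel" "E \<subseteq> SL2"
  shows "{r *\<^sub>R g | r g. 0 < r \<and> r \<le> 1 \<and> g \<in> E} \<in> sets borel"
proof -
  note [measurable] = assms(1)
  have "{M \<in> space borel. 0 < det M \<and> det M \<le> 1 \<and> (1 / sqrt (det M)) *\<^sub>R M \<in> E} \<in> sets borel"
    by measurable
  then show ?thesis using cone_eq[OF assms(2)] by simp
qed

lemma unipotent_tile_translates_disjoint:
  assumes "\<alpha> > 0" "M ** upper_unipotent (of_int m * \<alpha>) \<in> unipotent_tile \<alpha>"
    "M ** upper_unipotent (of_int n * \<alpha>) \<in> unipotent_tile \<alpha>"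
  shows "m = n"
proof -
  define p q where "p = M $ 1 $ 1" and "q = M $ 1 $ 2"
  have M: "1 \<le> p" "0 \<le> q + of_int m * \<alpha> * p" "q + of_int m * \<alpha> * p < \<alpha> * p"
    "0 \<le> q + of_int n * \<alpha> * p" "q + of_int n * \<alpha> * p < \<alpha> * p"
    using assms(2,3) by (simp_all add: unipotent_tile_def matrix_mult_upper_unipotent p_def q_def)
  have pos: "\<alpha> * p > 0" using assms(1) M(1) by simp
  have "of_int (m - n) * (\<alpha> * p) < 1 * (\<alpha> * p)" "of_int (n - m) * (\<alpha> * p) < 1 * (\<alpha> * p)"
    using M by (simp_all add: algebra_simps)
  then have "of_int (m - n) < (1 :: real)" "of_int (n - m) < (1 :: real)"
    using mult_less_cancel_right_pos[OF pos] by blast+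
  then show ?thesis by linarith
qed

text \<open>
  The usual comparison of two fundamental domains.  The translates of the cone over \<open>E\<close> cover the
  tile, whose volume is infinite.  Moving the pieces back into the cone preserves volume, and they
  remain disjoint for different powers of the generator because the tile meets each orbit at most once.
  The sign doubles the bound.
\<close>

lemma SL2_haar_unipotent_infinite:
  assumes \<alpha>: "\<alpha> > 0" and E: "E \<in> sets borel" "E \<subseteq> SL2"
    and \<Gamma>: "\<And>h. h \<in> \<Gamma> \<Longrightarrow> \<exists>n :: int. h = upper_unipotent (of_int n * \<alpha>) \<or> h = - upper_unipotent (of_int n * \<alpha>)"
    and cover: "\<And>g. g \<in> SL2 \<Longrightarrow> \<exists>h\<in>\<Gamma>. g ** h \<in> E"
  shows "SL2_haar E = \<infinity>"
proof -
  let ?Q = "unipotent_tile \<alpha>"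
  define C where "C = {r *\<^sub>R g | r g. 0 < r \<and> r \<le> 1 \<and> g \<in> E}"
  have C [measurable]: "C \<in> sets borel" unfolding C_def by (rule cone_measurable[OF E])
  have negC [measurable]: "uminus -` C \<in> sets borel"
    using measurable_sets[OF borel_measurable_uminus[OF measurable_ident_sets[OF refl]] C] by simp
  define u where "u k = of_int (int_decode k) * \<alpha>" for k
  define R where "R \<kappa> = (\<lambda>M :: real^2^2. M ** upper_unipotent \<kappa>)" for \<kappa>
  have R [measurable]: "R \<kappa> \<in> borel_measurable borel" for \<kappa> unfolding R_def by simp
  have vR: "R \<kappa> -` A \<in> sets borel" if "A \<in> sets borel" for A \<kappa>
    using measurable_sets[OF R that] by simp
  have R_inv: "R \<kappa> (R (- \<kappa>) M) = M" for \<kappa> M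
    by (simp add: R_def matrix_eq_iff_2 matrix_mult_upper_unipotent)
  define D where "D = C \<union> uminus -` C"
  have D [measurable]: "D \<in> sets borel" by (simp add: D_def)
  have cov: "?Q \<subseteq> (\<Union>k. ?Q \<inter> R (u k) -` D)"
  proof
    fix M assume M: "M \<in> ?Q"
    define d where "d = sqrt (det M)"
    have d: "0 < d" "d \<le> 1" "d\<^sup>2 = det M" using M by (auto simp: d_def unipotent_tile_def)
    have "(1 / d) *\<^sub>R M \<in> SL2" using d(3) M by (simp add: SL2_def det_scaleR_2 power_divide unipotent_tile_def)
    then obtain h where h: "h \<in> \<Gamma>" "(1 / d) *\<^sub>R M ** h \<in> E" using cover by blast
    have "M ** h = d *\<^sub>R ((1 / d) *\<^sub>R M ** h)" using d by (simp add: scaleR_matrix_mult)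
    then have MC: "M ** h \<in> C" unfolding C_def using d h by blast
    obtain n :: int where n: "h = upper_unipotent (of_int n * \<alpha>) \<or> h = - upper_unipotent (of_int n * \<alpha>)"
      using \<Gamma>[OF h(1)] by blast
    have "u (int_encode n) = of_int n * \<alpha>" by (simp add: u_def)
    then have "R (u (int_encode n)) M \<in> D"
      using n MC by (auto simp: R_def D_def matrix_mult_uminus)
    then show "M \<in> (\<Union>k. ?Q \<inter> R (u k) -` D)" using M by blast
  qed
  \<comment> \<open>Each piece of the tile is moved back into the cone by a map that preserves volume.\<close>
  have eq: "emeasure lborel (?Q \<inter> R (u k) -` D) = emeasure lborel (R (- u k) -` ?Q \<inter> D)" for k
  proof -
    have "emeasure lborel (?Q \<inter> R (u k) -` D) = emeasure lborel (R (- u k) -` (?Q \<inter> R (u k) -` D))"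
      unfolding R_def by (rule emeasure_vimage_mult_unipotent[symmetric])
        (use vR[OF D, of "u k"] in \<open>simp add: R_def\<close>)
    also have "R (- u k) -` (?Q \<inter> R (u k) -` D) = R (- u k) -` ?Q \<inter> D"
      using R_inv[of "u k"] by auto
    finally show ?thesis .
  qed
  have disj: "disjoint_family (\<lambda>k. R (- u k) -` ?Q \<inter> D)"
  unfolding disjoint_family_on_def
  proof (intro ballI impI, rule ccontr)
    fix k l :: nat assume kl: "k \<noteq> l" "(R (- u k) -` ?Q \<inter> D) \<inter> (R (- u l) -` ?Q \<inter> D) \<noteq> {}"
    then obtain M where "R (- u k) M \<in> ?Q" "R (- u l) M \<in> ?Q" by blast
    then have "- int_decode k = - int_decode l"
      using unipotent_tile_translates_disjoint[OF \<alpha>, of M "- int_decode k" "- int_decode l"]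
      by (simp add: R_def u_def)
    then show False using kl(1) inj_int_decode by (simp add: inj_eq)
  qed
  have "\<infinity> = emeasure lborel ?Q" by (simp add: emeasure_unipotent_tile[OF \<alpha>])
  also have "\<dots> \<le> emeasure lborel (\<Union>k. ?Q \<inter> R (u k) -` D)"
    by (intro emeasure_mono cov) (simp add: vR[OF D])
  also have "\<dots> \<le> (\<Sum>k. emeasure lborel (?Q \<inter> R (u k) -` D))"
    by (rule emeasure_subadditive_countably) (use vR[OF D] in auto)
  also have "\<dots> = (\<Sum>k. emeasure lborel (R (- u k) -` ?Q \<inter> D))" by (simp add: eq)
  also have "\<dots> = emeasure lborel (\<Union>k. R (- u k) -` ?Q \<inter> D)"
    by (rule suminf_emeasure[OF _ disj]) (use vR[of ?Q] in auto)
  also have "\<dots> \<le> emeasure lborel D" by (rule emeasure_mono) auto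
  also have "\<dots> \<le> emeasure lborel C + emeasure lborel (uminus -` C)"
    unfolding D_def by (rule emeasure_subadditive) simp_all
  also have "\<dots> = emeasure lborel C + emeasure lborel C"
    by (simp add: emeasure_vimage_uminus)
  finally have "emeasure lborel C = \<infinity>" by (simp add: top_unique ennreal_add_eq_top)
  then show ?thesis by (simp add: SL2_haar_def C_def)
qed

text \<open>
  Conjugating the generator of the stabilizer by an upper triangular \<open>g\<close> with diagonal entry \<open>\<lambda>\<close>
  multiplies its width by \<open>\<lambda>\<^sup>2\<close>, so \<open>\<lambda>\<^sup>2\<close> is an integer.  The same holds for the inverse of \<open>g\<close>,
  hence \<open>\<lambda> = 1\<close> or \<open>\<lambda> = - 1\<close>.  A group of upper triangular matrices would thus be the stabilizer up to
  sign, and this has infinite covolume.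
\<close>

lemma lattice_not_upper_triangular:
  assumes \<Gamma>: "lattice_SL2 \<Gamma>" and minus: "- mat 1 \<in> \<Gamma>" and width: "stabilizer_width \<Gamma> \<alpha>"
  shows "\<exists>g\<in>\<Gamma>. g $ 2 $ 1 \<noteq> 0"
proof (rule ccontr)
  assume "\<not> ?thesis"
  then have tri: "g $ 2 $ 1 = 0" if "g \<in> \<Gamma>" for g using that by blast
  have sub: "SL2_subgroup \<Gamma>" using \<Gamma> by (simp add: lattice_SL2_def)
  have \<alpha>: "\<alpha> > 0" and stab: "{g \<in> \<Gamma>. g *v vector [1, 0] = vector [1, 0]} =
      range (\<lambda>n::int. upper_unipotent (of_int n * \<alpha>))"
    using width by (simp_all add: stabilizer_width_def)
  have fix_iff: "g *v vector [1, 0] = vector [1, 0] \<longleftrightarrow> g $ 1 $ 1 = 1 \<and> g $ 2 $ 1 = 0" for g :: "real^2^2"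
    by (simp add: vector_eq_iff_2 matrix_vector_2)
  have u: "upper_unipotent \<alpha> \<in> \<Gamma>"
  proof -
    have "upper_unipotent (of_int 1 * \<alpha>) \<in> {g \<in> \<Gamma>. g *v vector [1, 0] = vector [1, 0]}"
      unfolding stab by blast
    then show ?thesis by simp
  qed
  have diag: "g $ 1 $ 1 * g $ 2 $ 2 = 1" if "g \<in> \<Gamma>" for g
    using that sub tri[OF that] by (auto simp: SL2_subgroup_def SL2_def det_2)
  have int_sq: "\<exists>n :: int. (g $ 1 $ 1)\<^sup>2 = of_int n" if g: "g \<in> \<Gamma>" for g
  proof -
    let ?c = "g ** upper_unipotent \<alpha> ** matrix_inv g"
    have gi: "matrix_inv g \<in> \<Gamma>" using g sub by (simp add: SL2_subgroup_def)
    have c: "?c \<in> \<Gamma>" using g gi u sub by (simp add: SL2_subgroup_def)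
    have "g \<in> SL2" using g sub by (auto simp: SL2_subgroup_def)
    then have "matrix_inv g ** g = mat 1" by (rule SL2_inverse)
    \<comment> \<open>Comparing the first rows of both sides determines the conjugate without computing the inverse.\<close>
    then have cg: "?c ** g = g ** upper_unipotent \<alpha>" by (metis matrix_mul_assoc matrix_mul_rid)
    have e: "(?c ** g) $ 1 $ 1 = ?c $ 1 $ 1 * g $ 1 $ 1"
      "(?c ** g) $ 1 $ 2 = ?c $ 1 $ 1 * g $ 1 $ 2 + ?c $ 1 $ 2 * g $ 2 $ 2"
      using tri[OF g] by (simp_all add: matrix_matrix_mult_def[of ?c g] sum_2)
    have nz: "g $ 1 $ 1 \<noteq> 0" using diag[OF g] by auto
    have c11: "?c $ 1 $ 1 = 1" using e(1) nz unfolding cg by (simp add: matrix_mult_upper_unipotent)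
    then have "?c *v vector [1, 0] = vector [1, 0]" using fix_iff tri[OF c] by simp
    then have "?c \<in> range (\<lambda>n::int. upper_unipotent (of_int n * \<alpha>))" using stab c by blast
    then obtain n :: int where "?c = upper_unipotent (of_int n * \<alpha>)" by blast
    then have c12: "?c $ 1 $ 2 = of_int n * \<alpha>" by (simp add: upper_unipotent_def)
    have "\<alpha> * g $ 1 $ 1 = of_int n * \<alpha> * g $ 2 $ 2"
      using e(2) c11 c12 unfolding cg by (simp add: matrix_mult_upper_unipotent)
    then have "g $ 1 $ 1 = of_int n * g $ 2 $ 2" using \<alpha> by simp
    then have "(g $ 1 $ 1)\<^sup>2 = of_int n * (g $ 1 $ 1 * g $ 2 $ 2)" by (simp add: power2_eq_square)
    then show ?thesis using diag[OF g] by auto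
  qed
  have unip: "\<exists>n :: int. h = upper_unipotent (of_int n * \<alpha>) \<or> h = - upper_unipotent (of_int n * \<alpha>)"
    if h: "h \<in> \<Gamma>" for h
  proof -
    let ?l = "h $ 1 $ 1"
    have hi: "matrix_inv h \<in> \<Gamma>" using h sub by (simp add: SL2_subgroup_def)
    have "h \<in> SL2" using h sub by (auto simp: SL2_subgroup_def)
    then have "h ** matrix_inv h = mat 1" by (rule SL2_inverse)
    then have "(h ** matrix_inv h) $ 1 $ 1 = 1" by (simp add: mat_def)
    then have li: "?l * matrix_inv h $ 1 $ 1 = 1"
      using tri[OF hi] by (simp add: matrix_matrix_mult_def sum_2)
    obtain n m :: int where nm: "?l\<^sup>2 = of_int n" "(matrix_inv h $ 1 $ 1)\<^sup>2 = of_int m"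
      using int_sq[OF h] int_sq[OF hi] by blast
    have "of_int (n * m) = (?l * matrix_inv h $ 1 $ 1)\<^sup>2" using nm by (simp add: power_mult_distrib)
    then have "n * m = 1" using li by (metis of_int_eq_1_iff power_one)
    moreover have "n \<ge> 0" using nm(1) by (metis of_int_0_le_iff zero_le_power2)
    ultimately have "n = 1" using zmult_eq_1_iff by auto
    then have "?l = 1 \<or> ?l = - 1" using nm(1) by (simp add: power2_eq_1_iff)
    then show ?thesis
    proof
      assume "?l = 1"
      then have "h *v vector [1, 0] = vector [1, 0]" using fix_iff tri[OF h] by simp
      then have "h \<in> range (\<lambda>n::int. upper_unipotent (of_int n * \<alpha>))" using stab h by blast
      then show ?thesis by blast
    next
      assume l: "?l = - 1"
      have "h ** (- mat 1) \<in> \<Gamma>" using h minus sub by (simp add: SL2_subgroup_def)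
      then have nh: "- h \<in> \<Gamma>" by (simp add: matrix_mult_uminus)
      then have "- h *v vector [1, 0] = vector [1, 0]" using fix_iff tri[OF nh] l by simp
      then have "- h \<in> range (\<lambda>n::int. upper_unipotent (of_int n * \<alpha>))" using stab nh by blast
      then obtain n :: int where "- h = upper_unipotent (of_int n * \<alpha>)" by blast
      then have "h = - upper_unipotent (of_int n * \<alpha>)" by (metis minus_minus)
      then show ?thesis by blast
    qed
  qed
  obtain E where E: "E \<in> sets borel" "E \<subseteq> SL2" "\<forall>g\<in>SL2. \<exists>!h. h \<in> \<Gamma> \<and> g ** h \<in> E" "SL2_haar E < \<infinity>"
    using \<Gamma> by (auto simp: lattice_SL2_def)
  have "SL2_haar E = \<infinity>"
  proof (rule SL2_haar_unipotent_infinite[OF \<alpha> E(1,2), of \<Gamma>])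
    show "\<exists>h\<in>\<Gamma>. g ** h \<in> E" if "g \<in> SL2" for g using E(3) that by blast
  qed (rule unip)
  then show False using E(4) by simp
qed

section \<open>Heights of a discrete invariant set\<close>

text \<open>
  The counting argument uses the surface only through these properties of its visible holonomy
  vectors.
\<close>

locale discrete_unipotent_invariant =
  fixes \<Lambda> :: "(real^2) set" and \<alpha> :: real
  assumes \<alpha>_pos: "\<alpha> > 0"
    and translate: "\<And>v n. v \<in> \<Lambda> \<Longrightarrow> vector [v $ 1 + of_int n * \<alpha> * v $ 2, v $ 2] \<in> \<Lambda>"
    and finite_bounded: "\<And>R. finite {v \<in> \<Lambda>. norm v \<le> R}"
    and heights_unbounded: "\<And>R. \<exists>j\<in>heights \<Lambda>. R < j"

begin

abbreviation "H \<equiv> heights \<Lambda>"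

abbreviation "Hb \<equiv> heights_below \<Lambda>"

abbreviation "\<Phi> \<equiv> phi_sum \<Lambda> \<alpha>"

abbreviation "\<zeta> \<equiv> zeta \<Lambda>"

lemma heights_pos: "j \<in> H \<Longrightarrow> 0 < j"
  by (auto simp: heights_def)

lemma finite_subset_components:
  assumes "S \<subseteq> \<Lambda>" "\<And>v. v \<in> S \<Longrightarrow> \<bar>v $ 1\<bar> \<le> B \<and> \<bar>v $ 2\<bar> \<le> C"
  shows "finite S"
proof (rule finite_subset[OF _ finite_bounded])
  show "S \<subseteq> {v \<in> \<Lambda>. norm v \<le> B + C}"
  proof
    fix v assume v: "v \<in> S"
    have "norm v \<le> \<bar>v $ 1\<bar> + \<bar>v $ 2\<bar>" using norm_le_l1_cart[of v] by (simp add: sum_2)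
    then show "v \<in> {v \<in> \<Lambda>. norm v \<le> B + C}" using assms(1) assms(2)[OF v] v by auto
  qed
qed

text \<open>
  Representatives of the vectors of height \<open>j\<close> modulo \<open>x \<mapsto> x + \<alpha> * j\<close>.
\<close>

definition strip :: "real \<Rightarrow> real set" where
  "strip j = {x. vector [x, j] \<in> \<Lambda> \<and> 0 \<le> x \<and> x < \<alpha> * j}"

lemma phi_eq_card_strip: "phi \<Lambda> \<alpha> j = card (strip j)"
  by (simp add: phi_def strip_def)

lemma finite_strip: "finite (strip j)"
proof -
  have "finite ((\<lambda>x. vector [x, j] :: real^2) ` strip j)"
    by (rule finite_subset_components[of _ "\<alpha> * j" "\<bar>j\<bar>"]) (auto simp: strip_def)
  moreover have "inj_on (\<lambda>x. vector [x, j] :: real^2) (strip j)"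
    by (auto simp: inj_on_def vector_eq_iff_2)
  ultimately show ?thesis by (rule finite_imageD)
qed

lemma in_strip_translate:
  assumes "v \<in> \<Lambda>" "v $ 2 > 0"
  obtains n :: int where "v $ 1 - of_int n * \<alpha> * v $ 2 \<in> strip (v $ 2)"
proof
  let ?P = "\<alpha> * v $ 2" let ?n = "\<lfloor>v $ 1 / ?P\<rfloor>"
  have P: "?P > 0" using \<alpha>_pos assms(2) by simp
  have "of_int ?n * ?P \<le> v $ 1"
    by (rule iffD1[OF pos_le_divide_eq[OF P]]) (rule of_int_floor_le)
  moreover have "v $ 1 < (of_int ?n + 1) * ?P"
    by (rule iffD1[OF pos_divide_less_eq[OF P]]) (rule real_of_int_floor_add_one_gt)
  ultimately show "v $ 1 - of_int ?n * \<alpha> * v $ 2 \<in> strip (v $ 2)"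
    using translate[OF assms(1), of "- ?n"] by (simp add: strip_def algebra_simps)
qed

lemma finite_heights_below: "finite (Hb R)"
proof -
  let ?S = "{v \<in> \<Lambda>. 0 < v $ 2 \<and> v $ 2 < R \<and> 0 \<le> v $ 1 \<and> v $ 1 < \<alpha> * v $ 2}"
  have "finite ?S"
  proof (rule finite_subset_components[of _ "\<alpha> * R" R])
    fix v assume v: "v \<in> ?S"
    then have "\<alpha> * v $ 2 \<le> \<alpha> * R" using \<alpha>_pos by simp
    then show "\<bar>v $ 1\<bar> \<le> \<alpha> * R \<and> \<bar>v $ 2\<bar> \<le> R" using v by auto
  qed auto
  moreover have "Hb R \<subseteq> (\<lambda>v. v $ 2) ` ?S"
  proof
    fix j assume j: "j \<in> Hb R"
    then obtain v where v: "v \<in> \<Lambda>" "j = v $ 2" "0 < v $ 2" "v $ 2 < R"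
      by (auto simp: heights_below_def heights_def)
    obtain n where "v $ 1 - of_int n * \<alpha> * v $ 2 \<in> strip (v $ 2)"
      using in_strip_translate[OF v(1,3)] by blast
    then have "vector [v $ 1 - of_int n * \<alpha> * v $ 2, v $ 2] \<in> ?S" using v by (simp add: strip_def)
    then show "j \<in> (\<lambda>v. v $ 2) ` ?S" by (rule image_eqI[rotated]) (simp add: v(2))
  qed
  ultimately show ?thesis by (rule finite_surj)
qed

text \<open>
  Local finiteness turns the infimum in the definition of \<open>zeta\<close> into a minimum, and unboundedness
  makes the set over which it is taken nonempty.
\<close>

lemma zeta_Suc:
  shows "\<zeta> (Suc k) \<in> H" "\<zeta> k < \<zeta> (Suc k)" "\<And>j. j \<in> H \<Longrightarrow> \<zeta> k < j \<Longrightarrow> \<zeta> (Suc k) \<le> j"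
proof -
  let ?S = "{j \<in> H. \<zeta> k < j}"
  obtain j0 where j0: "j0 \<in> ?S" using heights_unbounded by blast
  let ?T = "?S \<inter> {..j0}"
  have "?T \<subseteq> Hb (j0 + 1)" using heights_pos by (auto simp: heights_below_def)
  then have fT: "finite ?T" using finite_heights_below finite_subset by blast
  have T: "?T \<noteq> {}" using j0 by blast
  have min: "Min ?T \<le> j" if "j \<in> ?S" for j
  proof (cases "j \<le> j0")
    case True
    then show ?thesis using that fT by (intro Min_le) auto
  next
    case False
    have "Min ?T \<le> j0" using fT j0 by (intro Min_le) auto
    then show ?thesis using False by simp
  qed
  have mem: "Min ?T \<in> ?S" using Min_in[OF fT T] by blast
  have "\<zeta> (Suc k) = Min ?T"
    using mem min by (simp, intro cInf_eq_minimum) auto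
  then show "\<zeta> (Suc k) \<in> H" "\<zeta> k < \<zeta> (Suc k)" "\<And>j. j \<in> H \<Longrightarrow> \<zeta> k < j \<Longrightarrow> \<zeta> (Suc k) \<le> j"
    using mem min by auto
qed

declare zeta.simps(2) [simp del]

lemma zeta_strict_mono: "strict_mono \<zeta>"
  using zeta_Suc(2) by (simp add: strict_mono_Suc_iff)

lemma zeta_gap: "j \<in> H \<Longrightarrow> j < \<zeta> (Suc k) \<Longrightarrow> j \<le> \<zeta> k"
  using zeta_Suc(3) by (meson leD leI)

lemma last_index:
  assumes "x \<ge> 0"
  shows "\<zeta> (last_index \<Lambda> x) \<le> x" "x < \<zeta> (Suc (last_index \<Lambda> x))"
proof -
  let ?S = "{k. \<zeta> k \<le> x}"
  have "\<zeta> ` ?S \<subseteq> insert 0 (Hb (x + 1))"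
  proof
    fix z assume "z \<in> \<zeta> ` ?S"
    then obtain k where k: "\<zeta> k \<le> x" "z = \<zeta> k" by blast
    show "z \<in> insert 0 (Hb (x + 1))"
      using k zeta_Suc(1) heights_pos by (cases k) (auto simp: heights_below_def)
  qed
  then have "finite (\<zeta> ` ?S)" using finite_heights_below by (meson finite_insert finite_subset)
  then have fin: "finite ?S"
    using inj_on_subset[OF strict_mono_imp_inj_on[OF zeta_strict_mono] subset_UNIV] by (rule finite_imageD)
  have "0 \<in> ?S" using assms by simp
  then have "?S \<noteq> {}" by blast
  from Max_in[OF fin this] show "\<zeta> (last_index \<Lambda> x) \<le> x" by (simp add: last_index_def)
  have "Suc (last_index \<Lambda> x) \<notin> ?S"
    using Max_ge[OF fin] unfolding last_index_def by (metis Suc_n_not_le_n)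
  then show "x < \<zeta> (Suc (last_index \<Lambda> x))" by simp
qed

section \<open>The step function of the heights and its integral\<close>

definition weight :: "real \<Rightarrow> real" where "weight j = real (phi \<Lambda> \<alpha> j) / j"

text \<open>
  The integral of \<open>\<Phi>\<close> from \<open>0\<close> to \<open>x\<close>: a height \<open>j < x\<close> contributes its weight on \<open>{j..x}\<close>.
\<close>

definition phi_integral :: "real \<Rightarrow> real" where "phi_integral x = (\<Sum>j\<in>Hb x. weight j * (x - j))"

lemma phi_sum_eq: "\<Phi> x = (\<Sum>j\<in>Hb x. weight j)"
  by (simp add: phi_sum_def weight_def)

lemma weight_nonneg: "j \<in> Hb x \<Longrightarrow> 0 \<le> weight j"
  by (simp add: weight_def heights_below_def)

lemma phi_sum_nonneg: "0 \<le> \<Phi> x"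
  unfolding phi_sum_eq by (intro sum_nonneg weight_nonneg)

text \<open>
  \<open>\<Phi>\<close> is constant on \<open>{x<..y}\<close> if no height lies strictly between \<open>x\<close> and \<open>y\<close>: it is continuous from
  the left, so it does not jump before \<open>y\<close> even if \<open>y\<close> is a height.
\<close>

lemma phi_integral_diff:
  assumes "x \<le> y" "\<And>j. j \<in> H \<Longrightarrow> j < y \<Longrightarrow> j \<le> x"
  shows "phi_integral y - phi_integral x = (y - x) * \<Phi> y"
proof -
  have "(\<Sum>j\<in>Hb x. weight j * (x - j)) = (\<Sum>j\<in>Hb y. weight j * (x - j))"
  proof (rule sum.mono_neutral_left)
    show "Hb x \<subseteq> Hb y" using assms(1) by (auto simp: heights_below_def)
    show "\<forall>j\<in>Hb y - Hb x. weight j * (x - j) = 0"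
    proof
      fix j assume j: "j \<in> Hb y - Hb x"
      then have "j \<le> x" "x \<le> j" using assms(2)[of j] by (auto simp: heights_below_def)
      then show "weight j * (x - j) = 0" by simp
    qed
  qed (rule finite_heights_below)
  then have "phi_integral y - phi_integral x = (\<Sum>j\<in>Hb y. weight j * (y - j) - weight j * (x - j))"
    by (simp add: phi_integral_def sum_subtractf)
  also have "\<dots> = (\<Sum>j\<in>Hb y. (y - x) * weight j)" by (simp add: algebra_simps)
  finally show ?thesis by (simp add: phi_sum_eq sum_distrib_left)
qed

lemma phi_integral_zeta_1: "phi_integral (\<zeta> 1) = 0"
proof -
  have "Hb (\<zeta> 1) = {}"
    using zeta_gap[of _ 0] heights_pos by (force simp: heights_below_def)
  then show ?thesis by (simp add: phi_integral_def)
qed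

text \<open>
  \<open>\<Phi>\<close> vanishes up to the first height, so the sum may start there.
\<close>

lemma zeta_telescope:
  "(\<Sum>l = 1..n. (\<zeta> (l + 1) - \<zeta> l) / c * \<Phi> (\<zeta> (l + 1))) = phi_integral (\<zeta> (n + 1)) / c"
proof (induction n)
  case 0
  then show ?case using phi_integral_zeta_1 by simp
next
  case (Suc n)
  have "phi_integral (\<zeta> (Suc (Suc n))) - phi_integral (\<zeta> (Suc n)) = (\<zeta> (Suc (Suc n)) - \<zeta> (Suc n)) * \<Phi> (\<zeta> (Suc (Suc n)))"
    using zeta_Suc(2)[of "Suc n"] zeta_gap[of _ "Suc n"] by (intro phi_integral_diff) auto
  then have "phi_integral (\<zeta> (Suc (Suc n))) = phi_integral (\<zeta> (Suc n)) + (\<zeta> (Suc (Suc n)) - \<zeta> (Suc n)) * \<Phi> (\<zeta> (Suc (Suc n)))"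
    by simp
  then show ?case using Suc by (simp add: add_divide_distrib)
qed

text \<open>
  Each term is an integral of \<open>\<Phi>\<close>, divided by \<open>c\<close>.  If some height lies in \<open>{c * s0<..c}\<close>, the
  three intervals make up \<open>{c * s0..c}\<close>.  Otherwise the intervals of \<open>I1_jump\<close> and \<open>I3\<close> overlap in
  \<open>{c * s0..c}\<close>, and \<open>I2\<close> is minus the integral over their union.  With \<open>c * s0\<close> itself a height,
  \<open>\<Phi> (c * s0)\<close> is not the value of \<open>\<Phi>\<close> just after \<open>c * s0\<close>; this is the difference between \<open>I1\<close>
  and \<open>I1_jump\<close>.
\<close>

lemma I_sum_eq:
  assumes c: "c > 0" and s0: "0 < s0" "s0 < 1"
  shows "I1_jump \<Lambda> \<alpha> c s0 = (phi_integral (\<zeta> (Suc (last_index \<Lambda> (c * s0)))) - phi_integral (c * s0)) / c"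
    and "I2 \<Lambda> \<alpha> c s0 = (phi_integral (\<zeta> (last_index \<Lambda> c)) - phi_integral (\<zeta> (Suc (last_index \<Lambda> (c * s0))))) / c"
    and "I3 \<Lambda> \<alpha> c = (phi_integral c - phi_integral (\<zeta> (last_index \<Lambda> c))) / c"
    and "c * s0 \<notin> H \<Longrightarrow> I1 \<Lambda> \<alpha> c s0 = I1_jump \<Lambda> \<alpha> c s0"
    and "0 \<le> I1_jump \<Lambda> \<alpha> c s0" "0 \<le> I3 \<Lambda> \<alpha> c"
proof -
  let ?k1 = "last_index \<Lambda> (c * s0)" let ?k2 = "last_index \<Lambda> c"
  have k1: "\<zeta> ?k1 \<le> c * s0" "c * s0 < \<zeta> (Suc ?k1)" using last_index[of "c * s0"] c s0 by auto
  have k2: "\<zeta> ?k2 \<le> c" "c < \<zeta> (Suc ?k2)" using last_index[of c] c by auto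
  have "phi_integral (\<zeta> (Suc ?k1)) - phi_integral (c * s0) = (\<zeta> (Suc ?k1) - c * s0) * \<Phi> (\<zeta> (Suc ?k1))"
  proof (rule phi_integral_diff)
    show "c * s0 \<le> \<zeta> (Suc ?k1)" using k1 by simp
    show "j \<le> c * s0" if "j \<in> H" "j < \<zeta> (Suc ?k1)" for j
      using zeta_gap[OF that] k1 by simp
  qed
  then show "I1_jump \<Lambda> \<alpha> c s0 = (phi_integral (\<zeta> (Suc ?k1)) - phi_integral (c * s0)) / c"
    by (simp add: I1_jump_def)
  have "(\<Sum>l = 1..?k2 - 1. (\<zeta> (l + 1) - \<zeta> l) / c * \<Phi> (\<zeta> (l + 1))) = phi_integral (\<zeta> ?k2) / c"
  proof (cases ?k2)
    case 0
    \<comment> \<open>Without a height up to \<open>c\<close> the index refers to \<open>\<zeta> 0 = 0\<close>, where the integral of \<open>\<Phi>\<close> vanishes.\<close>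
    have "Hb 0 = {}" by (auto simp: heights_below_def)
    then show ?thesis using 0 by (simp add: phi_integral_def)
  next
    case (Suc n)
    then show ?thesis using zeta_telescope[of c n] by simp
  qed
  then show "I2 \<Lambda> \<alpha> c s0 = (phi_integral (\<zeta> ?k2) - phi_integral (\<zeta> (Suc ?k1))) / c"
    unfolding I2_def zeta_telescope by (simp add: diff_divide_distrib)
  have "phi_integral c - phi_integral (\<zeta> ?k2) = (c - \<zeta> ?k2) * \<Phi> c"
  proof (rule phi_integral_diff)
    show "j \<le> \<zeta> ?k2" if "j \<in> H" "j < c" for j
      using zeta_gap[OF that(1), of ?k2] that k2 by simp
  qed (rule k2)
  then show "I3 \<Lambda> \<alpha> c = (phi_integral c - phi_integral (\<zeta> ?k2)) / c" by (simp add: I3_def)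
  show "I1 \<Lambda> \<alpha> c s0 = I1_jump \<Lambda> \<alpha> c s0" if "c * s0 \<notin> H"
  proof -
    have "Hb (c * s0) = Hb (\<zeta> (Suc ?k1))"
    proof (intro equalityI subsetI)
      fix j assume "j \<in> Hb (c * s0)"
      then show "j \<in> Hb (\<zeta> (Suc ?k1))" using k1 by (simp add: heights_below_def)
    next
      fix j assume j: "j \<in> Hb (\<zeta> (Suc ?k1))"
      then have "j \<le> c * s0" using zeta_gap[of j ?k1] k1 by (simp add: heights_below_def)
      moreover have "j \<noteq> c * s0" using j that by (auto simp: heights_below_def)
      ultimately show "j \<in> Hb (c * s0)" using j by (simp add: heights_below_def)
    qed
    then show ?thesis by (simp add: I1_def I1_jump_def phi_sum_def)
  qed
  show "0 \<le> I1_jump \<Lambda> \<alpha> c s0" "0 \<le> I3 \<Lambda> \<alpha> c"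
    using k1 k2 c phi_sum_nonneg by (auto simp: I1_jump_def I3_def intro!: mult_nonneg_nonneg divide_nonneg_nonneg)
qed

end

section \<open>Unfolding the orbit count\<close>

text \<open>
  The translates \<open>{T + (n - 1) * P<..T + n * P}\<close> of the fundamental interval tile the line, so they
  cut \<open>{p..<q}\<close> into pieces; translating each piece back by \<open>n * P\<close> gives the summands.
\<close>

lemma measure_tiles:
  fixes P p q T :: real
  assumes P: "P > 0" and pq: "p \<le> q" and N: "finite N"
    and cover: "\<And>n :: int. {T - P<..T} \<inter> {p - of_int n * P..<q - of_int n * P} \<noteq> {} \<Longrightarrow> n \<in> N"
  shows "(\<Sum>n\<in>N. measure lborel ({T - P<..T} \<inter> {p - of_int n * P..<q - of_int n * P})) = q - p"
proof -
  define B where "B n = {p..<q} \<inter> {T + (of_int n - 1) * P<..T + of_int n * P}" for n :: int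
  have shift: "measure lborel ({T - P<..T} \<inter> {p - of_int n * P..<q - of_int n * P}) = measure lborel (B n)" for n
  proof -
    have "measure lborel (B n) = measure (distr lborel borel ((+) (of_int n * P))) (B n)"
      by (simp add: lborel_distr_plus)
    also have "\<dots> = measure lborel ((+) (of_int n * P) -` B n)"
      by (subst measure_distr) (simp_all add: B_def)
    also have "(+) (of_int n * P) -` B n = {T - P<..T} \<inter> {p - of_int n * P..<q - of_int n * P}"
      by (auto simp: B_def algebra_simps)
    finally show ?thesis by simp
  qed
  have disj: "disjoint_family_on B N"
    unfolding disjoint_family_on_def
  proof (intro ballI impI, rule ccontr)
    fix m n :: int assume "m \<noteq> n" "B m \<inter> B n \<noteq> {}"
    then obtain y where "(of_int m - 1) * P < y - T" "y - T \<le> of_int m * P"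
      "(of_int n - 1) * P < y - T" "y - T \<le> of_int n * P"
      by (auto simp: B_def less_diff_eq diff_le_eq add.commute)
    then have "(of_int m - 1) * P < of_int n * P" "(of_int n - 1) * P < of_int m * P" by linarith+
    then have "real_of_int m - 1 < of_int n" "real_of_int n - 1 < of_int m"
      using P mult_less_cancel_right_pos by blast+
    then show False using \<open>m \<noteq> n\<close> by linarith
  qed
  have "(\<Union>n\<in>N. B n) = {p..<q}"
  proof (intro equalityI subsetI)
    fix y assume y: "y \<in> {p..<q}"
    let ?n = "\<lceil>(y - T) / P\<rceil>"
    have n: "(of_int ?n - 1) * P < y - T" "y - T \<le> of_int ?n * P"
      by (rule iffD1[OF pos_less_divide_eq[OF P]], linarith)
        (rule iffD1[OF pos_divide_le_eq[OF P]], rule le_of_int_ceiling)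
    then have "y - of_int ?n * P \<in> {T - P<..T} \<inter> {p - of_int ?n * P..<q - of_int ?n * P}"
      using y by (simp add: algebra_simps)
    then have "?n \<in> N" using cover by blast
    moreover have "y \<in> B ?n" using y n by (simp add: B_def algebra_simps)
    ultimately show "y \<in> (\<Union>n\<in>N. B n)" by blast
  qed (auto simp: B_def)
  moreover have "measure lborel (\<Union>n\<in>N. B n) = (\<Sum>n\<in>N. measure lborel (B n))"
  proof (rule measure_finite_Union[OF N _ disj])
    show "B ` N \<subseteq> sets lborel" by (auto simp: B_def)
    show "emeasure lborel (B n) \<noteq> \<infinity>" if "n \<in> N" for n
      using emeasure_bounded_finite[of "B n"] bounded_subset[of "{p..<q}" "B n"] by (auto simp: B_def)
  qed
  ultimately show ?thesis using pq by (simp add: shift)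
qed

context discrete_unipotent_invariant

begin

definition time_set :: "real \<Rightarrow> real \<Rightarrow> real \<Rightarrow> real^2 \<Rightarrow> real set" where
  "time_set s a b v = {t \<in> {1 - \<alpha> * s<..1}. a \<le> s * v $ 1 + t * v $ 2 \<and> s * v $ 1 + t * v $ 2 < b}"

lemma time_set_eq:
  assumes "v $ 2 > 0"
  shows "time_set s a b v = {1 - \<alpha> * s<..1} \<inter> {(a - s * v $ 1) / v $ 2..<(b - s * v $ 1) / v $ 2}"
  using assms by (auto simp: time_set_def field_simps)

text \<open>
  The vectors of height \<open>j\<close> correspond to pairs of a representative \<open>x\<close> in \<open>strip j\<close> and an integer
  \<open>n\<close>.  For fixed \<open>x\<close>, the time sets are those of \<open>measure_tiles\<close> with period \<open>\<alpha> * s\<close>.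
\<close>

lemma sum_measure_time_set_height:
  assumes s: "s > 0" and ab: "a < b" and j: "j > 0" and L: "finite L" "L \<subseteq> \<Lambda>"
    and support: "\<And>v. v \<in> \<Lambda> \<Longrightarrow> v $ 2 = j \<Longrightarrow> time_set s a b v \<noteq> {} \<Longrightarrow> v \<in> L"
  shows "(\<Sum>v\<in>{v \<in> L. v $ 2 = j}. measure lborel (time_set s a b v)) = (b - a) * weight j"
proof -
  \<comment> \<open>\<open>g\<close> parametrizes the vectors of height \<open>j\<close>, and \<open>N x\<close> selects those of the class of \<open>x\<close> that lie in \<open>L\<close>.\<close>
  define g where "g = (\<lambda>(x, n :: int). vector [x + of_int n * \<alpha> * j, j] :: real^2)"
  define N where "N x = {n. g (x, n) \<in> L}" for x
  have inj: "inj_on g (strip j \<times> UNIV)"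
  proof (rule inj_onI)
    fix y z assume y: "y \<in> strip j \<times> UNIV" and z: "z \<in> strip j \<times> UNIV" and eq: "g y = g z"
    obtain x m where y': "y = (x, m)" by force
    obtain x' n where z': "z = (x', n)" by force
    have e: "x + of_int m * \<alpha> * j = x' + of_int n * \<alpha> * j"
      using eq by (simp add: g_def y' z' vector_eq_iff_2)
    have r: "0 \<le> x" "x < \<alpha> * j" "0 \<le> x'" "x' < \<alpha> * j" using y z by (simp_all add: y' z' strip_def)
    have pos: "\<alpha> * j > 0" using \<alpha>_pos j by simp
    have "of_int (m - n) * (\<alpha> * j) < 1 * (\<alpha> * j)" "of_int (n - m) * (\<alpha> * j) < 1 * (\<alpha> * j)"
      using e r by (simp_all add: algebra_simps)
    then have "of_int (m - n) < (1 :: real)" "of_int (n - m) < (1 :: real)"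
      using mult_less_cancel_right_pos[OF pos] by blast+
    then have "m = n" by linarith
    then show "y = z" using e by (simp add: y' z')
  qed
  have img: "g ` Sigma (strip j) N = {v \<in> L. v $ 2 = j}"
  proof (intro equalityI subsetI)
    fix v assume "v \<in> g ` Sigma (strip j) N"
    then show "v \<in> {v \<in> L. v $ 2 = j}" by (auto simp: N_def g_def)
  next
    fix v assume v: "v \<in> {v \<in> L. v $ 2 = j}"
    then obtain n where n: "v $ 1 - of_int n * \<alpha> * j \<in> strip j"
      using in_strip_translate[of v] j L by auto
    have "g (v $ 1 - of_int n * \<alpha> * j, n) = v" using v by (simp add: g_def vector_eq_iff_2)
    then show "v \<in> g ` Sigma (strip j) N" using n v by (intro image_eqI[of _ _ "(_, n)"]) (auto simp: N_def)
  qed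
  have injS: "inj_on g (Sigma (strip j) N)" by (rule inj_on_subset[OF inj]) auto
  have "finite (g ` Sigma (strip j) N)" unfolding img using L(1) by simp
  then have finS: "finite (Sigma (strip j) N)" using injS by (rule finite_imageD)
  have finN: "finite (N x)" if "x \<in> strip j" for x
  proof -
    have "(Pair x) ` N x \<subseteq> Sigma (strip j) N" using that by auto
    then have "finite (Pair x ` N x)" using finS finite_subset by blast
    then show ?thesis by (rule finite_imageD) (auto simp: inj_on_def)
  qed
  have inner: "(\<Sum>n\<in>N x. measure lborel (time_set s a b (g (x, n)))) = (b - a) / j" if x: "x \<in> strip j" for x
  proof -
    have ts: "time_set s a b (g (x, n)) =
        {1 - \<alpha> * s<..1} \<inter> {(a - s * x) / j - of_int n * (\<alpha> * s)..<(b - s * x) / j - of_int n * (\<alpha> * s)}" for n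
      using j by (subst time_set_eq) (auto simp: g_def field_simps)
    have gL: "g (x, n) \<in> \<Lambda>" for n
      using translate[of "vector [x, j]" n] x by (simp add: g_def strip_def)
    have "(\<Sum>n\<in>N x. measure lborel (time_set s a b (g (x, n)))) = (b - s * x) / j - (a - s * x) / j"
      unfolding ts
    proof (rule measure_tiles)
      show "\<alpha> * s > 0" using \<alpha>_pos s by simp
      show "(a - s * x) / j \<le> (b - s * x) / j" using ab j by (simp add: divide_right_mono)
      fix n :: int
      assume "{1 - \<alpha> * s<..1} \<inter> {(a - s * x) / j - of_int n * (\<alpha> * s)..<(b - s * x) / j - of_int n * (\<alpha> * s)} \<noteq> {}"
      then have "time_set s a b (g (x, n)) \<noteq> {}" using ts by simp
      then have "g (x, n) \<in> L" using support[OF gL] by (simp add: g_def)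
      then show "n \<in> N x" by (simp add: N_def)
    qed (rule finN[OF x])
    also have "\<dots> = (b - a) / j" by (simp add: diff_divide_distrib)
    finally show ?thesis .
  qed
  have "(\<Sum>v\<in>{v \<in> L. v $ 2 = j}. measure lborel (time_set s a b v)) =
      (\<Sum>y\<in>Sigma (strip j) N. measure lborel (time_set s a b (g y)))"
    unfolding img[symmetric] by (subst sum.reindex[OF injS]) simp
  also have "\<dots> = (\<Sum>x\<in>strip j. \<Sum>n\<in>N x. measure lborel (time_set s a b (g (x, n))))"
    using finite_strip finN by (subst sum.Sigma) auto
  also have "\<dots> = (\<Sum>x\<in>strip j. (b - a) / j)" using inner by simp
  also have "\<dots> = (b - a) * weight j" by (simp add: weight_def phi_eq_card_strip)
  finally show ?thesis .
qed

section \<open>The integral of the orbit count\<close>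

definition hit_set :: "real \<Rightarrow> real \<Rightarrow> real \<Rightarrow> real \<Rightarrow> real^2 \<Rightarrow> (real \<times> real) set" where
  "hit_set s0 a b c v = {(s, t). s0 \<le> s \<and> s \<le> 1 \<and> 0 < v $ 2 \<and> v $ 2 < c * s \<and> t \<in> time_set s a b v}"

text \<open>
  A finite set containing every vector that is mapped into the box for some point of \<open>\<Omega>\<^sup>0\<close>.  The
  bound on the norm comes from \<open>\<bar>t\<bar> \<le> 1 + \<alpha>\<close>, \<open>v $ 2 \<le> c\<close> and \<open>s0 \<le> s\<close>.
\<close>

definition relevant :: "real \<Rightarrow> real \<Rightarrow> real \<Rightarrow> real \<Rightarrow> (real^2) set" where
  "relevant s0 a b c = {v \<in> \<Lambda>. norm v \<le> (\<bar>a\<bar> + \<bar>b\<bar> + (1 + \<alpha>) * c) / s0 + c}"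

lemma finite_relevant: "finite (relevant s0 a b c)"
  unfolding relevant_def by (rule finite_bounded)

lemma hit_set_relevant:
  assumes v: "v \<in> \<Lambda>" and s0: "0 < s0" and c: "0 < c" and st: "(s, t) \<in> hit_set s0 a b c v"
  shows "v \<in> relevant s0 a b c"
proof -
  let ?C = "\<bar>a\<bar> + \<bar>b\<bar> + (1 + \<alpha>) * c"
  have s: "s0 \<le> s" "s \<le> 1" and v2: "0 < v $ 2" "v $ 2 < c * s" and t: "1 - \<alpha> * s < t" "t \<le> 1"
    and ab: "a \<le> s * v $ 1 + t * v $ 2" "s * v $ 1 + t * v $ 2 < b"
    using st by (auto simp: hit_set_def time_set_def)
  have "c * s \<le> c * 1" using c s by (intro mult_left_mono) auto
  then have v2c: "v $ 2 \<le> c" using v2 by simp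
  have "\<alpha> * s \<le> \<alpha> * 1" using \<alpha>_pos s by (intro mult_left_mono) auto
  then have "\<bar>t\<bar> \<le> 1 + \<alpha>" using t \<alpha>_pos by (intro abs_leI) linarith+
  then have "\<bar>t * v $ 2\<bar> \<le> (1 + \<alpha>) * c"
    unfolding abs_mult using v2 v2c \<alpha>_pos by (intro mult_mono) auto
  then have "\<bar>s * v $ 1\<bar> \<le> ?C" using ab by linarith
  moreover have "s0 * \<bar>v $ 1\<bar> \<le> \<bar>s * v $ 1\<bar>"
    unfolding abs_mult using s s0 by (intro mult_right_mono) auto
  ultimately have "s0 * \<bar>v $ 1\<bar> \<le> ?C" by linarith
  then have "\<bar>v $ 1\<bar> \<le> ?C / s0" using s0 by (simp add: pos_le_divide_eq mult.commute)
  moreover have "norm v \<le> \<bar>v $ 1\<bar> + \<bar>v $ 2\<bar>" using norm_le_l1_cart[of v] by (simp add: sum_2)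
  ultimately show ?thesis using v v2 v2c by (simp add: relevant_def)
qed

lemma hit_set_subset: "0 < s0 \<Longrightarrow> hit_set s0 a b c v \<subseteq> Omega0 \<alpha> s0"
  by (auto simp: hit_set_def Omega0_def Omega_def time_set_def)

text \<open>
  Counting image vectors in the box amounts to counting hit sets that contain \<open>(s, t)\<close>, which turns
  the orbit count into a finite sum of indicator functions.
\<close>

lemma orbit_hits:
  assumes s0: "0 < s0" and c: "0 < c" and st: "(s, t) \<in> Omega0 \<alpha> s0"
  shows "(*v) (p_matrix s t) ` \<Lambda> \<inter> box_A a b c =
      (*v) (p_matrix s t) ` {v \<in> relevant s0 a b c. (s, t) \<in> hit_set s0 a b c v}"
    and "inj ((*v) (p_matrix s t))"
proof -
  have s: "s > 0" "s0 \<le> s" "s \<le> 1" "1 - \<alpha> * s < t" "t \<le> 1"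
    using st s0 by (auto simp: Omega0_def Omega_def)
  have comp: "(p_matrix s t *v v) $ 1 = s * v $ 1 + t * v $ 2" "(p_matrix s t *v v) $ 2 = v $ 2 / s" for v
    by (simp_all add: p_matrix_def matrix_vector_mult_def sum_2 divide_inverse)
  have hit: "p_matrix s t *v v \<in> box_A a b c \<longleftrightarrow> (s, t) \<in> hit_set s0 a b c v" for v
    using s by (auto simp: box_A_def comp hit_set_def time_set_def pos_divide_less_eq zero_less_divide_iff)
  show "(*v) (p_matrix s t) ` \<Lambda> \<inter> box_A a b c =
      (*v) (p_matrix s t) ` {v \<in> relevant s0 a b c. (s, t) \<in> hit_set s0 a b c v}"
  proof (intro equalityI subsetI)
    fix w assume "w \<in> (*v) (p_matrix s t) ` \<Lambda> \<inter> box_A a b c"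
    then obtain v where v: "v \<in> \<Lambda>" "w = p_matrix s t *v v" "(s, t) \<in> hit_set s0 a b c v"
      using hit by blast
    then show "w \<in> (*v) (p_matrix s t) ` {v \<in> relevant s0 a b c. (s, t) \<in> hit_set s0 a b c v}"
      using hit_set_relevant[OF v(1) s0 c v(3)] by blast
  next
    fix w assume "w \<in> (*v) (p_matrix s t) ` {v \<in> relevant s0 a b c. (s, t) \<in> hit_set s0 a b c v}"
    then show "w \<in> (*v) (p_matrix s t) ` \<Lambda> \<inter> box_A a b c"
      using hit by (auto simp: relevant_def)
  qed
  show "inj ((*v) (p_matrix s t))"
  proof (rule injI)
    fix v w assume eq: "p_matrix s t *v v = p_matrix s t *v w"
    have "v $ 2 / s = w $ 2 / s" using comp(2) eq by metis
    then have 2: "v $ 2 = w $ 2" using s(1) by simp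
    have "s * v $ 1 + t * v $ 2 = s * w $ 1 + t * w $ 2" using comp(1) eq by metis
    then show "v = w" using 2 s(1) by (simp add: vector_eq_iff_2)
  qed
qed

lemma orbit_count_eq:
  assumes s0: "0 < s0" and c: "0 < c"
  shows "indicator (Omega0 \<alpha> s0) x * orbit_count \<Lambda> (box_A a b c) x =
    (\<Sum>v\<in>relevant s0 a b c. indicator (hit_set s0 a b c v) x)"
proof (cases "x \<in> Omega0 \<alpha> s0")
  case True
  obtain s t where x: "x = (s, t)" by force
  then have st: "(s, t) \<in> Omega0 \<alpha> s0" using True by simp
  have "card ((*v) (p_matrix s t) ` \<Lambda> \<inter> box_A a b c) = card {v \<in> relevant s0 a b c. x \<in> hit_set s0 a b c v}"
    unfolding orbit_hits(1)[OF s0 c st] x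
    by (rule card_image) (rule inj_on_subset[OF orbit_hits(2)[OF s0 c st] subset_UNIV])
  moreover have "{v \<in> relevant s0 a b c. x \<in> hit_set s0 a b c v} = relevant s0 a b c \<inter> {v. x \<in> hit_set s0 a b c v}"
    by blast
  ultimately show ?thesis
    using True finite_relevant
    by (simp add: orbit_count_def x indicator_def of_bool_def sum.If_cases)
next
  case False
  then have "x \<notin> hit_set s0 a b c v" for v using hit_set_subset[OF s0] by blast
  then show ?thesis using False by simp
qed

lemma time_set_measurable [measurable]: "time_set s a b v \<in> sets borel"
proof -
  have "{t \<in> space borel. t \<in> {1 - \<alpha> * s<..1} \<and> a \<le> s * v $ 1 + t * v $ 2 \<and> s * v $ 1 + t * v $ 2 < b} \<in> sets borel"
    by measurable
  then show ?thesis by (simp add: time_set_def)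
qed

lemma emeasure_time_set: "emeasure lborel (time_set s a b v) = ennreal (measure lborel (time_set s a b v))"
proof (rule emeasure_eq_ennreal_measure)
  have "bounded (time_set s a b v)"
    by (rule bounded_subset[OF compact_imp_bounded[OF compact_Icc[of "1 - \<alpha> * s" 1]]]) (auto simp: time_set_def)
  then show "emeasure lborel (time_set s a b v) \<noteq> top"
    using emeasure_bounded_finite by (simp add: less_top)
qed

lemma hit_set_measurable [measurable]: "hit_set s0 a b c v \<in> sets (borel \<Otimes>\<^sub>M borel)"
proof -
  have "hit_set s0 a b c v = {x \<in> space (borel \<Otimes>\<^sub>M borel). s0 \<le> fst x \<and> fst x \<le> 1 \<and> 0 < v $ 2 \<and> v $ 2 < c * fst x \<and>
      1 - \<alpha> * fst x < snd x \<and> snd x \<le> 1 \<and> a \<le> fst x * v $ 1 + snd x * v $ 2 \<and> fst x * v $ 1 + snd x * v $ 2 < b}"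
    by (auto simp: hit_set_def time_set_def space_pair_measure)
  also have "\<dots> \<in> sets (borel \<Otimes>\<^sub>M borel)" by measurable
  finally show ?thesis .
qed

text \<open>
  Grouping the vectors by height reduces the fibre over \<open>s\<close> to the heights below \<open>c * s\<close>, each of
  which contributes \<open>b - a\<close> times its weight.
\<close>

lemma sum_emeasure_fibres:
  assumes s0: "0 < s0" and ab: "a < b" and c: "0 < c"
  shows "(\<Sum>v\<in>relevant s0 a b c. emeasure lborel (Pair s -` hit_set s0 a b c v)) =
    ennreal ((b - a) * \<Phi> (c * s)) * indicator {s0..1} s"
proof (cases "s \<in> {s0..1}")
  case True
  then have s: "s0 \<le> s" "s \<le> 1" "0 < s" using s0 by auto
  let ?L = "relevant s0 a b c" let ?L' = "{v \<in> ?L. 0 < v $ 2 \<and> v $ 2 < c * s}"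
  let ?f = "\<lambda>v. measure lborel (time_set s a b v)"
  have "(\<Sum>v\<in>?L. emeasure lborel (Pair s -` hit_set s0 a b c v)) =
      (\<Sum>v\<in>?L. if 0 < v $ 2 \<and> v $ 2 < c * s then ennreal (?f v) else 0)"
  proof (rule sum.cong[OF refl])
    fix v
    have "Pair s -` hit_set s0 a b c v = (if 0 < v $ 2 \<and> v $ 2 < c * s then time_set s a b v else {})"
      using s by (auto simp: hit_set_def)
    then show "emeasure lborel (Pair s -` hit_set s0 a b c v) =
        (if 0 < v $ 2 \<and> v $ 2 < c * s then ennreal (?f v) else 0)"
      by (simp add: emeasure_time_set)
  qed
  also have "\<dots> = (\<Sum>v\<in>?L'. ennreal (?f v))"
    by (rule sum.inter_filter[symmetric]) (rule finite_relevant)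
  also have "\<dots> = ennreal (\<Sum>v\<in>?L'. ?f v)" by (rule sum_ennreal) simp
  also have "(\<Sum>v\<in>?L'. ?f v) = (\<Sum>j\<in>Hb (c * s). \<Sum>v\<in>{v \<in> ?L'. v $ 2 = j}. ?f v)"
  proof (rule sum.group[symmetric])
    show "finite ?L'" using finite_relevant by simp
    show "(\<lambda>v. v $ 2) ` ?L' \<subseteq> Hb (c * s)" by (auto simp: heights_below_def heights_def relevant_def)
  qed (rule finite_heights_below)
  also have "\<dots> = (\<Sum>j\<in>Hb (c * s). (b - a) * weight j)"
  proof (rule sum.cong[OF refl])
    fix j assume "j \<in> Hb (c * s)"
    then have j: "0 < j" "j < c * s" by (auto simp: heights_below_def)
    then have "{v \<in> ?L'. v $ 2 = j} = {v \<in> ?L. v $ 2 = j}" by auto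
    moreover have "(\<Sum>v\<in>{v \<in> ?L. v $ 2 = j}. ?f v) = (b - a) * weight j"
    proof (rule sum_measure_time_set_height[OF s(3) ab j(1) finite_relevant])
      show "?L \<subseteq> \<Lambda>" by (auto simp: relevant_def)
      fix v assume v: "v \<in> \<Lambda>" "v $ 2 = j" "time_set s a b v \<noteq> {}"
      then obtain t where "t \<in> time_set s a b v" by blast
      then have "(s, t) \<in> hit_set s0 a b c v" using v j s by (simp add: hit_set_def)
      then show "v \<in> ?L" by (rule hit_set_relevant[OF v(1) s0 c])
    qed
    ultimately show "(\<Sum>v\<in>{v \<in> ?L'. v $ 2 = j}. ?f v) = (b - a) * weight j" by simp
  qed
  also have "\<dots> = (b - a) * \<Phi> (c * s)" by (simp add: phi_sum_eq sum_distrib_left)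
  finally show ?thesis using True by simp
next
  case False
  then have "Pair s -` hit_set s0 a b c v = {}" for v by (auto simp: hit_set_def)
  then show ?thesis using False by simp
qed

text \<open>
  The height \<open>j\<close> contributes to \<open>\<Phi> (c * s)\<close> exactly for \<open>s\<close> beyond \<open>j / c\<close>, so integrating over
  \<open>{s0..1}\<close> gives its weight times \<open>1 - max s0 (j / c)\<close>.
\<close>

lemma nn_integral_phi_sum:
  assumes s0: "0 < s0" "s0 < 1" and k: "0 \<le> k" and c: "0 < c"
  shows "(\<integral>\<^sup>+s. ennreal (k * \<Phi> (c * s)) * indicator {s0..1} s \<partial>lborel) =
    ennreal (k * ((phi_integral c - phi_integral (c * s0)) / c))"
proof -
  define K where "K j = {s \<in> {s0..1}. j < c * s}" for j
  have K: "K j \<in> sets borel" "emeasure lborel (K j) = ennreal (1 - max s0 (j / c))" if j: "j \<in> Hb c" for j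
  proof -
    have jc: "j / c < 1" using j c by (simp add: heights_below_def)
    have "K j = {s \<in> {s0..1}. j / c < s}" using c by (simp add: K_def pos_divide_less_eq mult.commute)
    then consider "j / c < s0" "K j = {s0..1}" | "s0 \<le> j / c" "K j = {j / c<..1}" by force
    then have "K j \<in> sets borel \<and> emeasure lborel (K j) = ennreal (1 - max s0 (j / c))"
    proof cases
      case 1
      then show ?thesis using s0 by (simp add: max_def)
    next
      case 2
      then show ?thesis using jc by (simp add: max_def)
    qed
    then show "K j \<in> sets borel" "emeasure lborel (K j) = ennreal (1 - max s0 (j / c))" by blast+
  qed
  have pt: "ennreal (k * \<Phi> (c * s)) * indicator {s0..1} s = (\<Sum>j\<in>Hb c. ennreal (k * weight j) * indicator (K j) s)" for s
  proof (cases "s \<in> {s0..1}")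
    case True
    then have "c * s \<le> c * 1" using c by (intro mult_left_mono) auto
    then have "Hb (c * s) = {j \<in> Hb c. j < c * s}" by (auto simp: heights_below_def)
    then have "k * \<Phi> (c * s) = (\<Sum>j\<in>{j \<in> Hb c. j < c * s}. k * weight j)"
      by (simp only: phi_sum_eq sum_distrib_left)
    also have "\<dots> = (\<Sum>j\<in>Hb c. if j < c * s then k * weight j else 0)"
      by (rule sum.inter_filter) (rule finite_heights_below)
    also have "ennreal \<dots> = (\<Sum>j\<in>Hb c. ennreal (if j < c * s then k * weight j else 0))"
      using k weight_nonneg by (intro sum_ennreal[symmetric]) auto
    also have "\<dots> = (\<Sum>j\<in>Hb c. ennreal (k * weight j) * indicator (K j) s)"
      using True by (intro sum.cong) (auto simp: K_def)
    finally show ?thesis using True by simp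
  qed (auto simp: K_def)
  have "(\<integral>\<^sup>+s. ennreal (k * \<Phi> (c * s)) * indicator {s0..1} s \<partial>lborel) =
      (\<Sum>j\<in>Hb c. \<integral>\<^sup>+s. ennreal (k * weight j) * indicator (K j) s \<partial>lborel)"
    unfolding pt using K(1) by (intro nn_integral_sum) auto
  also have "\<dots> = (\<Sum>j\<in>Hb c. ennreal (k * weight j * (1 - max s0 (j / c))))"
  proof (rule sum.cong[OF refl])
    fix j assume j: "j \<in> Hb c"
    have "(\<integral>\<^sup>+s. ennreal (k * weight j) * indicator (K j) s \<partial>lborel) = ennreal (k * weight j) * emeasure lborel (K j)"
      by (rule nn_integral_cmult_indicator) (simp add: K(1)[OF j])
    also have "\<dots> = ennreal (k * weight j * (1 - max s0 (j / c)))"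
      unfolding K(2)[OF j] using k weight_nonneg[OF j] by (intro ennreal_mult'[symmetric]) simp
    finally show "(\<integral>\<^sup>+s. ennreal (k * weight j) * indicator (K j) s \<partial>lborel) = ennreal (k * weight j * (1 - max s0 (j / c)))" .
  qed
  also have "\<dots> = ennreal (\<Sum>j\<in>Hb c. k * weight j * (1 - max s0 (j / c)))"
  proof (rule sum_ennreal)
    fix j assume j: "j \<in> Hb c"
    then have "max s0 (j / c) \<le> 1" using c s0 by (simp add: heights_below_def)
    then show "0 \<le> k * weight j * (1 - max s0 (j / c))" using k weight_nonneg[OF j] by simp
  qed
  also have "(\<Sum>j\<in>Hb c. k * weight j * (1 - max s0 (j / c))) = k * ((phi_integral c - phi_integral (c * s0)) / c)"
  proof -
    have cs: "c * s0 < c * 1" using c s0 by (intro mult_strict_left_mono) auto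
    have "phi_integral (c * s0) = (\<Sum>j\<in>Hb c. weight j * max (c * s0 - j) 0)"
      unfolding phi_integral_def
    proof (rule sum.mono_neutral_cong_left)
      show "Hb (c * s0) \<subseteq> Hb c" using cs by (auto simp: heights_below_def)
      show "finite (Hb c)" by (rule finite_heights_below)
    qed (auto simp: heights_below_def)
    then have "phi_integral c - phi_integral (c * s0) = (\<Sum>j\<in>Hb c. weight j * (c - j) - weight j * max (c * s0 - j) 0)"
      by (simp add: phi_integral_def sum_subtractf)
    also have "\<dots> = (\<Sum>j\<in>Hb c. c * (weight j * (1 - max s0 (j / c))))"
    proof (rule sum.cong[OF refl])
      fix j
      have m: "c * max s0 (j / c) = max (c * s0) j" using c by (simp add: max_mult_distrib_left)
      have "c * (weight j * (1 - max s0 (j / c))) = weight j * (c - c * max s0 (j / c))"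
        by (simp add: algebra_simps)
      also have "\<dots> = weight j * (c - j) - weight j * max (c * s0 - j) 0"
        unfolding m by (simp add: max_def algebra_simps)
      finally show "weight j * (c - j) - weight j * max (c * s0 - j) 0 = c * (weight j * (1 - max s0 (j / c)))"
        by simp
    qed
    finally show ?thesis using c by (simp add: sum_distrib_left[symmetric] mult.assoc)
  qed
  finally show ?thesis .
qed

lemma Omega_measurable: "Omega \<alpha> \<in> sets (borel \<Otimes>\<^sub>M borel)"
proof -
  have "Omega \<alpha> = {x \<in> space (borel \<Otimes>\<^sub>M borel). 0 < fst x \<and> fst x \<le> 1 \<and> 1 - \<alpha> * fst x < snd x \<and> snd x \<le> 1}"
    by (auto simp: Omega_def space_pair_measure)
  also have "\<dots> \<in> sets (borel \<Otimes>\<^sub>M borel)" by measurable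
  finally show ?thesis .
qed

lemma emeasure_Omega: "emeasure lborel (Omega \<alpha>) = ennreal (\<alpha> / 2)"
proof -
  \<comment> \<open>The fibre over \<open>0\<close> is empty, but the formula is correct there because it gives the value \<open>0\<close>.\<close>
  have fib: "emeasure lborel (Pair s -` Omega \<alpha>) = ennreal (\<alpha> * s) * indicator {0..1} s" for s
  proof (cases "0 < s \<and> s \<le> 1")
    case True
    then have "Pair s -` Omega \<alpha> = {1 - \<alpha> * s<..1}" by (auto simp: Omega_def)
    then show ?thesis using True \<alpha>_pos by simp
  next
    case False
    then have "Pair s -` Omega \<alpha> = {}" by (auto simp: Omega_def)
    then show ?thesis using False by (cases "s = 0") auto
  qed
  have "emeasure lborel (Omega \<alpha>) = (\<integral>\<^sup>+s. emeasure lborel (Pair s -` Omega \<alpha>) \<partial>lborel)"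
    using lborel.emeasure_pair_measure_alt[of "Omega \<alpha>" lborel] Omega_measurable
    by (simp add: lborel_prod borel_prod)
  also have "\<dots> = (\<integral>\<^sup>+s. ennreal (\<alpha> * s) * indicator {0..1} s \<partial>lborel)" by (simp add: fib)
  also have "\<dots> = ennreal (\<alpha> * 1\<^sup>2 / 2 - \<alpha> * 0\<^sup>2 / 2)"
    using \<alpha>_pos by (intro nn_integral_FTC_Icc) (auto intro!: derivative_eq_intros)
  finally show ?thesis by simp
qed

theorem orbit_count_integral:
  assumes s0: "0 < s0" "s0 < 1" and ab: "a < b" and c: "0 < c"
  shows "\<forall>(s, t) \<in> Omega0 \<alpha> s0. finite ((*v) (p_matrix s t) ` \<Lambda> \<inter> box_A a b c)"
    and "set_integrable (Omega_measure \<alpha>) (Omega0 \<alpha> s0) (orbit_count \<Lambda> (box_A a b c))"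
    and "(LINT x:Omega0 \<alpha> s0|Omega_measure \<alpha>. orbit_count \<Lambda> (box_A a b c) x) =
      2 * (b - a) / \<alpha> * ((phi_integral c - phi_integral (c * s0)) / c)"
proof -
  let ?L = "relevant s0 a b c" let ?S = "hit_set s0 a b c" let ?M = "Omega_measure \<alpha>"
  show "\<forall>(s, t) \<in> Omega0 \<alpha> s0. finite ((*v) (p_matrix s t) ` \<Lambda> \<inter> box_A a b c)"
  proof (intro ballI, clarify)
    fix s t assume "(s, t) \<in> Omega0 \<alpha> s0"
    from orbit_hits(1)[OF s0(1) c this, of a b]
    show "finite ((*v) (p_matrix s t) ` \<Lambda> \<inter> box_A a b c)" using finite_relevant by simp
  qed
  have S: "?S v \<in> sets borel" for v using hit_set_measurable unfolding borel_prod .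
  have Om: "Omega \<alpha> \<in> sets borel" using Omega_measurable unfolding borel_prod .
  have eO: "emeasure lborel (Omega \<alpha>) \<noteq> 0" "emeasure lborel (Omega \<alpha>) \<noteq> \<infinity>"
    using \<alpha>_pos by (simp_all add: emeasure_Omega)
  have mO: "measure lborel (Omega \<alpha>) = \<alpha> / 2" using \<alpha>_pos by (simp add: measure_def emeasure_Omega)
  have sub: "?S v \<subseteq> Omega \<alpha>" for v 
    by (rule subset_trans[OF hit_set_subset[OF s0(1)]]) (auto simp: Omega0_def)
  have mS: "measure ?M (?S v) = measure lborel (?S v) / (\<alpha> / 2)" for v
    using measure_uniform_measure[OF eO, of "?S v"] S sub[of v]
    by (simp add: Omega_measure_def mO Int_absorb1)
  have setsM: "?S v \<in> sets ?M" for v using S by (simp add: Omega_measure_def)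
  have fin: "emeasure lborel (?S v) \<noteq> \<infinity>" for v
  proof -
    have "emeasure lborel (?S v) \<le> emeasure lborel (Omega \<alpha>)"
      using sub Om by (intro emeasure_mono) simp_all
    then show ?thesis using eO(2) by (auto simp: top_unique)
  qed
  have "emeasure ?M (?S v) = emeasure lborel (?S v) / emeasure lborel (Omega \<alpha>)" for v
    using emeasure_uniform_measure[of "Omega \<alpha>" lborel "?S v"] S Om sub[of v]
    by (simp add: Omega_measure_def Int_absorb1)
  then have "emeasure ?M (?S v) < \<infinity>" for v
    using fin eO by (simp add: less_top[symmetric] ennreal_divide_eq_top_iff)
  then have int: "integrable ?M (\<lambda>x. indicator (?S v) x :: real)" for v
    using setsM by (intro integrable_real_indicator) auto
  have eq: "(\<lambda>x. indicator (Omega0 \<alpha> s0) x *\<^sub>R orbit_count \<Lambda> (box_A a b c) x) =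
      (\<lambda>x. \<Sum>v\<in>?L. indicator (?S v) x)"
    using orbit_count_eq[OF s0(1) c] by (simp add: fun_eq_iff)
  show "set_integrable ?M (Omega0 \<alpha> s0) (orbit_count \<Lambda> (box_A a b c))"
    unfolding set_integrable_def eq by (intro Bochner_Integration.integrable_sum int)
  have total: "(\<Sum>v\<in>?L. emeasure lborel (?S v)) = ennreal ((b - a) * ((phi_integral c - phi_integral (c * s0)) / c))"
  proof -
    have "(\<Sum>v\<in>?L. emeasure lborel (?S v)) = (\<Sum>v\<in>?L. \<integral>\<^sup>+s. emeasure lborel (Pair s -` ?S v) \<partial>lborel)"
      using lborel.emeasure_pair_measure_alt[of "?S v" lborel for v] hit_set_measurable
      by (simp add: lborel_prod borel_prod)
    also have "\<dots> = (\<integral>\<^sup>+s. (\<Sum>v\<in>?L. emeasure lborel (Pair s -` ?S v)) \<partial>lborel)"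
    proof (rule nn_integral_sum[symmetric])
      fix v
      have "?S v \<in> sets (lborel \<Otimes>\<^sub>M lborel)" using S by (simp add: lborel_prod)
      then show "(\<lambda>s. emeasure lborel (Pair s -` ?S v)) \<in> borel_measurable lborel"
        by (rule lborel.measurable_emeasure_Pair)
    qed
    also have "\<dots> = ennreal ((b - a) * ((phi_integral c - phi_integral (c * s0)) / c))"
      unfolding sum_emeasure_fibres[OF s0(1) ab c]
      using ab by (intro nn_integral_phi_sum s0 c) simp
    finally show ?thesis .
  qed
  have nonneg: "0 \<le> (b - a) * ((phi_integral c - phi_integral (c * s0)) / c)"
  proof -
    have "phi_integral (c * s0) \<le> (\<Sum>j\<in>Hb (c * s0). weight j * (c - j))"
      unfolding phi_integral_def using s0 c weight_nonneg
      by (intro sum_mono mult_left_mono) (auto simp: mult_le_cancel_left1)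
    also have "\<dots> \<le> phi_integral c"
      unfolding phi_integral_def
    proof (rule sum_mono2[OF finite_heights_below])
      have "c * s0 < c * 1" using c s0 by (intro mult_strict_left_mono) auto
      then show "Hb (c * s0) \<subseteq> Hb c" by (auto simp: heights_below_def)
    qed (use weight_nonneg in \<open>auto simp: heights_below_def\<close>)
    finally show ?thesis using ab c by simp
  qed
  have "ennreal (\<Sum>v\<in>?L. measure lborel (?S v)) = (\<Sum>v\<in>?L. emeasure lborel (?S v))"
    using fin by (subst sum_ennreal[symmetric]) (auto simp: emeasure_eq_ennreal_measure)
  then have msum: "(\<Sum>v\<in>?L. measure lborel (?S v)) = (b - a) * ((phi_integral c - phi_integral (c * s0)) / c)"
    using total nonneg by (simp add: ennreal_inj sum_nonneg)
  have "(LINT x:Omega0 \<alpha> s0|?M. orbit_count \<Lambda> (box_A a b c) x) = (\<Sum>v\<in>?L. measure ?M (?S v))"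
    unfolding set_lebesgue_integral_def eq
    using int setsM by (subst Bochner_Integration.integral_sum) (auto simp: sets.Int_space_eq2)
  also have "\<dots> = (\<Sum>v\<in>?L. measure lborel (?S v)) / (\<alpha> / 2)"
    by (simp only: mS sum_divide_distrib)
  also have "\<dots> = 2 * (b - a) / \<alpha> * ((phi_integral c - phi_integral (c * s0)) / c)"
    unfolding msum using c \<alpha>_pos by (simp add: field_simps)
  finally show "(LINT x:Omega0 \<alpha> s0|?M. orbit_count \<Lambda> (box_A a b c) x) =
      2 * (b - a) / \<alpha> * ((phi_integral c - phi_integral (c * s0)) / c)" .
qed

end

section \<open>Lattice surfaces\<close>

lemma upper_unipotent_vec: "upper_unipotent \<kappa> *v v = vector [v $ 1 + \<kappa> * v $ 2, v $ 2]"
  by (simp add: vector_eq_iff_2 matrix_vector_2 upper_unipotent_def)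

text \<open>
  The elements \<open>g ** upper_unipotent (n * \<alpha>) ** g\<close> move a horizontal vector to heights that grow
  linearly in \<open>n\<close>, since their lower left entry is \<open>g $ 2 $ 1 * (g $ 1 $ 1 + g $ 2 $ 2)\<close> plus
  \<open>n * \<alpha> * (g $ 2 $ 1)\<^sup>2\<close>.  The sign is corrected by \<open>- mat 1\<close>.
\<close>

lemma heights_unbounded_of_orbit:
  assumes inv: "\<And>h v. h \<in> \<Gamma> \<Longrightarrow> v \<in> \<Lambda> \<Longrightarrow> h *v v \<in> \<Lambda>"
    and minus: "- mat 1 \<in> \<Gamma>" and u: "\<And>n :: int. upper_unipotent (of_int n * \<alpha>) \<in> \<Gamma>"
    and \<alpha>: "\<alpha> > 0" and g: "g \<in> \<Gamma>" "g $ 2 $ 1 \<noteq> 0"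
    and v: "v \<in> \<Lambda>" "v $ 1 \<noteq> 0" "v $ 2 = 0"
  shows "\<exists>j\<in>heights \<Lambda>. R < j"
proof -
  define A where "A = g $ 2 $ 1 * (g $ 1 $ 1 + g $ 2 $ 2) * v $ 1"
  define B where "B = \<alpha> * (g $ 2 $ 1)\<^sup>2 * v $ 1"
  have B: "\<bar>B\<bar> > 0" using \<alpha> g v by (simp add: B_def)
  obtain n :: int where "(\<bar>R\<bar> + \<bar>A\<bar>) / \<bar>B\<bar> < of_int n" using ex_less_of_int by blast
  then have "\<bar>R\<bar> + \<bar>A\<bar> < of_int n * \<bar>B\<bar>" by (rule iffD1[OF pos_divide_less_eq[OF B]])
  also have "\<dots> \<le> \<bar>of_int n * B\<bar>" unfolding abs_mult by (intro mult_right_mono) auto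
  also have "\<dots> \<le> \<bar>A + of_int n * B\<bar> + \<bar>A\<bar>" by linarith
  finally have big: "\<bar>R\<bar> < \<bar>A + of_int n * B\<bar>" by simp
  let ?w = "g *v (upper_unipotent (of_int n * \<alpha>) *v (g *v v))"
  have w: "?w \<in> \<Lambda>" using inv g(1) u v(1) by blast
  have w2: "?w $ 2 = A + of_int n * B"
    using v(3) by (simp add: matrix_vector_2 upper_unipotent_vec A_def B_def power2_eq_square algebra_simps)
  have "- mat 1 *v ?w = - ?w" by (simp add: vector_eq_iff_2 matrix_vector_2 mat_def)
  then have nw: "- ?w \<in> \<Lambda>" using inv[OF minus w] by simp
  show ?thesis
  proof (cases "0 < A + of_int n * B")
    case True
    then have "A + of_int n * B \<in> heights \<Lambda>" using w w2 unfolding heights_def by force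
    then show ?thesis using big True by (intro bexI) auto
  next
    case False
    then have "0 < (- ?w) $ 2" using big w2 by simp
    then have "(- ?w) $ 2 \<in> heights \<Lambda>" using nw unfolding heights_def by blast
    moreover have "R < (- ?w) $ 2" using big False w2 by simp
    ultimately show ?thesis by blast
  qed
qed

lemma visible_holonomy_discrete_unipotent_invariant:
  assumes X: "lattice_surface X" and minus: "- mat 1 \<in> veech_group X"
    and width: "stabilizer_width (veech_group X) \<alpha>"
    and horizontal: "\<exists>v\<in>holonomy_vectors X. v $ 2 = 0 \<and> norm v = 1"
    and no_shorter: "\<forall>v\<in>holonomy_vectors X. v $ 2 = 0 \<longrightarrow> 1 \<le> norm v"
  shows "discrete_unipotent_invariant (visible_holonomy X) \<alpha>"
proof
  let ?\<Lambda> = "visible_holonomy X"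
  have tX: "translation_surface X" and lat: "lattice_SL2 (veech_group X)"
    using X by (simp_all add: lattice_surface_def)
  have sub: "SL2_subgroup (veech_group X)" using lat by (simp add: lattice_SL2_def)
  show \<alpha>: "\<alpha> > 0" using width by (simp add: stabilizer_width_def)
  have u: "upper_unipotent (of_int n * \<alpha>) \<in> veech_group X" for n :: int
    using width by (auto simp: stabilizer_width_def set_eq_iff)
  show "vector [v $ 1 + of_int n * \<alpha> * v $ 2, v $ 2] \<in> ?\<Lambda>" if "v \<in> ?\<Lambda>" for v n
    using visible_holonomy_veech[OF tX sub u that] by (simp add: upper_unipotent_vec)
  show "finite {v \<in> ?\<Lambda>. norm v \<le> R}" for R
    by (rule finite_subset[OF _ finite_holonomy_vectors_bounded[OF tX, of R]])
      (auto simp: visible_holonomy_def)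
  show "\<exists>j\<in>heights ?\<Lambda>. R < j" for R
  proof -
    obtain g where g: "g \<in> veech_group X" "g $ 2 $ 1 \<noteq> 0"
      using lattice_not_upper_triangular[OF lat minus width] by blast
    obtain v where v: "v \<in> holonomy_vectors X" "v $ 2 = 0" "norm v = 1" using horizontal by blast
    have "norm v \<le> norm (r *\<^sub>R v)" if "r > 0" "r *\<^sub>R v \<in> holonomy_vectors X" for r
      using no_shorter[rule_format, OF that(2)] v by simp
    then have "v \<in> ?\<Lambda>" using v by (simp add: visible_holonomy_def)
    moreover have "v $ 1 \<noteq> 0"
    proof
      assume "v $ 1 = 0"
      then have "v = 0" using v(2) by (simp add: vector_eq_iff_2)
      then show False using v(3) by simp
    qed
    ultimately show ?thesis
      using heights_unbounded_of_orbit[OF visible_holonomy_veech[OF tX sub] minus u \<alpha> g] v(2) by blast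
  qed
qed

theorem theorem1p2:
  fixes X :: "'a::t2_space form_surface"
    and \<Gamma> :: "(real^2^2) set" and \<Lambda> :: "(real^2) set"
    and \<alpha> s0 a b c :: real
  assumes surface: "lattice_surface X"
    and \<Gamma>_def: "\<Gamma> = veech_group X"
    and one_cusp: "card (cusps \<Gamma>) = 1"
    and minus_id: "- mat 1 \<in> \<Gamma>"
    and horizontal: "\<exists>v \<in> holonomy_vectors X. v $ 2 = 0 \<and> norm v = 1"
    and no_shorter: "\<forall>v \<in> holonomy_vectors X. v $ 2 = 0 \<longrightarrow> 1 \<le> norm v"
    and \<Lambda>_def: "\<Lambda> = visible_holonomy X"
    and width: "stabilizer_width \<Gamma> \<alpha>"
    and s0: "0 < s0" "s0 < 1"
    and A: "a < b" "0 < c" "b - a < zeta \<Lambda> 1 * \<alpha> * s0"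
  shows "(\<forall>(s, t) \<in> Omega0 \<alpha> s0. finite ((*v) (p_matrix s t) ` \<Lambda> \<inter> box_A a b c)) \<and>
    set_integrable (Omega_measure \<alpha>) (Omega0 \<alpha> s0) (orbit_count \<Lambda> (box_A a b c)) \<and>
    2 * (b - a) / \<alpha> * I2 \<Lambda> \<alpha> c s0
      \<le> (LINT x:Omega0 \<alpha> s0|Omega_measure \<alpha>. orbit_count \<Lambda> (box_A a b c) x) \<and>
    (c * s0 \<notin> heights \<Lambda> \<longrightarrow>
      (LINT x:Omega0 \<alpha> s0|Omega_measure \<alpha>. orbit_count \<Lambda> (box_A a b c) x)
        = 2 * (b - a) / \<alpha> * (I1 \<Lambda> \<alpha> c s0 + I2 \<Lambda> \<alpha> c s0 + I3 \<Lambda> \<alpha> c)) \<and>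
    (c * s0 \<in> heights \<Lambda> \<longrightarrow>
      (LINT x:Omega0 \<alpha> s0|Omega_measure \<alpha>. orbit_count \<Lambda> (box_A a b c) x)
        = 2 * (b - a) / \<alpha> * (I1_jump \<Lambda> \<alpha> c s0 + I2 \<Lambda> \<alpha> c s0 + I3 \<Lambda> \<alpha> c))"
proof -
  interpret discrete_unipotent_invariant \<Lambda> \<alpha>
    unfolding \<Lambda>_def
    by (rule visible_holonomy_discrete_unipotent_invariant[OF surface minus_id[unfolded \<Gamma>_def]
          width[unfolded \<Gamma>_def] horizontal no_shorter])
  note I = I_sum_eq[OF A(2) s0]
  note count = orbit_count_integral[OF s0 A(1,2)]
  have total: "(phi_integral c - phi_integral (c * s0)) / c =
      I1_jump \<Lambda> \<alpha> c s0 + I2 \<Lambda> \<alpha> c s0 + I3 \<Lambda> \<alpha> c"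
    unfolding I(1-3) by (simp add: diff_divide_distrib)
  have integral: "(LINT x:Omega0 \<alpha> s0|Omega_measure \<alpha>. orbit_count \<Lambda> (box_A a b c) x) =
      2 * (b - a) / \<alpha> * (I1_jump \<Lambda> \<alpha> c s0 + I2 \<Lambda> \<alpha> c s0 + I3 \<Lambda> \<alpha> c)"
    unfolding count(3) total ..
  have "2 * (b - a) / \<alpha> * I2 \<Lambda> \<alpha> c s0 \<le>
      2 * (b - a) / \<alpha> * (I1_jump \<Lambda> \<alpha> c s0 + I2 \<Lambda> \<alpha> c s0 + I3 \<Lambda> \<alpha> c)"
    using I(5,6) A(1) \<alpha>_pos by (intro mult_left_mono) auto
  then show ?thesis using count(1,2) integral I(4) by auto
qed

end
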